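(* Let $C$ be an algebraically closed field of characteristic zero, $k=C(x)$, and let $(\delta,\sigma,\mu)$ be as in one of the cases S, Q, M described in the context. Let $A\in \mathrm{gl}_n(k)$ and $B\in \mathrm{GL}_n(k)$ satisfy the consistency condition $\delta(B)=\mu\,\sigma(A)B-BA$. Then the system $\delta(Y)=AY,\ \sigma(Y)=BY$ is equivalent over $k$ to a system $\delta(Z)=\tilde A Z,\ \sigma(Z)=\tilde B Z$ with $\tilde A\in \mathrm{gl}_n(C)$ and $\tilde B\in \mathrm{GL}_n(k)$. Moreover, this system can be chosen with the following properties: - In case S: $\tilde A$ is diagonal, and $\tilde B\in \mathrm{GL}_n(C)$ is constant, upper triangular and commutes with $\tilde A$. - In case Q: if $\lambda_1,\lambda_2$ are eigenvalues of $\tilde A$, then $\lambda_1-\lambda_2\notin\mathbb{Z}\setminus\{0\}$; and $\tilde B\in \mathrm{GL}_n(C)$ is constant and commutes with $\tilde A$. - In case M: the eigenvalues of $\tilde A$ are rational and lie in the interval $[0,1[$, and there exists a diagonalisable matrix $D$ with integer eigenvalues commuting with $\tilde A$ such that $\tilde A+D$ is conjugate to $q\tilde A$. Furthermore $\tilde B\in \mathrm{GL}_n(C[x,x^{-1}])$, and the exponents $m$ of the powers $x^m$ appearing with nonzero coefficient in $\tilde B$ are integers of the form $m=q\lambda_1-\lambda_2$ with $\lambda_1,\lambda_2$ eigenvalues of $\tilde A$.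
   Context: Cases ($\delta$ is a derivation of $k=C(x)$ with constants $C$, $\sigma$ a $C$-algebra endomorphism of $k$, and $\delta\sigma=\mu\,\sigma\delta$): - Case S: $\delta=d/dx$, $\sigma(x)=x+1$, $\mu=1$. - Case Q: $\delta=x\,d/dx$, $\sigma(x)=qx$ with $q\in C$, $q\neq 0$ and $q$ not a root of unity, $\mu=1$. - Case M: $\delta=x\,d/dx$, $\sigma(x)=x^q$ with an integer $q\ge 2$, $\mu=q$. $\delta$ and $\sigma$ act on matrices entrywise. The system $\delta(Y)=AY,\ \sigma(Y)=BY$ is called equivalent over $k$ to $\delta(Z)=\tilde AZ,\ \sigma(Z)=\tilde BZ$ if there is $G\in \mathrm{GL}_n(k)$ with $\tilde A=\delta(G)G^{-1}+GAG^{-1}$ and $\tilde B=\sigma(G)BG^{-1}$ (gauge transformation $Z=GY$). *)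

theory Defs
  imports
    "HOL-Computational_Algebra.Polynomial_Factorial"
    "Jordan_Normal_Form.Char_Poly"
begin

section \<open>The rational function field \<open>C(x)\<close>\<close>

type_synonym 'c ratfun = "'c poly fract"

definition rf_const :: "'c::field \<Rightarrow> 'c ratfun" where
  "rf_const c = to_fract [:c:]"

definition rf_X :: "'c::field ratfun" where
  "rf_X = to_fract [:0, 1:]"

text \<open>
  The following two functions are defined on the representative \<open>(a, b)\<close>, \<open>b \<noteq> 0\<close>,
  chosen by the quotient construction; the lemmas \<open>rf_deriv_Fract\<close> and \<open>rf_subst_Fract\<close>
  show that the choice does not matter.
\<close>

definition rf_deriv :: "'c::field ratfun \<Rightarrow> 'c ratfun" where
  "rf_deriv f = (case rep_fract f of (a, b) \<Rightarrow> Fract (pderiv a * b - a * pderiv b) (b * b))"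

text \<open>
  Substitution \<open>f(x) \<mapsto> f(s(x))\<close> for a polynomial \<open>s\<close>. It is meaningful only for
  nonconstant \<open>s\<close>, since otherwise \<open>s\<close> may be a pole of \<open>f\<close>.
\<close>

definition rf_subst :: "'c::field poly \<Rightarrow> 'c ratfun \<Rightarrow> 'c ratfun" where
  "rf_subst s f = (case rep_fract f of (a, b) \<Rightarrow> Fract (pcompose a s) (pcompose b s))"


lemma rep_fract_Fract:
  fixes a b :: "'a::idom"
  assumes "rep_fract (Fract a b) = (c, d)" "b \<noteq> 0"
  shows "d \<noteq> 0" "a * d = c * b"
proof -
  have *: "Fract a b = abs_fract (a, b)"
    using assms by (simp add: Fract_def)
  have "fractrel (rep_fract (abs_fract (a, b))) (a, b)"
    by (rule Quotient3_rep_abs[OF Quotient3_fract]) (use assms in simp)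
  thus "d \<noteq> 0" "a * d = c * b"
    using assms by (auto simp: *)
qed

lemma rf_deriv_Fract:
  fixes a b :: "'c::field poly"
  assumes b: "b \<noteq> 0"
  shows "rf_deriv (Fract a b) = Fract (pderiv a * b - a * pderiv b) (b * b)"
proof -
  obtain c d where r: "rep_fract (Fract a b) = (c, d)" by fastforce
  note d = rep_fract_Fract(1)[OF r b] and eq = rep_fract_Fract(2)[OF r b]
  have "pderiv a * d + a * pderiv d = pderiv c * b + c * pderiv b"
    using arg_cong[OF eq, of pderiv] by (simp add: pderiv_mult algebra_simps)
  hence deq: "pderiv a * d = pderiv c * b + c * pderiv b - a * pderiv d"
    by (simp add: algebra_simps)
  have "(pderiv a * b - a * pderiv b) * (d * d) =
        (pderiv a * d) * (b * d) - (a * d) * (d * pderiv b)"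
    by (simp add: algebra_simps)
  also have "\<dots> = pderiv c * b * b * d + (c * b) * (d * pderiv b) - (a * d) * (b * pderiv d) -
          (a * d) * (d * pderiv b)"
    unfolding deq by (simp add: algebra_simps)
  also have "\<dots> = (pderiv c * d - c * pderiv d) * (b * b)"
    unfolding eq by (simp add: algebra_simps)
  finally show ?thesis
    using b d by (simp add: rf_deriv_def r eq_fract)
qed

lemma rf_const_1: "rf_const 1 = 1"
  by (simp add: rf_const_def to_fract_def One_fract_def one_pCons)

lemma rf_const_add: "rf_const (c + d) = rf_const c + rf_const d"
  by (simp add: rf_const_def flip: to_fract_add)

lemma rf_const_mult: "rf_const (c * d) = rf_const c * rf_const d"
  by (simp add: rf_const_def flip: to_fract_mult)

lemma rf_const_of_nat: "rf_const (of_nat m) = of_nat m"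
  by (induction m) (simp_all add: rf_const_add rf_const_1, simp add: rf_const_def)

lemma rf_deriv_add: "rf_deriv (f + g) = rf_deriv f + rf_deriv g"
  by (cases f, cases g) (simp add: rf_deriv_Fract eq_fract pderiv_mult pderiv_add algebra_simps)

lemma rf_deriv_mult: "rf_deriv (f * g) = rf_deriv f * g + f * rf_deriv g"
  by (cases f, cases g) (simp add: rf_deriv_Fract eq_fract pderiv_mult algebra_simps)

lemma rf_deriv_const: "rf_deriv (rf_const c) = 0"
  by (simp add: rf_const_def to_fract_def rf_deriv_Fract pderiv_pCons eq_fract Zero_fract_def)

lemma rf_deriv_X: "rf_deriv rf_X = 1"
  by (simp add: rf_X_def to_fract_def rf_deriv_Fract pderiv_pCons eq_fract One_fract_def)

lemma rf_subst_Fract: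
  fixes a b :: "'c::field poly"
  assumes s: "degree s > 0" and b: "b \<noteq> 0"
  shows "rf_subst s (Fract a b) = Fract (pcompose a s) (pcompose b s)"
proof -
  obtain c d where r: "rep_fract (Fract a b) = (c, d)" by fastforce
  note d = rep_fract_Fract(1)[OF r b] and eq = rep_fract_Fract(2)[OF r b]
  have "pcompose b s \<noteq> 0" "pcompose d s \<noteq> 0"
    using s b d by (auto simp: pcompose_eq_0_iff)
  moreover have "pcompose a s * pcompose d s = pcompose c s * pcompose b s"
    using eq by (simp flip: pcompose_mult)
  ultimately show ?thesis
    by (simp add: rf_subst_def r eq_fract)
qed

lemma rf_subst_add: "degree s > 0 \<Longrightarrow> rf_subst s (f + g) = rf_subst s f + rf_subst s g"
  by (cases f, cases g) (simp add: rf_subst_Fract pcompose_eq_0_iff pcompose_add pcompose_mult)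

lemma rf_subst_mult: "degree s > 0 \<Longrightarrow> rf_subst s (f * g) = rf_subst s f * rf_subst s g"
  by (cases f, cases g) (simp add: rf_subst_Fract pcompose_mult)

lemma rf_subst_const: "degree s > 0 \<Longrightarrow> rf_subst s (rf_const c) = rf_const c"
  by (simp add: rf_const_def to_fract_def rf_subst_Fract pcompose_1)

lemma rf_subst_X: "degree s > 0 \<Longrightarrow> rf_subst s rf_X = to_fract s"
  by (simp add: rf_X_def to_fract_def rf_subst_Fract pcompose_1 pcompose_pCons)

lemma rf_deriv_subst:
  assumes "degree s > 0"
  shows "rf_deriv (rf_subst s f) = to_fract (pderiv s) * rf_subst s (rf_deriv f)"
proof (cases f)
  case (Fract a b)
  moreover have "pcompose b s \<noteq> 0"
    using assms Fract by (auto simp: pcompose_eq_0_iff)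
  ultimately show ?thesis using assms
    by (simp add: rf_subst_Fract rf_deriv_Fract to_fract_def eq_fract pderiv_pcompose
        pcompose_mult pcompose_diff algebra_simps)
qed

lemma wronskian_degree:
  fixes a b :: "'c::field_char_0 poly"
  assumes eq: "pderiv a * b = a * pderiv b" and a: "a \<noteq> 0" and b: "b \<noteq> 0"
  shows "degree a = degree b"
proof (cases "degree a = 0 \<or> degree b = 0")
  case True
  hence "pderiv a = 0 \<or> pderiv b = 0" by (auto simp: pderiv_eq_0_iff)
  hence "pderiv a = 0 \<and> pderiv b = 0" using eq a b by auto
  thus ?thesis by (auto simp: pderiv_eq_0_iff)
next
  case False
  have "lead_coeff (pderiv a) * lead_coeff b = lead_coeff a * lead_coeff (pderiv b)"
    using arg_cong[OF eq, of lead_coeff] by (simp only: lead_coeff_mult)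
  moreover have "lead_coeff (pderiv p) = of_nat (degree p) * lead_coeff p" if "degree p \<noteq> 0"
    for p :: "'c poly"
    using that by (simp add: degree_pderiv coeff_pderiv flip: of_nat_Suc)
  ultimately show ?thesis using False a b by simp
qed

lemma rf_deriv_eq_0_iff:
  fixes f :: "'c::field_char_0 ratfun"
  shows "rf_deriv f = 0 \<longleftrightarrow> f \<in> range rf_const"
proof
  assume der: "rf_deriv f = 0"
  obtain a b where f: "f = Fract a b" and b: "b \<noteq> 0" by (cases f)
  have w: "pderiv a * b = a * pderiv b"
    using der b by (simp add: f rf_deriv_Fract Zero_fract_def eq_fract)
  define c where "c = lead_coeff a / lead_coeff b"
  define r where "r = a - Polynomial.smult c b"
  have "r = 0"
  proof (rule ccontr)
    assume r: "r \<noteq> 0"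
    hence "a \<noteq> 0" using b by (auto simp: r_def c_def)
    hence ab: "degree a = degree b" using wronskian_degree w b by blast
    have "pderiv r * b = r * pderiv b"
      using w by (simp add: r_def pderiv_diff pderiv_smult algebra_simps)
    hence rb: "degree r = degree b" using wronskian_degree r b by blast
    have "coeff r (degree b) = 0" using b ab by (simp add: r_def c_def)
    thus False using r rb by (metis leading_coeff_0_iff)
  qed
  hence "f = rf_const c" using b by (simp add: f r_def rf_const_def to_fract_def eq_fract)
  thus "f \<in> range rf_const" by blast
qed (auto simp: rf_deriv_const)


section \<open>The three cases\<close>

definition case_S :: "('c::field ratfun \<Rightarrow> 'c ratfun) \<Rightarrow> ('c ratfun \<Rightarrow> 'c ratfun) \<Rightarrow> nat \<Rightarrow> bool" where
  "case_S \<delta> \<sigma> \<mu> \<longleftrightarrow> \<delta> = rf_deriv \<and> \<sigma> = rf_subst [:1, 1:] \<and> \<mu> = 1"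

definition case_Q ::
  "'c::field \<Rightarrow> ('c ratfun \<Rightarrow> 'c ratfun) \<Rightarrow> ('c ratfun \<Rightarrow> 'c ratfun) \<Rightarrow> nat \<Rightarrow> bool" where
  "case_Q q \<delta> \<sigma> \<mu> \<longleftrightarrow>
     q \<noteq> 0 \<and> (\<forall>m::nat. m > 0 \<longrightarrow> q ^ m \<noteq> 1) \<and>
     \<delta> = (\<lambda>f. rf_X * rf_deriv f) \<and> \<sigma> = rf_subst [:0, q:] \<and> \<mu> = 1"

definition case_M ::
  "nat \<Rightarrow> ('c::field ratfun \<Rightarrow> 'c ratfun) \<Rightarrow> ('c ratfun \<Rightarrow> 'c ratfun) \<Rightarrow> nat \<Rightarrow> bool" where
  "case_M q \<delta> \<sigma> \<mu> \<longleftrightarrow>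
     q \<ge> 2 \<and> \<delta> = (\<lambda>f. rf_X * rf_deriv f) \<and> \<sigma> = rf_subst (monom 1 q) \<and> \<mu> = q"

lemma case_S_commute:
  assumes "case_S \<delta> \<sigma> \<mu>"
  shows "\<delta> (\<sigma> f) = of_nat \<mu> * \<sigma> (\<delta> f)" and "\<sigma> rf_X = rf_X + 1"
proof -
  have s: "to_fract [:1, 1:] = rf_X + 1"
    by (simp add: rf_X_def one_pCons flip: to_fract_1 to_fract_add)
  show "\<delta> (\<sigma> f) = of_nat \<mu> * \<sigma> (\<delta> f)" "\<sigma> rf_X = rf_X + 1"
    using assms
    by (simp_all add: case_S_def rf_deriv_subst rf_subst_X pderiv_pCons s rf_const_1
        rf_const_def [symmetric])
qed

lemma case_Q_commute:
  assumes "case_Q q \<delta> \<sigma> \<mu>"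
  shows "\<delta> (\<sigma> f) = of_nat \<mu> * \<sigma> (\<delta> f)" and "\<sigma> rf_X = rf_const q * rf_X"
proof -
  have s: "to_fract [:0, q:] = rf_const q * rf_X"
    by (simp add: rf_const_def rf_X_def flip: to_fract_mult)
  show "\<delta> (\<sigma> f) = of_nat \<mu> * \<sigma> (\<delta> f)" "\<sigma> rf_X = rf_const q * rf_X"
    using assms
    by (simp_all add: case_Q_def rf_deriv_subst rf_subst_mult rf_subst_X pderiv_pCons
        s rf_const_def [symmetric] mult_ac)
qed

lemma to_fract_monom: "to_fract (monom c m) = rf_const c * rf_X ^ m"
proof (induction m)
  case (Suc m)
  have "monom c (Suc m) = [:0, 1:] * monom c m"
    by (simp add: monom_Suc)
  hence "to_fract (monom c (Suc m)) = rf_X * to_fract (monom c m)"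
    by (simp add: rf_X_def del: mult_pCons_left)
  thus ?case by (simp add: Suc mult_ac)
qed (simp add: rf_const_def monom_0)

lemma case_M_commute:
  fixes \<delta> \<sigma> :: "'c::field ratfun \<Rightarrow> 'c ratfun"
  assumes "case_M q \<delta> \<sigma> \<mu>"
  shows "\<delta> (\<sigma> f) = of_nat \<mu> * \<sigma> (\<delta> f)" and "\<sigma> rf_X = rf_X ^ q"
proof -
  have q: "q \<ge> 2" and d: "degree (monom (1::'c) q) > 0"
    using assms by (auto simp: case_M_def degree_monom_eq)
  have "rf_X * to_fract (pderiv (monom (1::'c) q)) = of_nat q * rf_X ^ q"
    using q by (simp add: pderiv_monom rf_const_of_nat to_fract_monom power_eq_if)
  thus "\<delta> (\<sigma> f) = of_nat \<mu> * \<sigma> (\<delta> f)" "\<sigma> rf_X = rf_X ^ q"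
    using assms d
    by (simp_all add: case_M_def rf_deriv_subst rf_subst_mult rf_subst_X to_fract_monom rf_const_1
        mult.assoc [symmetric])
qed


section \<open>Matrices and systems\<close>

definition GL :: "nat \<Rightarrow> 'a::semiring_1 mat set" where
  "GL n = {M \<in> carrier_mat n n. invertible_mat M}"

definition consistent ::
  "('c::field ratfun \<Rightarrow> 'c ratfun) \<Rightarrow> ('c ratfun \<Rightarrow> 'c ratfun) \<Rightarrow> nat \<Rightarrow>
   'c ratfun mat \<Rightarrow> 'c ratfun mat \<Rightarrow> bool" where
  "consistent \<delta> \<sigma> \<mu> A B \<longleftrightarrow>
     map_mat \<delta> B = of_nat \<mu> \<cdot>\<^sub>m (map_mat \<sigma> A * B) - B * A"

definition gauge_equivalent ::
  "('c::field ratfun \<Rightarrow> 'c ratfun) \<Rightarrow> ('c ratfun \<Rightarrow> 'c ratfun) \<Rightarrow> nat \<Rightarrow>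
   'c ratfun mat \<Rightarrow> 'c ratfun mat \<Rightarrow> 'c ratfun mat \<Rightarrow> 'c ratfun mat \<Rightarrow> bool" where
  "gauge_equivalent \<delta> \<sigma> n A B A' B' \<longleftrightarrow>
     (\<exists>G \<in> carrier_mat n n. \<exists>H \<in> carrier_mat n n.
        G * H = 1\<^sub>m n \<and> H * G = 1\<^sub>m n \<and>
        A' = map_mat \<delta> G * H + G * A * H \<and>
        B' = map_mat \<sigma> G * B * H)"

definition diagonalisable_mat :: "'c::field mat \<Rightarrow> bool" where
  "diagonalisable_mat D \<longleftrightarrow> (\<exists>E. diagonal_mat E \<and> similar_mat D E)"


section \<open>Laurent polynomials inside \<open>C(x)\<close>\<close>

text \<open>
  \<open>laurent_expansion f c\<close>: \<open>f\<close> is the Laurent polynomial whose coefficient of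
  \<open>x\<^sup>m\<close> is \<open>c m\<close>.
\<close>

definition laurent_expansion :: "'c::field ratfun \<Rightarrow> (int \<Rightarrow> 'c) \<Rightarrow> bool" where
  "laurent_expansion f c \<longleftrightarrow>
     finite {m. c m \<noteq> 0} \<and> f = (\<Sum>m | c m \<noteq> 0. rf_const (c m) * rf_X powi m)"

lemma laurent_expansion_unique:
  fixes f :: "'c::field ratfun"
  assumes "laurent_expansion f c" "laurent_expansion f d"
  shows "c = d"
proof -
  define S where "S = {m. c m \<noteq> 0} \<union> {m. d m \<noteq> 0}"
  have S: "finite S" using assms by (auto simp: S_def laurent_expansion_def)
  obtain N :: nat where N: "\<And>m. m \<in> S \<Longrightarrow> m + int N \<ge> 0"
  proof
    fix m assume "m \<in> S"
    hence "\<bar>m\<bar> \<le> (\<Sum>k\<in>S. \<bar>k\<bar>)"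
      using S by (intro member_le_sum) auto
    thus "m + int (nat (\<Sum>k\<in>S. \<bar>k\<bar>)) \<ge> 0" by linarith
  qed
  have X: "(rf_X :: 'c ratfun) \<noteq> 0"
    by (simp add: rf_X_def)
  have *: "f * rf_X ^ N = to_fract (\<Sum>m\<in>S. monom (e m) (nat (m + int N)))"
    if e: "laurent_expansion f e" and sub: "{m. e m \<noteq> 0} \<subseteq> S" for e
  proof -
    have "f = (\<Sum>m\<in>S. rf_const (e m) * rf_X powi m)"
      using e sub S by (auto simp: laurent_expansion_def rf_const_def intro!: sum.mono_neutral_left)
    hence "f * rf_X ^ N = (\<Sum>m\<in>S. rf_const (e m) * (rf_X powi m * rf_X ^ N))"
      by (simp add: sum_distrib_right mult.assoc)
    also have "\<dots> = (\<Sum>m\<in>S. to_fract (monom (e m) (nat (m + int N))))"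
    proof (rule sum.cong)
      fix m assume m: "m \<in> S"
      have "rf_X powi m * rf_X ^ N = (rf_X :: 'c ratfun) powi (m + int N)"
        using X by (simp add: power_int_add)
      also have "\<dots> = rf_X ^ nat (m + int N)"
        using N[OF m] by (simp add: power_int_def)
      finally show "rf_const (e m) * (rf_X powi m * rf_X ^ N) =
          to_fract (monom (e m) (nat (m + int N)))"
        by (simp add: to_fract_monom)
    qed simp
    also have "\<dots> = to_fract (\<Sum>m\<in>S. monom (e m) (nat (m + int N)))"
      using S by (induction S rule: finite_induct) auto
    finally show ?thesis .
  qed
  have eq: "(\<Sum>m\<in>S. monom (c m) (nat (m + int N))) = (\<Sum>m\<in>S. monom (d m) (nat (m + int N)))"
    (is "?p = ?q")
  proof -
    have "to_fract ?p = f * rf_X ^ N" by (rule *[OF assms(1), symmetric]) (simp add: S_def)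
    also have "\<dots> = to_fract ?q" by (rule *[OF assms(2)]) (simp add: S_def)
    finally show ?thesis by (simp only: to_fract_eq_iff)
  qed
  have co: "coeff (\<Sum>m\<in>S. monom (e m) (nat (m + int N))) (nat (l + int N)) = e l"
    if l: "l \<in> S" for l and e :: "int \<Rightarrow> 'c"
  proof -
    have "coeff (\<Sum>m\<in>S. monom (e m) (nat (m + int N))) (nat (l + int N)) =
        (\<Sum>m\<in>S. if m = l then e m else 0)"
      unfolding coeff_sum using N l by (intro sum.cong) (auto simp: nat_eq_iff)
    thus ?thesis using S l by simp
  qed
  show ?thesis
  proof
    fix l show "c l = d l"
      using co[of l c] co[of l d] eq by (cases "l \<in> S") (auto simp: S_def)
  qed
qed

definition laurent_polys :: "'c::field ratfun set" where
  "laurent_polys = {f. \<exists>c. laurent_expansion f c}"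

definition GL_laurent :: "nat \<Rightarrow> 'c::field ratfun mat set" where
  "GL_laurent n =
     {M \<in> carrier_mat n n. \<exists>N \<in> carrier_mat n n.
        M * N = 1\<^sub>m n \<and> N * M = 1\<^sub>m n \<and>
        elements_mat M \<subseteq> laurent_polys \<and> elements_mat N \<subseteq> laurent_polys}"

definition laurent_exponents :: "'c::field ratfun mat \<Rightarrow> int set" where
  "laurent_exponents M =
     {m. \<exists>f \<in> elements_mat M. \<exists>c. laurent_expansion f c \<and> c m \<noteq> 0}"

end

theory Submission
  imports Defs "HOL-Library.Function_Algebras"
begin

text \<open>
  On \<open>k\<^sup>n\<close> let \<open>D v = \<delta> v - A v\<close> and \<open>\<Phi> v = B\<^sup>-\<^sup>1 \<sigma>(v)\<close>; consistency means \<open>D \<Phi> = \<mu> \<Phi> D\<close>. Let \<open>L\<close> be the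
  space of those \<open>v\<close> for which all \<open>D\<^sup>j v\<close> have a common denominator (in cases Q and M up to powers
  of \<open>x\<close>). It is stable under \<open>x\<close>, \<open>D\<close> and \<open>\<Phi>\<close>, and it spans \<open>k\<^sup>n\<close>: an iterate of \<open>\<sigma>\<close> moves every
  possible pole of \<open>D\<^sup>j v\<close> to some point where poles are bounded. Counting dimensions shows that \<open>L\<close> has
  finite rank over \<open>C[D]\<close>.

  This rank is \<open>0\<close>. In case M, independent elements \<open>m\<^sub>i\<close> yield \<open>q\<close> times as many independent elements
  \<open>x\<^sup>t \<Phi>(m\<^sub>i)\<close>, \<open>t < q\<close>. In cases S and Q, \<open>\<Phi>\<close> is \<open>C[D]\<close>-linear and hence annihilated by a minimal
  polynomial over \<open>C(D)\<close>; commuting it with \<open>x\<close> gives \<open>p\<^sub>d p\<^sub>0' = p\<^sub>d' p\<^sub>0 + d p\<^sub>d p\<^sub>0\<close>, respectively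
  \<open>p\<^sub>d(D) p\<^sub>0(D+1) = q\<^sup>d p\<^sub>d(D+1) p\<^sub>0(D)\<close>, for its leading and constant coefficients, which is impossible
  for \<open>d > 0\<close>.

  So \<open>D\<close> is locally finite on \<open>L\<close>, and \<open>k\<^sup>n\<close> is spanned by generalised eigenvectors of \<open>D\<close>. In case S
  Taylor expansion reduces them to eigenvectors; in cases Q and M powers of \<open>x\<close> shift the eigenvalues
  into a set of representatives of \<open>C\<close> modulo the integers. A triangular basis of such vectors makes
  \<open>A\<close> constant, and then every entry of \<open>B\<close> is a monomial \<open>\<beta> x\<^sup>m\<close> with \<open>m = \<mu> \<lambda>\<^sub>i - \<lambda>\<^sub>j\<close>.
\<close>

section \<open>Poles of rational functions\<close>

text \<open>Two scalar equations over k shape the normal forms. A nonzero rational solution of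
  \<delta> f = c f forces c = 0 if \<delta> is d/dx, and c integral if \<delta> is x d/dx. The
  equation \<delta> f = c is solved by c x for d/dx, whereas for x d/dx it forces f to be constant:
  k contains no logarithm. In case S the function x therefore dissolves every Jordan block and A
  becomes diagonal. In cases Q and M Jordan blocks remain, but once no two eigenvalues differ by a
  nonzero integer, rational coordinates between generalised eigenvectors are constant. The obstacle
  before that is that D is only C-linear, so the finite dimension of k^n over k gives no
  annihilating polynomial. The pole orders of D^j v may grow with j wherever A has a pole, and
  C-dimensions can be counted only where they are under control. \<sigma> cannot help at infinity
  and, in cases Q and M, at 0, because it fixes these points. Growth there is at most linear in j,
  which leaves a finite rank over C[D] but not rank 0; hence the separate arguments for rank
  0.\<close>

lemma order_power_eq:
  fixes p :: "'a::idom poly"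
  shows "p \<noteq> 0 \<Longrightarrow> order a (p ^ k) = k * order a p"
  by (induction k) (auto simp: order_mult order_1_eq_0)

lemma pcompose_pow:
  fixes p q :: "'a::comm_ring_1 poly"
  shows "pcompose (p ^ k) q = pcompose p q ^ k"
  by (induction k) (auto simp: pcompose_mult pcompose_1)

text \<open>Over an algebraically closed field root multiplicities decide divisibility; each round
  of the induction cancels a linear factor common to p and q.\<close>

lemma dvd_of_order_le:
  fixes p q :: "'a::alg_closed_field poly"
  assumes "q \<noteq> 0" "\<And>a. poly p a = 0 \<Longrightarrow> order a p \<le> order a q" "p \<noteq> 0"
  shows "p dvd q"
  using assms
proof (induction "degree p" arbitrary: p q rule: less_induct)
  case less
  show ?case
  proof (cases "degree p = 0")
    case True
    thus ?thesis using less.prems is_unit_iff_degree unit_imp_dvd by blast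
  next
    case False
    then obtain a where a: "poly p a = 0" using alg_closed_imp_poly_has_root by blast
    then obtain p' where p': "p = [:-a, 1:] * p'" by (metis dvdE poly_eq_0_iff_dvd)
    have "order a p > 0" using a less.prems by (simp add: order_gt_0_iff)
    hence "order a q > 0" using less.prems(2)[OF a] by simp
    then obtain q' where q': "q = [:-a, 1:] * q'"
      using less.prems(1) by (metis dvdE order_gt_0_iff poly_eq_0_iff_dvd)
    have nz: "p' \<noteq> 0" "q' \<noteq> 0" using p' q' less.prems by auto
    have "degree p' < degree p" unfolding p' using nz by (subst degree_mult_eq) auto
    moreover have "order b p' \<le> order b q'" if "poly p' b = 0" for b
    proof -
      have "order b p \<le> order b q" using less.prems(2) that p' by simp
      moreover have "order b p = order b [:-a, 1:] + order b p'"
        using p' less.prems by (simp add: order_mult del: mult_pCons_left)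
      moreover have "order b q = order b [:-a, 1:] + order b q'"
        using q' less.prems by (simp add: order_mult del: mult_pCons_left)
      ultimately show ?thesis by simp
    qed
    ultimately have "p' dvd q'" using less.hyps nz by blast
    thus ?thesis unfolding p' q' by (rule mult_dvd_mono[OF dvd_refl])
  qed
qed

text \<open>A linear factor x - a of g divides (x - s(a)) composed with s, because the latter
  vanishes at a; g' is the product of these x - s(a). In \<open>LL_large\<close> this yields
  functions whose image under an iterate of \<sigma> absorbs a prescribed denominator.\<close>

lemma dvd_pcompose:
  fixes g s :: "'a::alg_closed_field poly"
  assumes "g \<noteq> 0"
  obtains g' where "g' \<noteq> 0" "g dvd pcompose g' s"
proof -
  have "\<exists>g'. g' \<noteq> 0 \<and> g dvd pcompose g' s"
    using assms
  proof (induction "degree g" arbitrary: g rule: less_induct)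
    case less
    show ?case
    proof (cases "degree g = 0")
      case True
      hence "g dvd pcompose 1 s" using less.prems is_unit_iff_degree unit_imp_dvd by blast
      thus ?thesis by (intro exI[of _ 1]) simp
    next
      case False
      then obtain a where a: "poly g a = 0" using alg_closed_imp_poly_has_root by blast
      then obtain g1 where g1: "g = [:-a, 1:] * g1" by (metis dvdE poly_eq_0_iff_dvd)
      have nz: "g1 \<noteq> 0" using g1 less.prems by auto
      have "degree g1 < degree g" unfolding g1 using nz by (subst degree_mult_eq) auto
      then obtain h where h: "h \<noteq> 0" "g1 dvd pcompose h s" using less.hyps nz by blast
      have "[:-a, 1:] dvd pcompose [:- poly s a, 1:] s"
        by (subst dvd_iff_poly_eq_0) (simp add: poly_pcompose)
      hence "g dvd pcompose ([:- poly s a, 1:] * h) s"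
        unfolding g1 pcompose_mult using h by (intro mult_dvd_mono)
      thus ?thesis using h by (intro exI[of _ "[:- poly s a, 1:] * h"]) (auto simp del: mult_pCons_left)
    qed
  qed
  thus ?thesis using that by blast
qed

text \<open>A denominator of least degree shares no root with the numerator, since a common linear
  factor could be cancelled.\<close>

lemma fract_no_common_root:
  fixes z :: "'c::field ratfun"
  obtains p s where "s \<noteq> 0" "z = Fract p s" "\<And>a. \<not> (poly p a = 0 \<and> poly s a = 0)"
proof -
  define P where "P = (\<lambda>s. s \<noteq> 0 \<and> (\<exists>p. z = Fract p s))"
  have "\<exists>s. P s" unfolding P_def by (cases z) auto
  then obtain s where s: "P s" and m: "\<And>t. P t \<Longrightarrow> degree s \<le> degree t"
    using exists_least_lemma[of "\<lambda>n. \<exists>s. P s \<and> degree s = n"]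
    by (metis arg_min_natI arg_min_nat_le)
  from s obtain p where p: "s \<noteq> 0" "z = Fract p s" by (auto simp: P_def)
  have "\<not> (poly p a = 0 \<and> poly s a = 0)" for a
  proof
    assume "poly p a = 0 \<and> poly s a = 0"
    then obtain p' s' where e: "p = [:-a, 1:] * p'" "s = [:-a, 1:] * s'"
      by (metis dvdE poly_eq_0_iff_dvd)
    have s': "s' \<noteq> 0" using e p by auto
    have "z = Fract p' s'" using p s' unfolding e by (simp add: eq_fract del: mult_pCons_left)
    hence "degree s \<le> degree s'" using s' by (intro m) (auto simp: P_def)
    moreover have "degree s = Suc (degree s')" unfolding e(2) using s' by (subst degree_mult_eq) auto
    ultimately show False by simp
  qed
  thus ?thesis using p that by blast
qed

lemma Fract_eq_to_fract: "Fract a b = to_fract a / to_fract b"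
  by (simp add: to_fract_def)

text \<open>The two estimates at the points \<open>a\<close> and \<open>b\<close> bound the order of the pole of \<open>z\<close> at \<open>a\<close>
  by the order of \<open>g\<close> at \<open>b\<close>, independently of \<open>j\<close>.\<close>
lemma bounded_denominator:
  fixes z :: "'c::alg_closed_field ratfun" and s h g u :: "'c poly"
  assumes s: "degree s > 0" and nz: "h \<noteq> 0" "g \<noteq> 0" "u \<noteq> 0"
    and sep: "\<And>a. poly h a = 0 \<Longrightarrow> poly u a \<noteq> 0 \<Longrightarrow>
        \<exists>b. poly s b = a \<and> poly h b \<noteq> 0 \<and> poly u b \<noteq> 0"
    and z1: "to_fract (h ^ j) * z * to_fract u ^ i1 = to_fract r1"
    and z2: "to_fract (g * h ^ j) * rf_subst s z * to_fract u ^ i2 = to_fract r2"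
  shows "\<exists>i r. to_fract (h ^ degree g) * z * to_fract u ^ i = to_fract r"
proof -
  obtain p t where t: "t \<noteq> 0" and z: "z = Fract p t"
    and nc: "\<And>a. \<not> (poly p a = 0 \<and> poly t a = 0)" using fract_no_common_root[of z] by blast
  have up: "to_fract u ^ i = to_fract (u ^ i)" for i by (induction i) auto
  have tc: "pcompose t s \<noteq> 0" using s t by (simp add: pcompose_eq_0_iff)
  have e1: "h ^ j * p * u ^ i1 = r1 * t"
  proof -
    have "Fract (h ^ j * p * u ^ i1) t = Fract r1 1"
      using z1 unfolding z up unfolding to_fract_def by simp
    thus ?thesis using t by (simp add: eq_fract)
  qed
  have e2: "g * h ^ j * pcompose p s * u ^ i2 = r2 * pcompose t s"
  proof -
    have "Fract (g * h ^ j * pcompose p s * u ^ i2) (pcompose t s) = Fract r2 1"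
      using z2 unfolding z rf_subst_Fract[OF s t] up unfolding to_fract_def by simp
    thus ?thesis using tc by (simp add: eq_fract)
  qed
  \<comment> \<open>At zeros of u nothing has to be bounded, so the crude exponent
    \<open>degree t\<close> is enough. At the other zeros of t the estimate at b yields the exponent
    \<open>degree g\<close>.\<close>
  have "t dvd h ^ degree g * u ^ degree t"
  proof (rule dvd_of_order_le)
    fix a assume a: "poly t a = 0"
    show "order a t \<le> order a (h ^ degree g * u ^ degree t)"
    proof (cases "poly u a = 0")
      case True
      have "order a t \<le> degree t" using t by (rule order_degree)
      also have "degree t \<le> order a u * degree t"
        using True nz by (simp add: order_gt_0_iff Suc_le_eq)
      also have "\<dots> \<le> order a (h ^ degree g * u ^ degree t)"
        using nz by (simp add: order_mult mult.commute order_power_eq)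
      finally show ?thesis .
    next
      case False
      have "poly (h ^ j * p * u ^ i1) a = 0" unfolding e1 using a by simp
      hence ha: "poly h a = 0" using False nc a by auto
      \<comment> \<open>As s maps b to a, t composed with s vanishes at b at least to the order of t
        at a. Among the factors on the left of \<open>e2\<close> only g can vanish at b.\<close>
      then obtain b where b: "poly s b = a" "poly h b \<noteq> 0" "poly u b \<noteq> 0"
        using sep False by blast
      have pb: "poly (pcompose p s) b \<noteq> 0" using nc[of a] a b by (auto simp: poly_pcompose)
      have ps: "pcompose p s \<noteq> 0" using pb by auto
      have lin: "[:-b, 1:] dvd pcompose [:-a, 1:] s"
        using b by (subst dvd_iff_poly_eq_0) (simp add: poly_pcompose)
      have "[:-a, 1:] ^ order a t dvd t" by (rule order_1)
      then obtain t' where t': "t = [:-a, 1:] ^ order a t * t'" by (metis dvdE)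
      have "pcompose t s = pcompose [:-a, 1:] s ^ order a t * pcompose t' s"
        by (subst t') (simp only: pcompose_mult pcompose_pow)
      hence "[:-b, 1:] ^ order a t dvd pcompose t s"
        using dvd_power_same[OF lin] by (metis dvd_mult2)
      hence "order a t \<le> order b (pcompose t s)" using tc by (meson order_divides)
      also have "\<dots> \<le> order b (r2 * pcompose t s)"
        unfolding e2[symmetric] using nz tc ps e2
        by (metis le_add2 mult_eq_0_iff order_mult power_not_zero)
      also have "\<dots> = order b g"
        unfolding e2[symmetric] using nz tc ps b pb
        by (simp add: order_mult order_0I)
      also have "\<dots> \<le> degree g" using nz by (intro order_degree)
      also have "\<dots> \<le> order a h * degree g"
        using ha nz by (simp add: order_gt_0_iff Suc_le_eq)
      also have "\<dots> \<le> order a (h ^ degree g * u ^ degree t)"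
        using nz by (simp add: order_mult mult.commute order_power_eq)
      finally show ?thesis .
    qed
  qed (use nz t in auto)
  then obtain r where r: "h ^ degree g * u ^ degree t = t * r" by (elim dvdE)
  have "to_fract (h ^ degree g) * z * to_fract u ^ degree t
      = Fract (h ^ degree g * u ^ degree t * p) t"
    unfolding up z by (simp add: to_fract_def ac_simps)
  also have "\<dots> = to_fract (r * p)" unfolding r using t by (simp add: to_fract_def eq_fract)
  finally show ?thesis by blast
qed

section \<open>Systems as operators on vectors of rational functions\<close>

text \<open>Used as simplification rules, the pointwise equations eta-expand \<open>v + w\<close> below a functional.\<close>
declare plus_fun_apply [simp del] zero_fun_apply [simp del] minus_apply [simp del]

lemmas pointwise = plus_fun_apply zero_fun_apply minus_apply

section \<open>Polynomials, constants and substitutions inside k\<close>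

lemma to_fract_pow: "to_fract (p ^ i) = to_fract p ^ i"
  by (induction i) auto

lemma to_fract_sum: "to_fract (sum f S) = (\<Sum>i\<in>S. to_fract (f i))"
  by (induction S rule: infinite_finite_induct) auto

lemma rf_const_0: "rf_const 0 = 0"
  by (simp add: rf_const_def)

lemma rf_const_minus: "rf_const (- c) = - rf_const c"
  by (metis rf_const_add rf_const_0 add.left_neutral add_eq_0_iff)

lemma rf_const_eq_iff: "rf_const c = rf_const d \<longleftrightarrow> c = d"
  by (simp add: rf_const_def)

lemma rf_const_sum: "rf_const (sum f S) = (\<Sum>i\<in>S. rf_const (f i))"
  by (induction S rule: infinite_finite_induct) (auto simp: rf_const_add rf_const_0)

lemma rf_deriv_to_fract: "rf_deriv (to_fract p) = to_fract (pderiv p)"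
  by (simp add: to_fract_def rf_deriv_Fract)

lemma rf_subst_to_fract:
  "degree s > 0 \<Longrightarrow> rf_subst s (to_fract p) = to_fract (pcompose p s)"
  by (simp add: to_fract_def rf_subst_Fract pcompose_1)

lemma rf_subst_rf_subst:
  assumes "degree s > 0" "degree t > 0"
  shows "rf_subst s (rf_subst t f) = rf_subst (pcompose t s) f"
proof (cases f)
  case (Fract a b)
  have "pcompose b t \<noteq> 0" using assms Fract by (simp add: pcompose_eq_0_iff)
  moreover have "degree (pcompose t s) > 0" using assms by (simp add: degree_pcompose)
  ultimately show ?thesis using assms Fract
    by (simp add: rf_subst_Fract pcompose_assoc)
qed

lemma rf_subst_inj:
  assumes "degree s > 0" "rf_subst s f = 0"
  shows "f = 0"
proof (cases f)
  case (Fract a b)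
  have "pcompose b s \<noteq> 0" using assms Fract by (auto simp: pcompose_eq_0_iff)
  hence "pcompose a s = 0"
    using assms Fract by (simp add: rf_subst_Fract Zero_fract_def eq_fract)
  thus ?thesis using assms Fract by (auto simp: pcompose_eq_0_iff Zero_fract_def eq_fract)
qed

lemma to_fract_div: "\<exists>a b. b \<noteq> 0 \<and> f = to_fract a / to_fract b"
  by (cases f) (metis Fract_eq_to_fract)

lemma common_denominator:
  fixes f :: "'i \<Rightarrow> 'c::field ratfun"
  assumes "finite S"
  shows "\<exists>h. h \<noteq> 0 \<and> (\<forall>i\<in>S. \<exists>p. to_fract h * f i = to_fract p)"
  using assms
proof (induction S rule: finite_induct)
  case empty
  show ?case by (rule exI[of _ 1]) auto
next
  case (insert x S)
  then obtain h where h: "h \<noteq> 0" "\<And>i. i \<in> S \<Longrightarrow> \<exists>p. to_fract h * f i = to_fract p" by blast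
  obtain a b where ab: "b \<noteq> 0" "f x = to_fract a / to_fract b" using to_fract_div by blast
  have "\<exists>p. to_fract (b * h) * f i = to_fract p" if "i \<in> insert x S" for i
  proof (cases "i = x")
    case True
    have "to_fract (b * h) * f x = to_fract (h * a)" using ab by simp
    thus ?thesis using True by blast
  next
    case False
    then obtain p where "to_fract h * f i = to_fract p" using h(2)[of i] \<open>i \<in> insert x S\<close> False by blast
    hence "to_fract (b * h) * f i = to_fract (b * p)" by (simp add: mult.assoc)
    thus ?thesis by blast
  qed
  thus ?case using h ab by (intro exI[of _ "b * h"]) auto
qed

section \<open>The coefficient ring C[x,1/u]: polynomials for u = 1, Laurent polynomials for u =
  x\<close>

definition localised :: "'c::field poly \<Rightarrow> 'c ratfun set" where
  "localised u = {f. \<exists>i p. f * to_fract u ^ i = to_fract p}"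

lemma localised_polyI [intro]: "to_fract p \<in> localised u"
  unfolding localised_def by (rule CollectI, rule exI[of _ 0]) auto

lemma localised_0 [simp]: "0 \<in> localised u"
  using localised_polyI[of 0] by simp

lemma localised_add:
  assumes "f \<in> localised u" "g \<in> localised u"
  shows "f + g \<in> localised u"
proof -
  obtain i p j q where *: "f * to_fract u ^ i = to_fract p" "g * to_fract u ^ j = to_fract q"
    using assms unfolding localised_def by blast
  have "(f + g) * to_fract u ^ (i + j) =
      (f * to_fract u ^ i) * to_fract u ^ j + (g * to_fract u ^ j) * to_fract u ^ i"
    by (simp add: power_add algebra_simps)
  also have "\<dots> = to_fract (p * u ^ j + q * u ^ i)" unfolding * by (simp add: to_fract_pow)
  finally show ?thesis unfolding localised_def by blast
qed

lemma localised_mult: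
  assumes "f \<in> localised u" "g \<in> localised u"
  shows "f * g \<in> localised u"
proof -
  obtain i p j q where *: "f * to_fract u ^ i = to_fract p" "g * to_fract u ^ j = to_fract q"
    using assms unfolding localised_def by blast
  have "(f * g) * to_fract u ^ (i + j) = (f * to_fract u ^ i) * (g * to_fract u ^ j)"
    by (simp add: power_add algebra_simps)
  also have "\<dots> = to_fract (p * q)" unfolding * by simp
  finally show ?thesis unfolding localised_def by blast
qed

lemma localised_const: "rf_const c \<in> localised u"
  unfolding rf_const_def by (rule localised_polyI)

lemma localised_of_nat: "of_nat m \<in> localised u"
  unfolding rf_const_of_nat[symmetric] by (rule localised_const)

lemma localised_uminus: "f \<in> localised u \<Longrightarrow> - f \<in> localised u"
  using localised_mult[of "rf_const (-1)" u f] localised_const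
  by (metis mult_minus1 rf_const_1 rf_const_minus)

lemma localised_diff: "f \<in> localised u \<Longrightarrow> g \<in> localised u \<Longrightarrow> f - g \<in> localised u"
  using localised_add[of f u "- g"] localised_uminus by force

lemma localised_sum: "(\<And>i. i \<in> S \<Longrightarrow> f i \<in> localised u) \<Longrightarrow> sum f S \<in> localised u"
  by (induction S rule: infinite_finite_induct) (auto intro: localised_add)

lemma localised_deriv:
  assumes "f \<in> localised u"
  shows "to_fract u * rf_deriv f \<in> localised u"
proof -
  obtain i p where *: "f * to_fract u ^ i = to_fract p"
    using assms unfolding localised_def by blast
  have "rf_deriv f * to_fract u ^ i + f * to_fract (pderiv (u ^ i)) = to_fract (pderiv p)"
    using arg_cong[OF *, of rf_deriv]
    by (simp add: rf_deriv_mult rf_deriv_to_fract flip: to_fract_pow)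
  hence **: "rf_deriv f * to_fract u ^ i = to_fract (pderiv p) - f * to_fract (pderiv (u ^ i))"
    by (simp add: algebra_simps)
  have "(to_fract u * rf_deriv f) * to_fract u ^ i
      = to_fract u * (rf_deriv f * to_fract u ^ i)" by (simp add: algebra_simps)
  also have "\<dots> = to_fract u * to_fract (pderiv p) - to_fract u * to_fract (pderiv (u ^ i)) * f"
    unfolding ** by (simp add: algebra_simps)
  finally have e: "(to_fract u * rf_deriv f) * to_fract u ^ i
      = to_fract u * to_fract (pderiv p) - to_fract u * to_fract (pderiv (u ^ i)) * f" .
  have "(to_fract u * rf_deriv f) * to_fract u ^ i \<in> localised u"
    unfolding e using assms by (intro localised_diff localised_mult localised_polyI)
  then obtain j q where "((to_fract u * rf_deriv f) * to_fract u ^ i) * to_fract u ^ j = to_fract q"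
    unfolding localised_def by blast
  hence "(to_fract u * rf_deriv f) * to_fract u ^ (i + j) = to_fract q"
    by (simp add: power_add algebra_simps)
  thus ?thesis unfolding localised_def by blast
qed

text \<open>The third assumption makes \<sigma>(u) a unit of C[x,1/u], so the substitution creates
  no poles outside the zeros of u.\<close>

lemma localised_subst:
  assumes "f \<in> localised u" "degree s > 0" "pcompose u s * w = u ^ k"
  shows "rf_subst s f \<in> localised u"
proof -
  obtain i p where *: "f * to_fract u ^ i = to_fract p"
    using assms unfolding localised_def by blast
  have "rf_subst s f * to_fract (pcompose u s) ^ i = to_fract (pcompose p s)"
    using arg_cong[OF *, of "rf_subst s"] assms(2)
    by (simp add: rf_subst_mult rf_subst_to_fract pcompose_pow flip: to_fract_pow)
  hence "rf_subst s f * to_fract (pcompose u s) ^ i * to_fract w ^ i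
      = to_fract (pcompose p s * w ^ i)" by (simp add: to_fract_pow)
  moreover have "to_fract (pcompose u s) ^ i * to_fract w ^ i = to_fract u ^ (k * i)"
    using assms(3) by (metis power_mult power_mult_distrib to_fract_mult to_fract_pow)
  ultimately have "rf_subst s f * to_fract u ^ (k * i) = to_fract (pcompose p s * w ^ i)"
    by (simp add: mult.assoc)
  thus ?thesis unfolding localised_def by blast
qed

section \<open>Vectors over k, with scalars from k and from C\<close>

definition ks :: "'a::semiring_0 \<Rightarrow> (nat \<Rightarrow> 'a) \<Rightarrow> nat \<Rightarrow> 'a" where
  "ks f v = (\<lambda>i. f * v i)"

definition sc :: "'c::field \<Rightarrow> (nat \<Rightarrow> 'c ratfun) \<Rightarrow> nat \<Rightarrow> 'c ratfun" where
  "sc c v = ks (rf_const c) v"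

text \<open>Column vectors of length n are encoded as functions vanishing from n on, so that both
  vector space structures, over k and over C, live on a whole type.\<close>

definition supp :: "nat \<Rightarrow> (nat \<Rightarrow> 'a::zero) set" where
  "supp n = {v. \<forall>i\<ge>n. v i = 0}"

lemma supp_0 [simp]: "0 \<in> supp n"
  by (simp add: supp_def pointwise)

lemma supp_add: "v \<in> supp n \<Longrightarrow> w \<in> supp n \<Longrightarrow> v + w \<in> supp n" for v :: "nat \<Rightarrow> 'a::monoid_add"
  by (simp add: supp_def pointwise)

lemma supp_diff: "v \<in> supp n \<Longrightarrow> w \<in> supp n \<Longrightarrow> v - w \<in> supp n" for v :: "nat \<Rightarrow> 'a::group_add"
  by (simp add: supp_def pointwise)

lemma supp_ks: "v \<in> supp n \<Longrightarrow> ks f v \<in> supp n"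
  by (simp add: supp_def ks_def)

lemma supp_sc: "v \<in> supp n \<Longrightarrow> sc f v \<in> supp n"
  by (simp add: sc_def supp_ks)

lemma supp_sum: "(\<And>i. i \<in> S \<Longrightarrow> f i \<in> supp n) \<Longrightarrow> sum f S \<in> supp n"
  for f :: "'i \<Rightarrow> nat \<Rightarrow> 'a::comm_monoid_add"
  by (induction S rule: infinite_finite_induct) (auto intro: supp_add)

lemma sum_fun_app: "sum f S i = (\<Sum>x\<in>S. f x i)" for f :: "'i \<Rightarrow> nat \<Rightarrow> 'a::comm_monoid_add"
  by (induction S rule: infinite_finite_induct) (auto simp: pointwise)

lemma ks_add: "ks f (v + w) = ks f v + ks f w"
  by (auto simp: fun_eq_iff pointwise ks_def algebra_simps)

lemma ks_ks: "ks f (ks g v) = ks (f * g) v"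
  by (auto simp: fun_eq_iff pointwise ks_def algebra_simps)

lemma ks_0 [simp]: "ks 0 v = 0" "ks f 0 = 0"
  by (auto simp: fun_eq_iff pointwise ks_def)

interpretation kv: vector_space "ks :: 'a::field \<Rightarrow> _"
  by unfold_locales (auto simp: fun_eq_iff pointwise ks_def algebra_simps)

lemmas ks_sum = kv.scale_sum_right

interpretation cv: vector_space "sc :: 'a::field \<Rightarrow> _"
  by unfold_locales (auto simp: fun_eq_iff pointwise sc_def ks_def algebra_simps rf_const_add rf_const_mult rf_const_1)

lemma ks_sc: "ks f (sc c v) = sc c (ks f v)"
  by (auto simp: fun_eq_iff pointwise sc_def ks_def algebra_simps)

text \<open>One locale for the three cases: \<delta> is u d/dx with u = 1 (case S) or u = x (cases Q
  and M), \<sigma> substitutes s for x, and a, b, bi are the entries of A, B and the inverse of B.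
  \<open>\<delta>_bi\<close> is the consistency condition rewritten for the inverse.
  \<open>sep\<close> provides one iterate of the substitution under which every zero z of h outside
  u is the image of a point y that is a zero of neither h nor u.\<close>

locale system_cases =
  fixes \<delta> \<sigma> :: "'c::{alg_closed_field, field_char_0} ratfun \<Rightarrow> 'c ratfun"
    and u s :: "'c poly" and \<mu> n :: nat and a b bi :: "nat \<Rightarrow> nat \<Rightarrow> 'c ratfun"
  assumes u_cases: "u = 1 \<or> u = [:0, 1:]"
    and \<delta>_eq: "\<delta> = (\<lambda>f. to_fract u * rf_deriv f)"
    and \<sigma>_eq: "\<sigma> = rf_subst s"
    and deg_s: "degree s > 0"
    and \<delta>\<sigma>: "\<And>f. \<delta> (\<sigma> f) = of_nat \<mu> * \<sigma> (\<delta> f)"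
    and \<mu>_pos: "\<mu> > 0"
    and u_subst: "\<exists>w k. pcompose u s * w = u ^ k"
    and sep: "\<And>h. h \<noteq> 0 \<Longrightarrow> \<exists>m. \<forall>z. poly h z = 0 \<longrightarrow> poly u z \<noteq> 0 \<longrightarrow>
        (\<exists>y. poly (((\<lambda>p. pcompose p s) ^^ m) [:0, 1:]) y = z \<and> poly h y \<noteq> 0 \<and> poly u y \<noteq> 0)"
    and b_bi: "\<And>i j. i < n \<Longrightarrow> j < n \<Longrightarrow> (\<Sum>k<n. b i k * bi k j) = (if i = j then 1 else 0)"
    and \<delta>_bi: "\<And>i j. i < n \<Longrightarrow> j < n \<Longrightarrow>
        \<delta> (bi i j) = (\<Sum>k<n. a i k * bi k j) - of_nat \<mu> * (\<Sum>k<n. bi i k * \<sigma> (a k j))"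
begin

lemma u_nz: "u \<noteq> 0" using u_cases by auto

lemma \<delta>_add: "\<delta> (f + g) = \<delta> f + \<delta> g"
  by (simp add: \<delta>_eq rf_deriv_add algebra_simps)

lemma \<delta>_mult: "\<delta> (f * g) = \<delta> f * g + f * \<delta> g"
  by (simp add: \<delta>_eq rf_deriv_mult algebra_simps)

lemma \<delta>_const [simp]: "\<delta> (rf_const c) = 0"
  by (simp add: \<delta>_eq rf_deriv_const)

lemma \<delta>_0 [simp]: "\<delta> 0 = 0"
  using \<delta>_const[of 0] by (simp add: rf_const_0)

lemma \<delta>_sum: "\<delta> (sum f S) = (\<Sum>i\<in>S. \<delta> (f i))"
  by (induction S rule: infinite_finite_induct) (auto simp: \<delta>_add)

lemma \<sigma>_add: "\<sigma> (f + g) = \<sigma> f + \<sigma> g"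
  using deg_s by (simp add: \<sigma>_eq rf_subst_add)

lemma \<sigma>_mult: "\<sigma> (f * g) = \<sigma> f * \<sigma> g"
  using deg_s by (simp add: \<sigma>_eq rf_subst_mult)

lemma \<sigma>_const [simp]: "\<sigma> (rf_const c) = rf_const c"
  using deg_s by (simp add: \<sigma>_eq rf_subst_const)

lemma \<sigma>_0 [simp]: "\<sigma> 0 = 0"
  using \<sigma>_const[of 0] by (simp add: rf_const_0)

lemma \<sigma>_1 [simp]: "\<sigma> 1 = 1"
  using \<sigma>_const[of 1] by (simp add: rf_const_1)

lemma \<sigma>_of_nat [simp]: "\<sigma> (of_nat k) = of_nat k"
  using \<sigma>_const[of "of_nat k"] by (simp add: rf_const_of_nat)

lemma \<sigma>_sum: "\<sigma> (sum f S) = (\<Sum>i\<in>S. \<sigma> (f i))"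
  by (induction S rule: infinite_finite_induct) (auto simp: \<sigma>_add)

lemma \<sigma>_inj: "\<sigma> f = 0 \<Longrightarrow> f = 0"
  using deg_s rf_subst_inj by (auto simp: \<sigma>_eq)

lemma \<sigma>_minus: "\<sigma> (- f) = - \<sigma> f"
  using \<sigma>_add[of f "- f"] by (simp add: eq_neg_iff_add_eq_0 add.commute)

lemma \<sigma>_diff: "\<sigma> (f - g) = \<sigma> f - \<sigma> g"
  using \<sigma>_add[of f "- g"] by (simp add: \<sigma>_minus)

abbreviation R where "R \<equiv> localised u"

lemma R_\<delta>: "f \<in> R \<Longrightarrow> \<delta> f \<in> R"
  unfolding \<delta>_eq by (rule localised_deriv)

lemma R_\<sigma>: "f \<in> R \<Longrightarrow> \<sigma> f \<in> R"
  using u_subst localised_subst[OF _ deg_s] unfolding \<sigma>_eq by blast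

definition D :: "(nat \<Rightarrow> 'c ratfun) \<Rightarrow> nat \<Rightarrow> 'c ratfun" where
  "D v = (\<lambda>i. if i < n then \<delta> (v i) - (\<Sum>j<n. a i j * v j) else 0)"

definition Ph :: "(nat \<Rightarrow> 'c ratfun) \<Rightarrow> nat \<Rightarrow> 'c ratfun" where
  "Ph v = (\<lambda>i. if i < n then (\<Sum>j<n. bi i j * \<sigma> (v j)) else 0)"

lemma D_supp [simp]: "D v \<in> supp n" by (simp add: D_def supp_def)

lemma Ph_supp [simp]: "Ph v \<in> supp n" by (simp add: Ph_def supp_def)

lemma D_pow_supp [simp]: "v \<in> supp n \<Longrightarrow> (D ^^ j) v \<in> supp n"
  by (cases j) auto

lemma Ph_pow_supp [simp]: "v \<in> supp n \<Longrightarrow> (Ph ^^ j) v \<in> supp n"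
  by (cases j) auto

lemma D_add: "D (v + w) = D v + D w"
  by (auto simp: pointwise D_def fun_eq_iff \<delta>_add algebra_simps sum.distrib)

lemma Ph_add: "Ph (v + w) = Ph v + Ph w"
  by (auto simp: pointwise Ph_def fun_eq_iff \<sigma>_add algebra_simps sum.distrib)

lemma D_ks: "v \<in> supp n \<Longrightarrow> D (ks f v) = ks (\<delta> f) v + ks f (D v)"
  by (auto simp: pointwise D_def ks_def supp_def fun_eq_iff \<delta>_mult algebra_simps sum_distrib_left)

lemma D_sc: "D (sc c v) = sc c (D v)"
  by (auto simp: pointwise D_def sc_def ks_def fun_eq_iff \<delta>_mult algebra_simps sum_distrib_left)

lemma Ph_ks: "Ph (ks f v) = ks (\<sigma> f) (Ph v)"
  by (auto simp: pointwise Ph_def ks_def fun_eq_iff \<sigma>_mult algebra_simps sum_distrib_left)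

lemma Ph_sc: "Ph (sc c v) = sc c (Ph v)"
  by (simp add: sc_def Ph_ks)

text \<open>The products of a and bi that \<open>\<delta>_bi\<close> contributes cancel those coming
  from D; the other term of \<open>\<delta>_bi\<close> and \<delta> \<sigma> = \<mu> \<sigma>
  \<delta> supply the factor \<mu>.\<close>

lemma D_Ph: "D (Ph v) = ks (of_nat \<mu>) (Ph (D v))"
proof
  fix i
  show "D (Ph v) i = ks (of_nat \<mu>) (Ph (D v)) i"
  proof (cases "i < n")
    case i: True
    have "D (Ph v) i = (\<Sum>j<n. \<delta> (bi i j) * \<sigma> (v j) + bi i j * \<delta> (\<sigma> (v j)))
        - (\<Sum>k<n. a i k * (\<Sum>j<n. bi k j * \<sigma> (v j)))"
      using i by (simp add: D_def Ph_def \<delta>_sum \<delta>_mult)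
    also have "(\<Sum>k<n. a i k * (\<Sum>j<n. bi k j * \<sigma> (v j)))
        = (\<Sum>j<n. (\<Sum>k<n. a i k * bi k j) * \<sigma> (v j))"
      unfolding sum_distrib_left sum_distrib_right by (subst sum.swap) (simp add: mult.assoc)
    also have "(\<Sum>j<n. \<delta> (bi i j) * \<sigma> (v j) + bi i j * \<delta> (\<sigma> (v j)))
        = (\<Sum>j<n. ((\<Sum>k<n. a i k * bi k j) - of_nat \<mu> * (\<Sum>k<n. bi i k * \<sigma> (a k j))) * \<sigma> (v j)
            + bi i j * (of_nat \<mu> * \<sigma> (\<delta> (v j))))"
      using i by (intro sum.cong) (simp_all add: \<delta>_bi \<delta>\<sigma>)
    also have "\<dots> - (\<Sum>j<n. (\<Sum>k<n. a i k * bi k j) * \<sigma> (v j))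
        = of_nat \<mu> * ((\<Sum>j<n. bi i j * \<sigma> (\<delta> (v j))) - (\<Sum>j<n. \<Sum>k<n. bi i k * \<sigma> (a k j) * \<sigma> (v j)))"
      by (simp add: algebra_simps sum.distrib sum_subtractf sum_distrib_left sum_distrib_right
          sum_negf)
    also have "(\<Sum>j<n. \<Sum>k<n. bi i k * \<sigma> (a k j) * \<sigma> (v j))
        = (\<Sum>k<n. bi i k * \<sigma> (\<Sum>j<n. a k j * v j))"
      by (subst sum.swap) (simp add: \<sigma>_sum \<sigma>_mult sum_distrib_left mult.assoc)
    also have "(\<Sum>j<n. bi i j * \<sigma> (\<delta> (v j))) - \<dots> = Ph (D v) i"
      using i by (simp add: Ph_def D_def \<sigma>_diff right_diff_distrib sum_subtractf)
    finally show ?thesis by (simp add: ks_def)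
  qed (simp add: D_def Ph_def ks_def)
qed

lemma \<sigma>_via_Ph: "i < n \<Longrightarrow> \<sigma> (v i) = (\<Sum>j<n. b i j * Ph v j)"
proof -
  assume i: "i < n"
  have "(\<Sum>j<n. b i j * Ph v j) = (\<Sum>k<n. (\<Sum>j<n. b i j * bi j k) * \<sigma> (v k))"
    unfolding sum_distrib_right by (subst sum.swap) (simp add: Ph_def sum_distrib_left mult.assoc)
  also have "\<dots> = (\<Sum>k<n. if k = i then \<sigma> (v k) else 0)"
    using i by (intro sum.cong) (auto simp: b_bi)
  also have "\<dots> = \<sigma> (v i)" using i by simp
  finally show ?thesis ..
qed

lemma Ph_inj:
  assumes "v \<in> supp n" "Ph v = 0"
  shows "v = 0"
proof
  fix i
  show "v i = 0 i"
  proof (cases "i < n")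
    case True
    have "\<sigma> (v i) = 0" using \<sigma>_via_Ph[OF True, of v] assms(2) by (simp add: pointwise)
    thus ?thesis using \<sigma>_inj by (simp add: pointwise)
  qed (use assms in \<open>auto simp: supp_def pointwise\<close>)
qed

lemma D_pow_Ph_pow: "(D ^^ j) ((Ph ^^ m) v) = ks (of_nat (\<mu> ^ (m * j))) ((Ph ^^ m) ((D ^^ j) v))"
proof -
  have Phk: "Ph (ks (of_nat k) v) = ks (of_nat k) (Ph v)" for k :: nat and v by (simp only: Ph_ks \<sigma>_of_nat)
  have Dk: "D (ks (of_nat k) v) = ks (of_nat k) (D v)" for k v
    using D_sc[of "of_nat k" v] by (simp add: sc_def rf_const_of_nat)
  have 1: "D ((Ph ^^ m) v) = ks (of_nat (\<mu> ^ m)) ((Ph ^^ m) (D v))" for m v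
    by (induction m) (simp_all add: D_Ph Phk ks_ks del: of_nat_power of_nat_mult flip: of_nat_mult)
  show ?thesis
    by (induction j) (simp_all add: Dk 1 ks_ks power_add mult.commute del: of_nat_power of_nat_mult flip: of_nat_mult)
qed

lemma \<sigma>_pow: "(\<sigma> ^^ m) f = rf_subst (((\<lambda>p. pcompose p s) ^^ m) [:0, 1:]) f"
  and deg_s_pow: "degree (((\<lambda>p. pcompose p s) ^^ m) [:0, 1:]) > 0"
proof (induction m arbitrary: f)
  case 0
  { case 1 show ?case by (cases f) (simp add: rf_subst_Fract pcompose_idR) }
  { case 2 show ?case by simp }
next
  case (Suc m)
  { case 1 show ?case
      using deg_s Suc by (simp add: \<sigma>_eq rf_subst_rf_subst) }
  { case 2 show ?case using deg_s Suc(2) by (simp add: degree_pcompose) }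
qed

end

section \<open>Vectors with bounded denominators\<close>

context system_cases
begin

definition clears :: "'c poly \<Rightarrow> (nat \<Rightarrow> 'c ratfun) \<Rightarrow> bool" where
  "clears d v \<longleftrightarrow> v \<in> supp n \<and> (\<forall>j i. to_fract d * (D ^^ j) v i \<in> R)"

definition LL :: "(nat \<Rightarrow> 'c ratfun) set" where
  "LL = {v. \<exists>d. d \<noteq> 0 \<and> clears d v}"

lemma LL_supp: "v \<in> LL \<Longrightarrow> v \<in> supp n"
  by (auto simp: LL_def clears_def)

lemma D_pow_add: "(D ^^ j) (v + w) = (D ^^ j) v + (D ^^ j) w"
  by (induction j) (auto simp: D_add)

lemma clears_mult: "clears d v \<Longrightarrow> clears (e * d) v"
  by (auto simp: clears_def mult.assoc intro: localised_mult)

lemma clears_mult': "clears d v \<Longrightarrow> clears (d * e) v"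
  using clears_mult[of d v e] by (simp add: mult.commute)

lemma D_pow_D: "(D ^^ j) (D v) = (D ^^ Suc j) v"
  by (simp add: funpow_swap1)

lemma clears_D: "clears d v \<Longrightarrow> clears d (D v)"
  unfolding clears_def using D_pow_D by (metis D_supp)

lemma clears_ks:
  assumes "clears d v" "f \<in> R"
  shows "clears d (ks f v)"
proof -
  \<comment> \<open>Generalised over f and v, because D turns \<open>ks f v\<close> into a sum in
    which either f or v has been differentiated.\<close>
  have "\<forall>f v. f \<in> R \<longrightarrow> clears d v \<longrightarrow> (\<forall>i. to_fract d * (D ^^ j) (ks f v) i \<in> R)" for j
  proof (induction j)
    case 0
    show ?case
    proof (intro allI impI)
      fix f v i assume "f \<in> R" "clears d v"
      hence "f \<in> R" "to_fract d * (D ^^ 0) v i \<in> R" unfolding clears_def by (blast, blast)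
      hence "f * (to_fract d * (D ^^ 0) v i) \<in> R" by (rule localised_mult)
      thus "to_fract d * (D ^^ 0) (ks f v) i \<in> R" by (simp add: ks_def ac_simps)
    qed
  next
    case (Suc j)
    show ?case
    proof (intro allI impI)
      fix f v i assume f: "f \<in> R" and v: "clears d v"
      have "v \<in> supp n" using v unfolding clears_def by blast
      hence e: "D (ks f v) = ks (\<delta> f) v + ks f (D v)" by (rule D_ks)
      have "(D ^^ Suc j) (ks f v) = (D ^^ j) (D (ks f v))" by (rule D_pow_D[symmetric])
      also have "\<dots> = (D ^^ j) (ks (\<delta> f) v + ks f (D v))" by (rule arg_cong[OF e])
      also have "\<dots> = (D ^^ j) (ks (\<delta> f) v) + (D ^^ j) (ks f (D v))" by (rule D_pow_add)
      finally have "(D ^^ Suc j) (ks f v) = (D ^^ j) (ks (\<delta> f) v) + (D ^^ j) (ks f (D v))" .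
      moreover have "to_fract d * (D ^^ j) (ks (\<delta> f) v) i \<in> R"
        by (rule Suc[rule_format, OF R_\<delta>[OF f] v])
      moreover have "to_fract d * (D ^^ j) (ks f (D v)) i \<in> R"
        by (rule Suc[rule_format, OF f clears_D[OF v]])
      ultimately show "to_fract d * (D ^^ Suc j) (ks f v) i \<in> R"
        by (simp only: plus_fun_apply ring_distribs localised_add)
    qed
  qed
  thus ?thesis using assms by (auto simp: clears_def supp_ks)
qed

lemma LL_ks: "v \<in> LL \<Longrightarrow> f \<in> R \<Longrightarrow> ks f v \<in> LL"
  unfolding LL_def using clears_ks by blast

lemma \<sigma>_pow_hom:
  "(\<sigma> ^^ m) (f + g) = (\<sigma> ^^ m) f + (\<sigma> ^^ m) g"
  "(\<sigma> ^^ m) (f * g) = (\<sigma> ^^ m) f * (\<sigma> ^^ m) g"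
  "(\<sigma> ^^ m) 0 = 0"
  by (induction m) (auto simp: \<sigma>_add \<sigma>_mult)

lemma \<sigma>_pow_sum: "(\<sigma> ^^ m) (sum f S) = (\<Sum>i\<in>S. (\<sigma> ^^ m) (f i))"
  by (induction S rule: infinite_finite_induct) (auto simp: \<sigma>_pow_hom)

lemma \<sigma>_pow_denominator:
  fixes c :: "nat \<Rightarrow> nat \<Rightarrow> 'c ratfun"
  shows "\<exists>e. e \<noteq> 0 \<and> (\<forall>i<n. \<forall>j<n. to_fract e * (\<sigma> ^^ m) (c i j) \<in> R)"
proof -
  have "finite ({..<n}\<times>{..<n})" by simp
  from common_denominator[OF this, of "\<lambda>ij. (\<sigma> ^^ m) (c (fst ij) (snd ij))"]
  obtain e where e: "e \<noteq> 0"
    "\<forall>ij\<in>{..<n}\<times>{..<n}. \<exists>p. to_fract e * (\<sigma> ^^ m) (c (fst ij) (snd ij)) = to_fract p"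
    by (elim exE conjE) (rule that)
  have "to_fract e * (\<sigma> ^^ m) (c i j) \<in> R" if "i < n" "j < n" for i j
  proof -
    have "\<exists>p. to_fract e * (\<sigma> ^^ m) (c i j) = to_fract p"
      using e(2)[rule_format, of "(i, j)"] that by simp
    thus ?thesis using localised_polyI by metis
  qed
  thus ?thesis using e(1) by blast
qed

text \<open>Since D^j \<Phi> v is \<mu>^j \<Phi> D^j v, a common denominator e of the entries of
  \<open>bi\<close> times \<sigma>(d) serves all j at once.\<close>

lemma LL_Ph:
  assumes "v \<in> LL"
  shows "Ph v \<in> LL"
proof -
  obtain d where d: "d \<noteq> 0" "clears d v" using assms by (auto simp: LL_def)
  obtain e where e: "e \<noteq> 0" "\<And>i j. i < n \<Longrightarrow> j < n \<Longrightarrow> to_fract e * bi i j \<in> R"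
    using \<sigma>_pow_denominator[of 0 bi] by auto
  have \<sigma>d: "\<sigma> (to_fract d) = to_fract (pcompose d s)" using deg_s by (simp add: \<sigma>_eq rf_subst_to_fract)
  have "to_fract (e * pcompose d s) * (D ^^ j) (Ph v) i \<in> R" for i j
  proof (cases "i < n")
    case True
    have "to_fract (e * pcompose d s) * (D ^^ j) (Ph v) i
        = of_nat (\<mu> ^ j) * (\<Sum>k<n. (to_fract e * bi i k) * \<sigma> (to_fract d * (D ^^ j) v k))"
      using D_pow_Ph_pow[of j 1 v] True
      by (simp add: ks_def Ph_def \<sigma>_mult \<sigma>d sum_distrib_left ac_simps)
    also have "\<dots> \<in> R"
      using d(2) True e(2) unfolding clears_def
      by (intro localised_mult[OF localised_of_nat] localised_sum localised_mult[OF _ R_\<sigma>]) auto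
    finally show ?thesis .
  next
    case False
    have "(D ^^ j) (Ph v) \<in> supp n" by simp
    thus ?thesis using False by (simp add: supp_def)
  qed
  moreover have "e * pcompose d s \<noteq> 0" using d e deg_s by (simp add: pcompose_eq_0_iff)
  ultimately show ?thesis unfolding LL_def clears_def using Ph_supp by blast
qed

text \<open>The quantifier order matters: g depends on m alone. \<open>LL_large\<close> uses the
  same g for w replaced by D^j w and t = h^j, for all j.\<close>

lemma \<sigma>_pow_from_Ph_pow:
  "\<exists>g. g \<noteq> 0 \<and> (\<forall>w t. (\<forall>i. t * (Ph ^^ m) w i \<in> R) \<longrightarrow>
      (\<forall>i<n. to_fract g * t * (\<sigma> ^^ m) (w i) \<in> R))"
proof (induction m)
  case 0
  show ?case by (rule exI[of _ 1]) auto
next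
  case (Suc m)
  then obtain g where g: "g \<noteq> 0" "\<And>w t i. (\<forall>i. t * (Ph ^^ m) w i \<in> R) \<Longrightarrow> i < n \<Longrightarrow>
      to_fract g * t * (\<sigma> ^^ m) (w i) \<in> R" by blast
  obtain e where e: "e \<noteq> 0" "\<And>i j. i < n \<Longrightarrow> j < n \<Longrightarrow> to_fract e * (\<sigma> ^^ m) (b i j) \<in> R"
    using \<sigma>_pow_denominator[of m b] by blast
  have "to_fract (e * g) * t * (\<sigma> ^^ Suc m) (w i) \<in> R"
    if t: "\<forall>i. t * (Ph ^^ Suc m) w i \<in> R" and i: "i < n" for w t i
  proof -
    have 1: "\<forall>i. t * (Ph ^^ m) (Ph w) i \<in> R" using t by (simp add: funpow_swap1)
    have "to_fract (e * g) * t * (\<sigma> ^^ Suc m) (w i)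
        = to_fract (e * g) * t * (\<sigma> ^^ m) (\<sigma> (w i))" by (simp add: funpow_swap1)
    also have "\<dots> = (\<Sum>j<n. (to_fract e * (\<sigma> ^^ m) (b i j)) * (to_fract g * t * (\<sigma> ^^ m) (Ph w j)))"
      unfolding \<sigma>_via_Ph[OF i] \<sigma>_pow_sum \<sigma>_pow_hom sum_distrib_left
      by (intro sum.cong) (simp_all add: ac_simps)
    also have "\<dots> \<in> R" by (rule localised_sum, rule localised_mult) (use 1 i e g in auto)
    finally show ?thesis .
  qed
  thus ?case using e g by (intro exI[of _ "e * g"]) auto
qed

text \<open>The converse passage: divisibility of \<sigma>^m(w) by a fixed g compensates the
  denominators that the factors B^-1 in \<Phi>^m introduce.\<close>

lemma Ph_pow_from_\<sigma>_pow:
  "\<exists>g. g \<noteq> 0 \<and> (\<forall>w. w \<in> supp n \<longrightarrow> (\<forall>i<n. \<exists>r\<in>R. (\<sigma> ^^ m) (w i) = to_fract g * r) \<longrightarrow>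
      (\<forall>i<n. (Ph ^^ m) w i \<in> R))"
proof (induction m)
  case 0
  show ?case by (rule exI[of _ 1]) auto
next
  case (Suc m)
  then obtain g where g: "g \<noteq> 0" "\<And>w i. w \<in> supp n \<Longrightarrow>
      (\<And>i. i < n \<Longrightarrow> \<exists>r\<in>R. (\<sigma> ^^ m) (w i) = to_fract g * r) \<Longrightarrow> i < n \<Longrightarrow> (Ph ^^ m) w i \<in> R"
    by blast
  obtain e where e: "e \<noteq> 0" "\<And>i j. i < n \<Longrightarrow> j < n \<Longrightarrow> to_fract e * (\<sigma> ^^ m) (bi i j) \<in> R"
    using \<sigma>_pow_denominator[of m bi] by blast
  have "(Ph ^^ Suc m) w i \<in> R"
    if w: "w \<in> supp n" "\<forall>i<n. \<exists>r\<in>R. (\<sigma> ^^ Suc m) (w i) = to_fract (e * g) * r" and i: "i < n" for w i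
  proof -
    obtain r where r: "\<And>i. i < n \<Longrightarrow> r i \<in> R \<and> (\<sigma> ^^ Suc m) (w i) = to_fract (e * g) * r i"
      using w(2) by metis
    have "\<exists>r\<in>R. (\<sigma> ^^ m) (Ph w i) = to_fract g * r" if i: "i < n" for i
    proof
      have "(\<sigma> ^^ m) (Ph w i) = (\<Sum>j<n. (\<sigma> ^^ m) (bi i j) * (\<sigma> ^^ Suc m) (w j))"
        using i by (simp add: Ph_def \<sigma>_pow_sum \<sigma>_pow_hom funpow_swap1)
      also have "\<dots> = to_fract g * (\<Sum>j<n. (to_fract e * (\<sigma> ^^ m) (bi i j)) * r j)"
        unfolding sum_distrib_left using r by (intro sum.cong) (simp_all add: ac_simps)
      finally show "(\<sigma> ^^ m) (Ph w i) = to_fract g * (\<Sum>j<n. (to_fract e * (\<sigma> ^^ m) (bi i j)) * r j)" .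
      show "(\<Sum>j<n. (to_fract e * (\<sigma> ^^ m) (bi i j)) * r j) \<in> R"
        by (rule localised_sum, rule localised_mult) (use e r i in auto)
    qed
    hence "(Ph ^^ m) (Ph w) i \<in> R" using i by (intro g) auto
    thus ?thesis by (simp add: funpow_swap1)
  qed
  thus ?case using e g by (intro exI[of _ "e * g"]) auto
qed

section \<open>\<open>LL\<close> spans k^n over k\<close>

definition unitv :: "nat \<Rightarrow> nat \<Rightarrow> 'c ratfun" where
  "unitv i = (\<lambda>k. if k = i then 1 else 0)"

text \<open>Multiplying by f avoids the exponent j - 1.\<close>

lemma \<delta>_power: "f * \<delta> (f ^ j) = of_nat j * \<delta> f * f ^ j"
proof (induction j)
  case 0
  have "\<delta> 1 = 0" using \<delta>_const[of 1] by (simp only: rf_const_1)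
  thus ?case by simp
next
  case (Suc j)
  have "f * \<delta> (f ^ Suc j) = f * \<delta> f * f ^ j + f * (f * \<delta> (f ^ j))"
    by (simp add: \<delta>_mult algebra_simps)
  also have "\<dots> = of_nat (Suc j) * \<delta> f * f ^ Suc j"
    unfolding Suc by (simp add: algebra_simps)
  finally show ?case .
qed

text \<open>Each application of D costs at most one factor h: by the product rule h h^j \<delta>(w)
  = h \<delta>(h^j w) - j \<delta>(h) h^j w, and the right side lies in R as soon as h^j w
  does.\<close>

lemma D_pow_pole:
  assumes h: "\<And>i j. i < n \<Longrightarrow> j < n \<Longrightarrow> to_fract h * a i j \<in> R"
    and v: "\<And>i. v i \<in> R"
  shows "to_fract (h ^ j) * (D ^^ j) v i \<in> R"
proof (induction j arbitrary: i)
  case 0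
  show ?case using v by simp
next
  case (Suc j)
  define w where "w = (D ^^ j) v"
  have w: "to_fract (h ^ j) * w i \<in> R" for i using Suc w_def by simp
  show ?case
  proof (cases "i < n")
    case True
    let ?h = "to_fract h"
    have e1: "?h * (?h ^ j * \<delta> (w i)) =
        ?h * \<delta> (?h ^ j * w i) - of_nat j * \<delta> ?h * (?h ^ j * w i)"
      using \<delta>_power[of ?h j] by (simp add: \<delta>_mult algebra_simps)
    have "to_fract (h ^ Suc j) * (D ^^ Suc j) v i
        = ?h * (?h ^ j * \<delta> (w i)) - (\<Sum>k<n. (?h * a i k) * (?h ^ j * w k))"
      using True by (simp add: D_def w_def [symmetric] to_fract_pow algebra_simps sum_distrib_left)
    also have "\<dots> \<in> R"
      unfolding e1 unfolding to_fract_pow[symmetric]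
      using w h True
      by (auto intro!: localised_diff localised_sum localised_mult[OF localised_polyI R_\<delta>]
          localised_mult[OF localised_mult[OF localised_of_nat R_\<delta>[OF localised_polyI]]]
          localised_mult[OF h])
    finally show ?thesis .
  qed (simp add: D_def)
qed

text \<open>For w = g e_l, with \<sigma>^m(g) divisible by g2, the vector v = \<Phi>^m w has entries
  in R. Then h^j clears D^j w and also D^j v, and through the latter g1 h^j clears \<sigma>^m(D^j
  w). These are the two estimates required by \<open>bounded_denominator\<close>, which gives D^j w
  the denominator h^(degree g1) for every j.\<close>

lemma LL_large: "\<exists>g. g \<noteq> 0 \<and> (\<forall>i<n. ks (to_fract g) (unitv i) \<in> LL)"
proof -
  obtain h where h: "h \<noteq> 0" "\<And>i j. i < n \<Longrightarrow> j < n \<Longrightarrow> to_fract h * a i j \<in> R"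
    using \<sigma>_pow_denominator[of 0 a] by auto
  obtain m where m: "\<And>z. poly h z = 0 \<Longrightarrow> poly u z \<noteq> 0 \<Longrightarrow>
        \<exists>y. poly (((\<lambda>p. pcompose p s) ^^ m) [:0, 1:]) y = z \<and> poly h y \<noteq> 0 \<and> poly u y \<noteq> 0"
    using sep[OF h(1)] by blast
  define sm where "sm = ((\<lambda>p. pcompose p s) ^^ m) [:0, 1:]"
  have dsm: "degree sm > 0" unfolding sm_def by (rule deg_s_pow)
  have \<sigma>m: "(\<sigma> ^^ m) f = rf_subst sm f" for f unfolding sm_def by (rule \<sigma>_pow)
  obtain g1 where g1: "g1 \<noteq> 0" "\<And>w t i. (\<forall>i. t * (Ph ^^ m) w i \<in> R) \<Longrightarrow> i < n \<Longrightarrow>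
      to_fract g1 * t * (\<sigma> ^^ m) (w i) \<in> R" using \<sigma>_pow_from_Ph_pow[of m] by blast
  obtain g2 where g2: "g2 \<noteq> 0" "\<And>w i. w \<in> supp n \<Longrightarrow>
      (\<And>i. i < n \<Longrightarrow> \<exists>r\<in>R. (\<sigma> ^^ m) (w i) = to_fract g2 * r) \<Longrightarrow> i < n \<Longrightarrow> (Ph ^^ m) w i \<in> R"
    using Ph_pow_from_\<sigma>_pow[of m] by blast
  obtain g where g: "g \<noteq> 0" "g2 dvd pcompose g sm" using dvd_pcompose[OF g2(1)] by blast
  have "ks (to_fract g) (unitv l) \<in> LL" if l: "l < n" for l
  proof -
    define w where "w = ks (to_fract g) (unitv l)"
    have ws: "w \<in> supp n" using l by (auto simp: w_def ks_def unitv_def supp_def)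
    have wR: "w i \<in> R" for i by (auto simp: w_def ks_def unitv_def)
    define v where "v = (Ph ^^ m) w"
    have "\<exists>r\<in>R. (\<sigma> ^^ m) (w i) = to_fract g2 * r" if "i < n" for i
    proof (cases "i = l")
      case True
      obtain q where "pcompose g sm = g2 * q" using g(2) by (elim dvdE)
      hence "(\<sigma> ^^ m) (w i) = to_fract g2 * to_fract q"
        using dsm True by (simp add: w_def ks_def unitv_def \<sigma>m rf_subst_to_fract)
      thus ?thesis by blast
    next
      case False
      hence "w i = 0" by (simp add: w_def ks_def unitv_def)
      hence "(\<sigma> ^^ m) (w i) = to_fract g2 * 0" by (simp add: \<sigma>_pow_hom)
      thus ?thesis using localised_0 by blast
    qed
    hence "v i \<in> R" if "i < n" for i unfolding v_def using that ws by (intro g2)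
    moreover have vs: "v \<in> supp n" unfolding v_def using ws by simp
    ultimately have vR: "v i \<in> R" for i by (cases "i < n") (auto simp: supp_def)
    have "to_fract (h ^ degree g1) * (D ^^ j) w i \<in> R" for i j
    proof (cases "i < n")
      case i: True
      let ?z = "(D ^^ j) w i"
      have P: "to_fract (h ^ j) * (Ph ^^ m) ((D ^^ j) w) k \<in> R" for k
      proof -
        have "to_fract (h ^ j) * (D ^^ j) v k \<in> R" by (rule D_pow_pole[OF h(2) vR])
        \<comment> \<open>The constant \<mu>^(m j) from \<open>D_pow_Ph_pow\<close> is divided out;
          it is nonzero in characteristic zero.\<close>
        hence "rf_const (1 / of_nat (\<mu> ^ (m * j))) * (to_fract (h ^ j) * (D ^^ j) v k) \<in> R"
          by (rule localised_mult[OF localised_const])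
        also have "(D ^^ j) v k = rf_const (of_nat (\<mu> ^ (m * j))) * (Ph ^^ m) ((D ^^ j) w) k"
          unfolding v_def D_pow_Ph_pow rf_const_of_nat by (simp add: ks_def)
        also have "rf_const (1 / of_nat (\<mu> ^ (m * j))) * (to_fract (h ^ j) *
            (rf_const (of_nat (\<mu> ^ (m * j))) * (Ph ^^ m) ((D ^^ j) w) k))
            = rf_const (1 / of_nat (\<mu> ^ (m * j)) * of_nat (\<mu> ^ (m * j))) *
               (to_fract (h ^ j) * (Ph ^^ m) ((D ^^ j) w) k)"
          unfolding rf_const_mult by (simp add: ac_simps)
        also have "1 / of_nat (\<mu> ^ (m * j)) * of_nat (\<mu> ^ (m * j)) = (1::'c)" using \<mu>_pos by simp
        finally show ?thesis by (simp add: rf_const_1)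
      qed
      hence "to_fract g1 * to_fract (h ^ j) * (\<sigma> ^^ m) ?z \<in> R" using i by (intro g1) auto
      then obtain i2 r2 where 2: "to_fract (g1 * h ^ j) * rf_subst sm ?z * to_fract u ^ i2 = to_fract r2"
        unfolding \<sigma>m localised_def by auto
      have "to_fract (h ^ j) * ?z \<in> R" by (rule D_pow_pole[OF h(2) wR])
      then obtain i1 r1 where 1: "to_fract (h ^ j) * ?z * to_fract u ^ i1 = to_fract r1"
        unfolding localised_def by auto
      have "\<exists>i r. to_fract (h ^ degree g1) * ?z * to_fract u ^ i = to_fract r"
        by (rule bounded_denominator[OF dsm h(1) g1(1) u_nz _ 1 2]) (use m sm_def in auto)
      thus ?thesis unfolding localised_def by auto
    next
      case False
      have "(D ^^ j) w \<in> supp n" using ws by simp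
      thus ?thesis using False by (simp add: supp_def)
    qed
    thus ?thesis using ws h(1) unfolding w_def[symmetric] LL_def clears_def
      by (intro CollectI exI[of _ "h ^ degree g1"]) auto
  qed
  thus ?thesis using g by blast
qed

end

section \<open>The rank over the constant coefficient differential operators\<close>

text \<open>The relations used later are sums over indices. A family without nontrivial relations is
  injective, so that its index set and its image have the same size.\<close>

lemma (in vector_space) family_independent:
  assumes fin: "finite I"
    and ind: "\<And>c. (\<Sum>x\<in>I. c x *s f x) = 0 \<Longrightarrow> \<forall>x\<in>I. c x = 0"
  shows "inj_on f I" "independent (f ` I)"
proof -
  show inj: "inj_on f I"
  proof (rule inj_onI, rule ccontr)
    fix x y assume xy: "x \<in> I" "y \<in> I" "f x = f y" "x \<noteq> y"
    define c where "c = (\<lambda>z. if z = x then 1 else if z = y then -1 else (0::'a))"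
    have "(\<Sum>z\<in>I. c z *s f z) = (\<Sum>z\<in>{x, y}. c z *s f z)"
      using xy fin by (intro sum.mono_neutral_right) (auto simp: c_def)
    also have "\<dots> = 0" using xy by (simp add: c_def)
    finally have "c x = 0" using ind xy by blast
    thus False by (simp add: c_def)
  qed
  have "u (f x) = 0" if "(\<Sum>v\<in>f ` I. u v *s v) = 0" "x \<in> I" for u x
    using ind[of "\<lambda>x. u (f x)"] that by (simp add: sum.reindex[OF inj])
  thus "independent (f ` I)" using fin by (auto simp: dependent_finite)
qed

lemma (in vector_space) family_card_le:
  assumes "finite I" "\<And>c. (\<Sum>x\<in>I. c x *s f x) = 0 \<Longrightarrow> \<forall>x\<in>I. c x = 0"
    and "f ` I \<subseteq> span T" "finite T"
  shows "card I \<le> card T"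
  using family_independent[OF assms(1,2)] independent_span_bound[OF assms(4) _ assms(3)]
  by (metis card_image)

section \<open>The action p(T) v of polynomials p in a C-linear operator T\<close>

definition pact :: "((nat \<Rightarrow> 'c::field ratfun) \<Rightarrow> nat \<Rightarrow> 'c ratfun) \<Rightarrow> 'c poly \<Rightarrow>
    (nat \<Rightarrow> 'c ratfun) \<Rightarrow> nat \<Rightarrow> 'c ratfun" where
  "pact T p v = (\<Sum>j\<le>degree p. sc (coeff p j) ((T ^^ j) v))"

lemma pact_alt: "degree p \<le> N \<Longrightarrow> pact T p v = (\<Sum>j\<le>N. sc (coeff p j) ((T ^^ j) v))"
  unfolding pact_def by (rule sum.mono_neutral_left) (auto simp: coeff_eq_0)

lemma pact_0 [simp]: "pact T 0 v = 0"
  by (simp add: pact_def)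

lemma pact_1 [simp]: "pact T 1 v = v"
  by (simp add: pact_def)

lemma pact_add: "pact T (p + q) v = pact T p v + pact T q v"
proof -
  define N where "N = max (degree p) (degree q)"
  have N: "degree p \<le> N" "degree q \<le> N" "degree (p + q) \<le> N"
    unfolding N_def by (auto intro: degree_add_le)
  show ?thesis unfolding N[THEN pact_alt] by (simp add: cv.scale_left_distrib sum.distrib)
qed

lemma pact_smult: "pact T (Polynomial.smult c p) v = sc c (pact T p v)"
proof -
  have N: "degree p \<le> degree p" "degree (Polynomial.smult c p) \<le> degree p"
    by (auto simp: degree_smult_le)
  show ?thesis unfolding N[THEN pact_alt] by (simp add: cv.scale_sum_right)
qed

lemma pact_uminus: "pact T (- p) v = - pact T p v"
  using pact_smult[of T "-1" p v] by (simp add: cv.scale_minus_left)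

lemma pact_diff: "pact T (p - q) v = pact T p v - pact T q v"
  using pact_add[of T p "- q" v] by (simp add: pact_uminus)

lemma pact_sum: "pact T (sum f S) v = (\<Sum>i\<in>S. pact T (f i) v)"
  by (induction S rule: infinite_finite_induct) (auto simp: pact_add)

locale c_linear =
  fixes T :: "(nat \<Rightarrow> 'c::field ratfun) \<Rightarrow> nat \<Rightarrow> 'c ratfun"
  assumes T_add: "T (v + w) = T v + T w" and T_sc: "T (sc c v) = sc c (T v)"
begin

lemma T_0 [simp]: "T 0 = 0" using T_sc[of 0 0] by simp

lemma T_sum: "T (sum f S) = (\<Sum>i\<in>S. T (f i))"
  by (induction S rule: infinite_finite_induct) (auto simp: T_add)

lemma T_minus: "T (- v) = - T v"
  using T_sc[of "-1" v] by (simp add: cv.scale_minus_left)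

lemma T_diff: "T (v - w) = T v - T w"
  using T_add[of v "- w"] by (simp add: T_minus)

lemma T_pow_add: "(T ^^ j) (v + w) = (T ^^ j) v + (T ^^ j) w"
  by (induction j) (auto simp: T_add)

lemma T_pow_sc: "(T ^^ j) (sc c v) = sc c ((T ^^ j) v)"
  by (induction j) (auto simp: T_sc)

lemma pact_add_right: "pact T p (v + w) = pact T p v + pact T p w"
  by (simp add: pact_def T_pow_add cv.scale_right_distrib sum.distrib)

lemma pact_sc_right: "pact T p (sc c v) = sc c (pact T p v)"
  by (simp add: pact_def T_pow_sc cv.scale_sum_right mult.commute)

lemma pact_linear: "c_linear (pact T p)"
  by unfold_locales (rule pact_add_right, rule pact_sc_right)

lemma pact_zero_right [simp]: "pact T p 0 = 0"
  using pact_sc_right[of p 0 0] by simp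

lemma pact_pCons: "pact T (pCons c p) v = sc c v + T (pact T p v)"
proof -
  have "pact T (pCons c p) v = (\<Sum>j\<le>Suc (degree p). sc (coeff (pCons c p) j) ((T ^^ j) v))"
    by (rule pact_alt) (simp add: degree_pCons_le)
  also have "\<dots> = sc c v + T (pact T p v)"
    by (subst sum.atMost_Suc_shift) (simp add: pact_def T_sum T_sc)
  finally show ?thesis .
qed

lemma pact_mult: "pact T (p * q) v = pact T p (pact T q v)"
  by (induction p) (auto simp: pact_add pact_smult pact_pCons)

lemma pact_const: "pact T [:c:] v = sc c v"
  by (simp add: pact_pCons)

lemma pact_monom: "pact T (monom c j) v = sc c ((T ^^ j) v)"
proof -
  have "pact T (monom c j) v = (\<Sum>i\<le>j. sc (coeff (monom c j) i) ((T ^^ i) v))"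
    by (rule pact_alt) (rule degree_monom_le)
  also have "\<dots> = (\<Sum>i\<in>{j}. sc (coeff (monom c j) i) ((T ^^ i) v))"
    by (rule sum.mono_neutral_right) auto
  finally show ?thesis by simp
qed

lemma pact_commute: "pact T p (pact T q v) = pact T q (pact T p v)"
  by (metis pact_mult mult.commute)

end

context system_cases
begin

sublocale Dl: c_linear D
  by unfold_locales (rule D_add, rule D_sc)

sublocale Phl: c_linear Ph
  by unfold_locales (rule Ph_add, rule Ph_sc)

section \<open>Bounds N for the pole orders at infinity (\<open>size_inf\<close>) and at the zero of
  u (\<open>size_u\<close>)\<close>

definition size_inf :: "nat \<Rightarrow> 'c ratfun \<Rightarrow> bool" where
  "size_inf N f \<longleftrightarrow> (\<exists>p q. q \<noteq> 0 \<and> f = to_fract p / to_fract q \<and> degree p \<le> degree q + N)"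

text \<open>For u = 1 the condition on the zeros of q is vacuous and every f qualifies.\<close>

definition size_u :: "nat \<Rightarrow> 'c ratfun \<Rightarrow> bool" where
  "size_u N f \<longleftrightarrow> (\<exists>p q. q \<noteq> 0 \<and> f * to_fract u ^ N = to_fract p / to_fract q \<and>
      (\<forall>z. poly u z = 0 \<longrightarrow> poly q z \<noteq> 0))"

lemma size_inf_add:
  assumes "size_inf N f" "size_inf N g"
  shows "size_inf N (f + g)"
proof -
  obtain p q p' q' where *: "q \<noteq> 0" "f = to_fract p / to_fract q" "degree p \<le> degree q + N"
    "q' \<noteq> 0" "g = to_fract p' / to_fract q'" "degree p' \<le> degree q' + N"
    using assms unfolding size_inf_def by blast
  have "f + g = to_fract (p * q' + p' * q) / to_fract (q * q')"
    using * by (simp add: field_simps)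
  moreover have "degree (p * q' + p' * q) \<le> degree (q * q') + N"
    using * degree_mult_le[of p q'] degree_mult_le[of p' q]
    by (intro degree_add_le) (auto simp: degree_mult_eq)
  ultimately show ?thesis using * unfolding size_inf_def by (metis no_zero_divisors)
qed

lemma size_inf_mult:
  assumes "size_inf N f" "size_inf M g"
  shows "size_inf (N + M) (f * g)"
proof -
  obtain p q p' q' where *: "q \<noteq> 0" "f = to_fract p / to_fract q" "degree p \<le> degree q + N"
    "q' \<noteq> 0" "g = to_fract p' / to_fract q'" "degree p' \<le> degree q' + M"
    using assms unfolding size_inf_def by blast
  have "f * g = to_fract (p * p') / to_fract (q * q')"
    using * by simp
  moreover have "degree (p * p') \<le> degree (q * q') + (N + M)"
    using * degree_mult_le[of p p'] by (auto simp: degree_mult_eq)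
  ultimately show ?thesis using * unfolding size_inf_def by (metis no_zero_divisors)
qed

lemma size_inf_mono: "size_inf N f \<Longrightarrow> N \<le> M \<Longrightarrow> size_inf M f"
  unfolding size_inf_def by (metis add_left_mono order_trans)

text \<open>As u has degree at most 1, \<delta> does not worsen a pole at infinity; growth under D
  comes from the entries of a alone.\<close>

lemma degree_u_pderiv: "degree (u * pderiv p) \<le> degree p"
proof (cases "degree p = 0")
  case True
  hence "pderiv p = 0" by (simp add: pderiv_eq_0_iff)
  thus ?thesis by simp
next
  case False
  have "degree (u * pderiv p) \<le> degree u + degree (pderiv p)" by (rule degree_mult_le)
  also have "\<dots> \<le> 1 + (degree p - 1)" using u_cases by (auto simp: degree_pderiv)
  finally show ?thesis using False by simp
qed

lemma \<delta>_div:
  "q \<noteq> 0 \<Longrightarrow> \<delta> (to_fract p / to_fract q)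
    = to_fract (u * pderiv p * q - p * (u * pderiv q)) / to_fract (q * q)"
  using rf_deriv_Fract[of q p] unfolding \<delta>_eq Fract_eq_to_fract
  by (simp add: algebra_simps)

lemma size_inf_\<delta>:
  assumes "size_inf N f"
  shows "size_inf N (\<delta> f)"
proof -
  obtain p q where *: "q \<noteq> 0" "f = to_fract p / to_fract q" "degree p \<le> degree q + N"
    using assms unfolding size_inf_def by blast
  have "degree (u * pderiv p * q - p * (u * pderiv q)) \<le> degree p + degree q"
    using degree_u_pderiv[of p] degree_u_pderiv[of q]
    by (intro degree_diff_le order_trans[OF degree_mult_le[of "u * pderiv p"]]
        order_trans[OF degree_mult_le[of p]] add_mono) auto
  also have "\<dots> \<le> degree (q * q) + N" using * by (simp add: degree_mult_eq)
  finally show ?thesis using * unfolding size_inf_def by (metis no_zero_divisors \<delta>_div)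
qed

lemma size_u_add:
  assumes "size_u N f" "size_u N g"
  shows "size_u N (f + g)"
proof -
  obtain p q p' q' where *: "q \<noteq> 0" "f * to_fract u ^ N = to_fract p / to_fract q"
    "\<forall>z. poly u z = 0 \<longrightarrow> poly q z \<noteq> 0"
    "q' \<noteq> 0" "g * to_fract u ^ N = to_fract p' / to_fract q'"
    "\<forall>z. poly u z = 0 \<longrightarrow> poly q' z \<noteq> 0"
    using assms unfolding size_u_def by blast
  have "(f + g) * to_fract u ^ N = to_fract (p * q' + p' * q) / to_fract (q * q')"
    unfolding ring_distribs using * by (simp add: field_simps)
  moreover have "\<forall>z. poly u z = 0 \<longrightarrow> poly (q * q') z \<noteq> 0" using * by auto
  ultimately show ?thesis using * unfolding size_u_def by (metis no_zero_divisors)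
qed

lemma size_u_mult:
  assumes "size_u N f" "size_u M g"
  shows "size_u (N + M) (f * g)"
proof -
  obtain p q p' q' where *: "q \<noteq> 0" "f * to_fract u ^ N = to_fract p / to_fract q"
    "\<forall>z. poly u z = 0 \<longrightarrow> poly q z \<noteq> 0"
    "q' \<noteq> 0" "g * to_fract u ^ M = to_fract p' / to_fract q'"
    "\<forall>z. poly u z = 0 \<longrightarrow> poly q' z \<noteq> 0"
    using assms unfolding size_u_def by blast
  have "(f * g) * to_fract u ^ (N + M) = (f * to_fract u ^ N) * (g * to_fract u ^ M)"
    by (simp add: power_add ac_simps)
  hence "(f * g) * to_fract u ^ (N + M) = to_fract (p * p') / to_fract (q * q')"
    using * by simp
  moreover have "\<forall>z. poly u z = 0 \<longrightarrow> poly (q * q') z \<noteq> 0" using * by auto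
  ultimately show ?thesis using * unfolding size_u_def by (metis no_zero_divisors)
qed

lemma size_u_poly: "size_u N (to_fract p)"
proof -
  have "to_fract p * to_fract u ^ N = to_fract (p * u ^ N) / to_fract 1"
    by (simp add: to_fract_pow)
  thus ?thesis unfolding size_u_def by (metis poly_1 zero_neq_one)
qed

lemma size_u_mono:
  assumes "size_u N f" "N \<le> M"
  shows "size_u M f"
proof -
  have "size_u (N + (M - N)) (f * to_fract 1)"
    using assms(1) size_u_poly by (rule size_u_mult)
  thus ?thesis using assms(2) by simp
qed

text \<open>From \<delta>(u^N) = N u' u^N one gets u^N \<delta>(f) = \<delta>(u^N f) - N u' u^N f,
  and neither term has a pole at the zero of u.\<close>

lemma size_u_\<delta>:
  assumes "size_u N f"
  shows "size_u N (\<delta> f)"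
proof -
  obtain p q where *: "q \<noteq> 0" "f * to_fract u ^ N = to_fract p / to_fract q"
    "\<forall>z. poly u z = 0 \<longrightarrow> poly q z \<noteq> 0"
    using assms unfolding size_u_def by blast
  let ?u = "to_fract u"
  have of_nat: "to_fract (of_nat k) = of_nat k" for k by (induction k) auto
  have U: "\<delta> (?u ^ N) = of_nat N * to_fract (pderiv u) * ?u ^ N"
  proof -
    have "?u * \<delta> (?u ^ N) = ?u * (of_nat N * to_fract (pderiv u) * ?u ^ N)"
      unfolding \<delta>_power by (simp add: \<delta>_eq rf_deriv_to_fract)
    thus ?thesis using u_nz by simp
  qed
  have "\<delta> f * ?u ^ N = \<delta> (f * ?u ^ N) - of_nat N * to_fract (pderiv u) * (f * ?u ^ N)"
    by (simp add: \<delta>_mult U)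
  also have "\<dots> = to_fract (u * pderiv p * q - p * (u * pderiv q)) / to_fract (q * q)
      - of_nat N * to_fract (pderiv u) * (to_fract p / to_fract q)"
    unfolding * using * by (simp only: \<delta>_div not_False_eq_True)
  also have "of_nat N * to_fract (pderiv u) * (to_fract p / to_fract q)
      = to_fract (of_nat N * pderiv u * p * q) / to_fract (q * q)"
    using * by (simp add: of_nat)
  finally have "\<delta> f * ?u ^ N = to_fract (u * pderiv p * q - p * (u * pderiv q)
      - of_nat N * pderiv u * p * q) / to_fract (q * q)"
    by (simp only: diff_divide_distrib to_fract_diff)
  moreover have "\<forall>z. poly u z = 0 \<longrightarrow> poly (q * q) z \<noteq> 0" using * by auto
  ultimately show ?thesis using *(1) unfolding size_u_def by (metis no_zero_divisors)
qed

lemma size_inf_exists: "\<exists>N. size_inf N f"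
proof -
  obtain p q where "q \<noteq> 0" "f = to_fract p / to_fract q" using to_fract_div by blast
  hence "size_inf (degree p) f" unfolding size_inf_def by (intro exI[of _ p] exI[of _ q]) auto
  thus ?thesis by blast
qed

lemma size_u_exists: "\<exists>N. size_u N f"
proof -
  obtain p q where f: "q \<noteq> 0" "f = to_fract p / to_fract q" using to_fract_div by blast
  show ?thesis
  proof (cases "u = 1")
    case True
    have "size_u 0 f" unfolding size_u_def using f True by auto
    thus ?thesis by blast
  next
    case False
    hence u: "u = [:0, 1:]" using u_cases by blast
    obtain r where r: "q = [:- 0, 1:] ^ order 0 q * r" "\<not> [:- 0, 1:] dvd r"
      using order_decomp[OF f(1)] by blast
    have q: "to_fract q = to_fract u ^ order 0 q * to_fract r"
      using arg_cong[OF r(1), of to_fract] u by (simp add: to_fract_pow)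
    have "r \<noteq> 0" using r f by auto
    hence "f * to_fract u ^ order 0 q = to_fract p / to_fract r"
      unfolding f(2) q using u_nz by simp
    moreover have "\<forall>z. poly u z = 0 \<longrightarrow> poly r z \<noteq> 0" using r(2) u by (auto simp: dvd_iff_poly_eq_0)
    ultimately have "size_u (order 0 q) f" unfolding size_u_def using \<open>r \<noteq> 0\<close> by blast
    thus ?thesis by blast
  qed
qed

definition size_le :: "nat \<Rightarrow> 'c ratfun \<Rightarrow> bool" where
  "size_le N f \<longleftrightarrow> size_inf N f \<and> size_u N f"

lemma size_le_add: "size_le N f \<Longrightarrow> size_le N g \<Longrightarrow> size_le N (f + g)"
  and size_le_mult: "size_le N f \<Longrightarrow> size_le M g \<Longrightarrow> size_le (N + M) (f * g)"
  and size_le_mono: "size_le N f \<Longrightarrow> N \<le> M \<Longrightarrow> size_le M f"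
  and size_le_\<delta>: "size_le N f \<Longrightarrow> size_le N (\<delta> f)"
  unfolding size_le_def
  by (blast intro: size_inf_add size_u_add size_inf_mult size_u_mult size_inf_mono size_u_mono
      size_inf_\<delta> size_u_\<delta>)+

lemma size_le_const: "size_le N (rf_const c)"
proof -
  have "size_inf 0 (rf_const c)" unfolding size_inf_def rf_const_def
    by (intro exI[of _ "[:c:]"] exI[of _ 1]) auto
  hence "size_inf N (rf_const c)" by (rule size_inf_mono) simp
  moreover have "size_u N (rf_const c)" unfolding rf_const_def by (rule size_u_poly)
  ultimately show ?thesis by (simp add: size_le_def)
qed

lemma size_le_diff:
  assumes "size_le N f" "size_le N g"
  shows "size_le N (f - g)"
proof -
  have "size_le (0 + N) (rf_const (-1) * g)" using assms by (intro size_le_mult size_le_const)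
  hence "size_le N (f + rf_const (-1) * g)" using assms by (intro size_le_add) auto
  thus ?thesis by (simp add: rf_const_minus rf_const_1)
qed

lemma size_le_sum: "(\<And>i. i \<in> S \<Longrightarrow> size_le N (f i)) \<Longrightarrow> size_le N (sum f S)"
  using size_le_const[of N 0]
  by (induction S rule: infinite_finite_induct) (auto intro: size_le_add simp: rf_const_0)

lemma size_le_exists: "\<exists>N. size_le N f"
proof -
  obtain N M where "size_inf N f" "size_u M f" using size_inf_exists size_u_exists by blast
  hence "size_le (max N M) f" unfolding size_le_def
    by (auto intro: size_inf_mono size_u_mono)
  thus ?thesis by blast
qed

lemma size_le_uniform: "finite S \<Longrightarrow> \<exists>N. \<forall>x\<in>S. size_le N (f x)"
proof (induction S rule: finite_induct)
  case (insert x S)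
  then obtain N M where "\<forall>x\<in>S. size_le N (f x)" "size_le M (f x)" using size_le_exists by blast
  hence "\<forall>y\<in>insert x S. size_le (max N M) (f y)" by (auto intro: size_le_mono)
  thus ?case by blast
qed auto

lemma size_le_D: "\<exists>c. \<forall>v N. (\<forall>i. size_le N (v i)) \<longrightarrow> (\<forall>i. size_le (N + c) (D v i))"
proof -
  have "finite ({..<n} \<times> {..<n})" by simp
  from size_le_uniform[OF this, of "\<lambda>ij. a (fst ij) (snd ij)"]
  obtain c where c: "\<And>i j. i < n \<Longrightarrow> j < n \<Longrightarrow> size_le c (a i j)" by auto
  have "size_le (N + c) (D v i)" if "\<forall>i. size_le N (v i)" for v N i
  proof (cases "i < n")
    case True
    have "size_le (c + N) (a i j * v j)" if "j < n" for j
      using c True that \<open>\<forall>i. size_le N (v i)\<close> by (intro size_le_mult) auto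
    hence "size_le (N + c) (\<Sum>j<n. a i j * v j)" by (intro size_le_sum) (auto simp: add.commute)
    moreover have "size_le (N + c) (\<delta> (v i))"
      using size_le_\<delta>[OF that[rule_format]] by (rule size_le_mono) simp
    ultimately show ?thesis using True by (simp add: D_def size_le_diff)
  next
    case False
    thus ?thesis using size_le_const[of _ 0] by (simp add: D_def rf_const_0)
  qed
  thus ?thesis by blast
qed

text \<open>If u^N f is written as p/q with q nonzero at the zeros of u, then q divides d p, because
  d clears f up to powers of u. The degree bound collects N from the pole at infinity and at most N
  from u^N.\<close>

lemma size_le_cleared:
  assumes "size_le N f" "to_fract d * f \<in> R" "d \<noteq> 0"
  shows "\<exists>p. to_fract d * f * to_fract u ^ N = to_fract p \<and> degree p \<le> degree d + 2 * N"
proof (cases "f = 0")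
  case True
  thus ?thesis by (intro exI[of _ 0]) auto
next
  case False
  obtain i r where ir: "to_fract d * f * to_fract u ^ i = to_fract r"
    using assms(2) unfolding localised_def by blast
  obtain p q where pq: "q \<noteq> 0" "f * to_fract u ^ N = to_fract p / to_fract q"
    "\<And>z. poly u z = 0 \<Longrightarrow> poly q z \<noteq> 0"
    using assms(1) unfolding size_le_def size_u_def by blast
  have p: "p \<noteq> 0" using False pq u_nz by auto
  have "to_fract (r * u ^ N * q) = to_fract d * f * to_fract u ^ i * to_fract u ^ N * to_fract q"
    using ir by (simp add: to_fract_pow)
  also have "\<dots> = to_fract d * (f * to_fract u ^ N) * to_fract u ^ i * to_fract q"
    by (simp add: ac_simps)
  also have "\<dots> = to_fract (d * p * u ^ i)" unfolding pq(2) using pq(1) by (simp add: to_fract_pow)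
  finally have e: "r * u ^ N * q = d * p * u ^ i" by (simp only: to_fract_eq_iff)
  have "q dvd d * p"
  proof (rule dvd_of_order_le)
    fix z assume z: "poly q z = 0"
    hence "poly u z \<noteq> 0" using pq(3) by blast
    hence "order z (u ^ i) = 0" by (simp add: order_0I)
    moreover have "d * p * u ^ i \<noteq> 0" using assms p u_nz by simp
    ultimately have "order z (d * p) = order z (d * p * u ^ i)" by (simp add: order_mult)
    also have "\<dots> = order z (r * u ^ N) + order z q"
      unfolding e[symmetric] using \<open>d * p * u ^ i \<noteq> 0\<close> e by (subst order_mult) auto
    finally show "order z q \<le> order z (d * p)" by simp
  qed (use assms p pq in auto)
  then obtain w where w: "d * p = q * w" by (elim dvdE)
  have P: "to_fract d * f * to_fract u ^ N = to_fract w"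
  proof -
    have "to_fract d * f * to_fract u ^ N = to_fract (d * p) / to_fract q"
      using pq(2) by (simp add: mult.assoc)
    thus ?thesis unfolding w using pq by simp
  qed
  obtain p2 q2 where pq2: "q2 \<noteq> 0" "f = to_fract p2 / to_fract q2" "degree p2 \<le> degree q2 + N"
    using assms(1) unfolding size_le_def size_inf_def by blast
  have "w \<noteq> 0" using w p assms by auto
  have "to_fract (d * p2 * u ^ N) = to_fract d * f * to_fract u ^ N * to_fract q2"
    unfolding pq2(2) using pq2(1) by (simp add: to_fract_pow)
  also have "\<dots> = to_fract (w * q2)" unfolding P by simp
  finally have "d * p2 * u ^ N = w * q2" by (simp only: to_fract_eq_iff)
  hence "degree w + degree q2 = degree (d * p2 * u ^ N)"
    using \<open>w \<noteq> 0\<close> pq2 by (simp add: degree_mult_eq)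
  also have "\<dots> \<le> degree d + degree p2 + degree (u ^ N)"
    by (meson add_right_mono degree_mult_le order_trans)
  also have "degree (u ^ N) \<le> N" using u_cases by (auto simp: degree_power_eq)
  finally have "degree w \<le> degree d + 2 * N" using pq2(3) by simp
  thus ?thesis using P by blast
qed

section \<open>Linear independence over C[D] (\<open>theta_indep\<close>) and the rank of
  \<open>LL\<close>\<close>

definition theta_indep :: "(nat \<Rightarrow> nat \<Rightarrow> 'c ratfun) \<Rightarrow> nat \<Rightarrow> bool" where
  "theta_indep m r \<longleftrightarrow> (\<forall>P. (\<Sum>i<r. pact D (P i) (m i)) = 0 \<longrightarrow> (\<forall>i<r. P i = 0))"

text \<open>Expanding the cleared entries into monomials gives an explicit generating family with n
  (M + 1) members, one side of the dimension count below.\<close>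

lemma cspan_cleared:
  assumes d: "d \<noteq> 0" and w: "w \<in> supp n"
    and p: "\<And>i. \<exists>p. to_fract d * w i * to_fract u ^ N = to_fract p \<and> degree p \<le> M"
  shows "w \<in> cv.span ((\<lambda>(l, k). ks (to_fract (monom 1 k) / (to_fract d * to_fract u ^ N)) (unitv l))
      ` ({..<n} \<times> {..M}))" (is "w \<in> cv.span (?g ` _)")
proof -
  obtain P where P: "\<And>i. to_fract d * w i * to_fract u ^ N = to_fract (P i)" "\<And>i. degree (P i) \<le> M"
    using p by metis
  let ?e = "to_fract d * to_fract u ^ N"
  have e: "?e \<noteq> 0" using d u_nz by simp
  have wi: "w i = to_fract (P i) / ?e" for i
    using P(1)[of i] e by (simp add: field_simps)
  have "w = (\<Sum>l<n. \<Sum>k\<le>M. sc (coeff (P l) k) (?g (l, k)))"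
  proof
    fix i
    have "(\<Sum>l<n. \<Sum>k\<le>M. sc (coeff (P l) k) (?g (l, k))) i =
      (\<Sum>l<n. \<Sum>k\<le>M. rf_const (coeff (P l) k) * (to_fract (monom 1 k) / ?e * (if i = l then 1 else 0)))"
      by (simp add: sum_fun_app sc_def ks_def unitv_def)
    also have "\<dots> = (\<Sum>l<n. if i = l then to_fract (\<Sum>k\<le>M. monom (coeff (P l) k) k) / ?e else 0)"
      by (intro sum.cong)
        (auto simp: to_fract_sum to_fract_monom rf_const_1 sum_divide_distrib)
    also have "\<dots> = (\<Sum>l<n. if i = l then w l else 0)"
    proof (intro sum.cong refl)
      fix l
      have "(\<Sum>k\<le>M. monom (coeff (P l) k) k) = P l"
        using P(2)[of l] by (simp add: poly_as_sum_of_monoms')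
      thus "(if i = l then to_fract (\<Sum>k\<le>M. monom (coeff (P l) k) k) / ?e else 0) =
          (if i = l then w l else 0)" using wi by simp
    qed
    also have "\<dots> = w i" using w by (auto simp: supp_def)
    finally show "w i = (\<Sum>l<n. \<Sum>k\<le>M. sc (coeff (P l) k) (?g (l, k))) i" ..
  qed
  moreover have "(\<Sum>l<n. \<Sum>k\<le>M. sc (coeff (P l) k) (?g (l, k))) \<in> cv.span (?g ` ({..<n} \<times> {..M}))"
    by (intro cv.span_sum cv.span_scale cv.span_base) auto
  ultimately show ?thesis by simp
qed

text \<open>Counting: \<open>D\<^sup>j m\<close> has a denominator independent of \<open>j\<close>, while its degree at infinity and its
  pole at the zero of \<open>u\<close> grow at most linearly in \<open>j\<close> with a slope depending on \<open>a\<close> only.\<close>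
lemma theta_rank_bound: "\<exists>r0. \<forall>m r. (\<forall>i<r. m i \<in> LL) \<longrightarrow> theta_indep m r \<longrightarrow> r \<le> r0"
proof -
  obtain c where c: "\<And>v N i. (\<forall>i. size_le N (v i)) \<Longrightarrow> size_le (N + c) (D v i)"
    using size_le_D by blast
  have "r \<le> 2 * n * c" if m: "\<And>i. i < r \<Longrightarrow> m i \<in> LL" and ind: "theta_indep m r" for m r
  proof (rule ccontr)
    assume r: "\<not> r \<le> 2 * n * c"
    have "\<exists>d. d \<noteq> 0 \<and> (\<forall>i<k. clears d (m i))" if "k \<le> r" for k
      using that
    proof (induction k)
      case 0
      show ?case by (rule exI[of _ 1]) auto
    next
      case (Suc k)
      then obtain d where d: "d \<noteq> 0" "\<forall>i<k. clears d (m i)" by auto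
      obtain e where e: "e \<noteq> 0" "clears e (m k)" using m[of k] Suc by (auto simp: LL_def)
      have "\<forall>i<Suc k. clears (d * e) (m i)"
        using d e clears_mult clears_mult' by (auto simp: less_Suc_eq)
      thus ?case using d e by (intro exI[of _ "d * e"]) auto
    qed
    then obtain d where d: "d \<noteq> 0" "\<And>i. i < r \<Longrightarrow> clears d (m i)" by blast
    have "finite ({..<r} \<times> {..<n})" by simp
    from size_le_uniform[OF this, of "\<lambda>il. m (fst il) (snd il)"]
    obtain K where K: "\<And>i l. i < r \<Longrightarrow> l < n \<Longrightarrow> size_le K (m i l)" by auto
    have K: "size_le K (m i l)" if "i < r" for i l
    proof (cases "l < n")
      case False
      hence "m i l = 0" using LL_supp[OF m[OF that]] by (simp add: supp_def)
      thus ?thesis using size_le_const[of K 0] by (simp add: rf_const_0)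
    qed (use K that in auto)
    have sz: "size_le (K + c * j) ((D ^^ j) (m i) l)" if "i < r" for i j l
    proof (induction j arbitrary: l)
      case (Suc j)
      have "size_le (K + c * j + c) (D ((D ^^ j) (m i)) l)" using Suc by (intro c) blast
      thus ?case by (simp add: algebra_simps)
    qed (use K that in auto)
    \<comment> \<open>J is chosen so that n (M + 1) = J + 2 n c J. For r > 2 n c this is less than r
      (J + 1), the number of vectors D^j m_i with j up to J. The factor 2 stems from the poles at
      infinity and at the zero of u, each growing with slope at most c.\<close>
    define J where "J = n * (degree d + 2 * K + 1)"
    define N where "N = K + c * J"
    define M where "M = degree d + 2 * N"
    let ?g = "\<lambda>(l, k). ks (to_fract (monom 1 k) / (to_fract d * to_fract u ^ N)) (unitv l)"
    let ?f = "\<lambda>(i, j). (D ^^ j) (m i)"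
    have "card ({..<r} \<times> {..J}) \<le> card (?g ` ({..<n} \<times> {..M}))"
    proof (rule cv.family_card_le)
      fix C assume C: "(\<Sum>x\<in>{..<r} \<times> {..J}. sc (C x) (?f x)) = 0"
      define P where "P = (\<lambda>i. \<Sum>j\<le>J. monom (C (i, j)) j)"
      have "(\<Sum>i<r. pact D (P i) (m i)) = (\<Sum>i<r. \<Sum>j\<le>J. sc (C (i, j)) ((D ^^ j) (m i)))"
        by (simp add: P_def pact_sum Dl.pact_monom)
      also have "\<dots> = (\<Sum>x\<in>{..<r} \<times> {..J}. sc (C x) (?f x))"
        by (simp add: sum.cartesian_product case_prod_unfold)
      finally have P0: "\<forall>i<r. P i = 0" using ind C unfolding theta_indep_def by simp
      have "coeff (P i) j = C (i, j)" if "j \<le> J" for i j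
        using that by (simp add: P_def coeff_sum)
      thus "\<forall>x\<in>{..<r} \<times> {..J}. C x = 0" using P0 by (auto simp: le_less) (metis coeff_0)+
    next
      show "?f ` ({..<r} \<times> {..J}) \<subseteq> cv.span (?g ` ({..<n} \<times> {..M}))"
      proof (clarsimp)
        fix i j assume ij: "i < r" "j \<le> J"
        have cl: "clears d (m i)" using d ij by blast
        show "(D ^^ j) (m i) \<in> cv.span (?g ` ({..<n} \<times> {..M}))"
        proof (rule cspan_cleared[OF d(1)])
          show "(D ^^ j) (m i) \<in> supp n" using cl by (simp add: clears_def)
          fix l
          have "size_le N ((D ^^ j) (m i) l)"
            using sz[OF ij(1)] by (rule size_le_mono) (use ij in \<open>simp add: N_def\<close>)
          moreover have "to_fract d * (D ^^ j) (m i) l \<in> R" using cl by (simp add: clears_def)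
          ultimately show "\<exists>p. to_fract d * (D ^^ j) (m i) l * to_fract u ^ N = to_fract p \<and> degree p \<le> M"
            unfolding M_def using d(1) by (rule size_le_cleared)
        qed
      qed
    qed auto
    also have "\<dots> \<le> card ({..<n} \<times> {..M})" by (rule card_image_le) simp
    finally have "r * Suc J \<le> n * Suc M" by (simp add: card_cartesian_product)
    moreover have "(2 * n * c + 1) * Suc J \<le> r * Suc J" using r by (intro mult_right_mono) auto
    moreover have "n * Suc M = J + 2 * n * c * J" by (simp add: M_def N_def J_def algebra_simps)
    ultimately show False by (simp add: algebra_simps)
  qed
  thus ?thesis by blast
qed

end

section \<open>Torsion\<close>

lemma coeff_pcompose_monom:
  fixes p :: "'a::comm_ring_1 poly"
  assumes "r < q"
  shows "coeff (pcompose p (monom 1 q)) (j * q + r) = (if r = 0 then coeff p j else 0)"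
proof -
  have m: "pcompose (monom c i) (monom 1 q) = monom c (i * q)" for c :: 'a and i
    by (induction i) (auto simp: monom_0 monom_Suc pcompose_pCons mult_monom)
  have eq: "i * q = j * q + r \<longleftrightarrow> i = j \<and> r = 0" for i
  proof
    assume "i * q = j * q + r"
    moreover from this have "i = j" using assms
      by (metis div_mult_self3 div_mult_self_is_m div_less less_nat_zero_code nat_neq_iff add.commute
          add.right_neutral)
    ultimately show "i = j \<and> r = 0" by simp
  qed auto
  have "pcompose p (monom 1 q) = pcompose (\<Sum>i\<le>degree p. monom (coeff p i) i) (monom 1 q)"
    by (simp add: poly_as_sum_of_monoms)
  also have "\<dots> = (\<Sum>i\<le>degree p. monom (coeff p i) (i * q))"
    by (simp add: pcompose_sum m)
  finally have "coeff (pcompose p (monom 1 q)) (j * q + r)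
      = (\<Sum>i\<le>degree p. if i = j \<and> r = 0 then coeff p i else 0)"
    by (simp add: coeff_sum eq)
  also have "\<dots> = (if r = 0 then coeff p j else 0)"
    by (auto simp: coeff_eq_0)
  finally show ?thesis .
qed

text \<open>The summand with index r contains only exponents congruent to r modulo q, so different
  summands cannot cancel.\<close>

lemma monom_pcompose_independent:
  fixes p :: "nat \<Rightarrow> 'a::comm_ring_1 poly"
  assumes "(\<Sum>r<q. monom 1 r * pcompose (p r) (monom 1 q)) = 0" "r < q"
  shows "p r = 0"
proof (rule poly_eqI)
  fix j
  have "coeff (monom 1 t * pcompose (p t) (monom 1 q)) (j * q + r)
      = (if t = r then coeff (p r) j else 0)" if t: "t < q" for t
  proof (cases "t \<le> r")
    case True
    hence "coeff (monom 1 t * pcompose (p t) (monom 1 q)) (j * q + r)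
        = coeff (pcompose (p t) (monom 1 q)) (j * q + (r - t))"
      by (simp add: coeff_monom_mult)
    also have "\<dots> = (if r - t = 0 then coeff (p t) j else 0)"
      using assms(2) by (intro coeff_pcompose_monom) auto
    finally show ?thesis using True by auto
  next
    case False
    show ?thesis
    proof (cases "t \<le> j * q + r")
      case True
      \<comment> \<open>Subtracting t > r borrows one q: the remaining residue q + r - t lies
        strictly between 0 and q, where a polynomial in x^q has no coefficient.\<close>
      hence "j > 0" using False by (cases j) auto
      hence e: "j * q + r - t = (j - 1) * q + (q + r - t)"
        using t by (cases j) auto
      have "coeff (monom 1 t * pcompose (p t) (monom 1 q)) (j * q + r)
        = coeff (pcompose (p t) (monom 1 q)) ((j - 1) * q + (q + r - t))"
        using True by (simp add: coeff_monom_mult e)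
      also have "\<dots> = (if q + r - t = 0 then coeff (p t) (j - 1) else 0)"
        using False t by (intro coeff_pcompose_monom) auto
      also have "\<dots> = 0" using t by simp
      finally show ?thesis using False by auto
    qed (use False in \<open>auto simp: coeff_monom_mult\<close>)
  qed
  hence "coeff (\<Sum>r<q. monom 1 r * pcompose (p r) (monom 1 q)) (j * q + r)
      = (\<Sum>t<q. if t = r then coeff (p r) j else 0)"
    unfolding coeff_sum by (intro sum.cong) auto
  thus "coeff (p r) j = coeff 0 j" using assms by simp
qed

text \<open>The numbers below r q encode the pairs (i, t) with t < q as i q + t.\<close>

lemma sum_div_mod:
  fixes f :: "nat \<Rightarrow> nat \<Rightarrow> 'a::comm_monoid_add"
  shows "(\<Sum>k<r * q. f (k div q) (k mod q)) = (\<Sum>i<r. \<Sum>t<q. f i t)"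
proof -
  have "(\<Sum>k<r * q. f (k div q) (k mod q)) = (\<Sum>i<r. \<Sum>k\<in>{i * q..<i * q + q}. f (k div q) (k mod q))"
    by (rule sum.nat_group[symmetric])
  also have "\<dots> = (\<Sum>i<r. \<Sum>t<q. f i t)"
  proof (rule sum.cong)
    fix i assume "i \<in> {..<r}"
    have "(\<Sum>k\<in>{i * q..<i * q + q}. f (k div q) (k mod q))
        = (\<Sum>t\<in>{0..<q}. f ((t + i * q) div q) ((t + i * q) mod q))"
      using sum.shift_bounds_nat_ivl[of "\<lambda>k. f (k div q) (k mod q)" 0 "i * q" q]
      by (simp add: add.commute)
    also have "\<dots> = (\<Sum>t<q. f i t)" by (intro sum.cong) auto
    finally show "(\<Sum>k\<in>{i * q..<i * q + q}. f (k div q) (k mod q)) = (\<Sum>t<q. f i t)" .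
  qed simp
  finally show ?thesis .
qed

context system_cases
begin

section \<open>Torsion for the C[D]-module structure\<close>

lemma pact_D_supp [simp]: "v \<in> supp n \<Longrightarrow> pact D p v \<in> supp n"
  unfolding pact_def by (intro supp_sum supp_sc D_pow_supp)

text \<open>Conjugation by f turns D into D + c. For f a power of x this is the shift of eigenvalues
  by integers.\<close>

lemma pact_D_eigenfunction:
  assumes f: "\<delta> f = rf_const c * f" and v: "v \<in> supp n"
  shows "pact D p (ks f v) = ks f (pact D (pcompose p [:c, 1:]) v)"
proof (induction p)
  case (pCons a p)
  let ?w = "pact D (pcompose p [:c, 1:]) v"
  have w: "?w \<in> supp n" using v by simp
  have "D (ks f ?w) = ks f (sc c ?w + D ?w)"
    by (simp add: D_ks[OF w] f ks_add sc_def ks_ks mult.commute)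
  moreover have "pact D (pcompose (pCons a p) [:c, 1:]) v = sc a v + (sc c ?w + D ?w)"
    by (simp add: pcompose_pCons pact_add Dl.pact_pCons pact_smult)
  ultimately show ?case
    using pCons by (simp add: Dl.pact_pCons ks_add ks_sc)
qed simp

text \<open>Each D that moves to the right past \<Phi> picks up a factor \<mu>.\<close>

lemma pact_D_Ph: "pact D p (Ph v) = Ph (pact D (pcompose p [:0, of_nat \<mu>:]) v)"
proof (induction p)
  case (pCons a p)
  let ?w = "pact D (pcompose p [:0, of_nat \<mu>:]) v"
  have "D (Ph ?w) = Ph (sc (of_nat \<mu>) (D ?w))"
    by (simp add: D_Ph Ph_sc D_sc) (simp add: sc_def rf_const_of_nat)
  moreover have "pact D (pcompose (pCons a p) [:0, of_nat \<mu>:]) v = sc a v + sc (of_nat \<mu>) (D ?w)"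
    by (simp add: pcompose_pCons pact_add Dl.pact_pCons pact_smult D_sc)
  ultimately show ?case
    using pCons by (simp add: Dl.pact_pCons Ph_add Ph_sc)
qed simp

text \<open>Torsion over C[D]: that \<open>LL\<close> has rank 0 means that all its elements satisfy
  this.\<close>

definition tors :: "(nat \<Rightarrow> 'c ratfun) \<Rightarrow> bool" where
  "tors v \<longleftrightarrow> (\<exists>p. p \<noteq> 0 \<and> pact D p v = 0)"

lemma tors_pact: "p \<noteq> 0 \<Longrightarrow> tors (pact D p v) \<Longrightarrow> tors v"
  unfolding tors_def by (metis Dl.pact_mult no_zero_divisors)

lemma tors_add:
  assumes "tors v" "tors w"
  shows "tors (v + w)"
proof -
  obtain p q where pq: "p \<noteq> 0" "pact D p v = 0" "q \<noteq> 0" "pact D q w = 0"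
    using assms unfolding tors_def by blast
  have "pact D (p * q) w = 0" using pq by (simp add: Dl.pact_mult)
  moreover have "pact D (p * q) v = 0"
    using pq by (simp add: Dl.pact_mult Dl.pact_commute[of p])
  ultimately show ?thesis unfolding tors_def using pq
    by (intro exI[of _ "p * q"]) (auto simp: Dl.pact_add_right)
qed

lemma tors_pactI: "tors v \<Longrightarrow> tors (pact D p v)"
  unfolding tors_def by (metis Dl.pact_commute Dl.pact_zero_right)

lemma tors_uminus: "tors v \<Longrightarrow> tors (- v)"
  using tors_pactI[of v "[:-1:]"] by (simp add: Dl.pact_const cv.scale_minus_left)

lemma tors_diff: "tors v \<Longrightarrow> tors w \<Longrightarrow> tors (v - w)"
  using tors_add[of v "- w"] tors_uminus[of w] by simp

lemma tors_eigenfunction: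
  assumes f: "\<delta> f = rf_const c * f" "f \<noteq> 0" and v: "v \<in> supp n" and t: "tors (ks f v)"
  shows "tors v"
proof -
  obtain p where p: "p \<noteq> 0" "pact D p (ks f v) = 0" using t unfolding tors_def by blast
  have "pact D (pcompose p [:c, 1:]) v = 0"
    using p f pact_D_eigenfunction[OF f(1) v, of p] by simp
  moreover have "pcompose p [:c, 1:] \<noteq> 0" using p by (simp add: pcompose_eq_0_iff)
  ultimately show ?thesis unfolding tors_def by blast
qed

lemma tors_Ph:
  assumes "v \<in> supp n" "tors (Ph v)"
  shows "tors v"
proof -
  obtain p where p: "p \<noteq> 0" "pact D p (Ph v) = 0" using assms unfolding tors_def by blast
  have "pact D (pcompose p [:0, of_nat \<mu>:]) v = 0"
    using p assms Ph_inj by (simp add: pact_D_Ph)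
  moreover have "pcompose p [:0, of_nat \<mu>:] \<noteq> 0" using p \<mu>_pos by (simp add: pcompose_eq_0_iff)
  ultimately show ?thesis unfolding tors_def by blast
qed

text \<open>Here r is the rank of \<open>LL\<close> over C[D]. Its maximality is what later turns
  larger families into relations.\<close>

lemma maximal_theta_indep:
  obtains m r where "\<forall>i<r. m i \<in> LL" "theta_indep m r"
    "\<And>m' r'. \<forall>i<r'. m' i \<in> LL \<Longrightarrow> theta_indep m' r' \<Longrightarrow> r' \<le> r"
proof -
  obtain r0 where r0: "\<And>m r. \<forall>i<r. m i \<in> LL \<Longrightarrow> theta_indep m r \<Longrightarrow> r \<le> r0"
    using theta_rank_bound by blast
  define Q where "Q = (\<lambda>r. \<exists>m. (\<forall>i<r. m i \<in> LL) \<and> theta_indep m r)"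
  have "Q 0" by (auto simp: Q_def theta_indep_def)
  moreover have "\<And>r. Q r \<Longrightarrow> r \<le> r0" using r0 by (auto simp: Q_def)
  ultimately obtain r where "Q r" "\<And>r'. Q r' \<Longrightarrow> r' \<le> r"
    using GreatestI_nat[of Q 0 r0] Greatest_le_nat[of Q _ r0] by blast
  thus ?thesis using that unfolding Q_def by blast
qed

lemma single_theta_indep: "\<not> tors v \<Longrightarrow> theta_indep (\<lambda>_. v) 1"
  by (auto simp: theta_indep_def tors_def)

text \<open>Applying B turns \<Phi> back into \<sigma> entrywise, and \<sigma> maps k onto C(x^q),
  over which 1, x, ..., x^(q-1) are independent.\<close>

lemma Ph_powers_of_X_independent:
  assumes \<sigma>X: "s = monom 1 q" and w: "\<And>t. t < q \<Longrightarrow> w t \<in> supp n"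
    and sum0: "(\<Sum>t<q. ks (rf_X ^ t) (Ph (w t))) = 0" and t: "t < q"
  shows "w t = 0"
proof
  fix i
  show "w t i = 0 i"
  proof (cases "i < n")
    case i: True
    have "(\<Sum>t<q. rf_X ^ t * \<sigma> (w t i)) = (\<Sum>j<n. b i j * (\<Sum>t<q. ks (rf_X ^ t) (Ph (w t))) j)"
      unfolding \<sigma>_via_Ph[OF i] sum_fun_app sum_distrib_left
      by (subst sum.swap) (simp add: ks_def ac_simps)
    hence z: "(\<Sum>t<q. rf_X ^ t * \<sigma> (w t i)) = 0" unfolding sum0 by (simp add: pointwise)
    have fin: "finite {..<q}" by simp
    obtain d where d: "d \<noteq> 0" "\<forall>t\<in>{..<q}. \<exists>p. to_fract d * w t i = to_fract p"
      using common_denominator[OF fin, of "\<lambda>t. w t i"] by metis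
    then obtain p where p: "\<And>t. t < q \<Longrightarrow> to_fract d * w t i = to_fract (p t)"
      by (metis lessThan_iff)
    have "to_fract (\<Sum>t<q. monom 1 t * pcompose (p t) s) = (\<Sum>t<q. rf_X ^ t * \<sigma> (to_fract (p t)))"
      using deg_s by (simp add: to_fract_sum to_fract_monom rf_const_1 \<sigma>_eq rf_subst_to_fract)
    also have "\<dots> = (\<Sum>t<q. rf_X ^ t * \<sigma> (to_fract d * w t i))"
      by (intro sum.cong) (auto simp: p)
    also have "\<dots> = \<sigma> (to_fract d) * (\<Sum>t<q. rf_X ^ t * \<sigma> (w t i))"
      by (simp add: \<sigma>_mult sum_distrib_left ac_simps)
    finally have "to_fract (\<Sum>t<q. monom 1 t * pcompose (p t) s) = to_fract 0"
      unfolding z by simp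
    hence "(\<Sum>t<q. monom 1 t * pcompose (p t) (monom 1 q)) = 0"
      unfolding to_fract_eq_iff using \<sigma>X by simp
    hence "p t = 0" using t by (rule monom_pcompose_independent)
    hence "to_fract d * w t i = 0" using p[OF t] by simp
    thus ?thesis using d by (simp add: pointwise)
  qed (use w[OF t] in \<open>auto simp: supp_def pointwise\<close>)
qed

text \<open>If \<open>m\<^sub>1, \<dots>, m\<^sub>r\<close> are independent over \<open>C[D]\<close>, so are the \<open>q r\<close> elements \<open>x\<^sup>t \<Phi>(m\<^sub>i)\<close>, \<open>t < q\<close>.\<close>
lemma torsion_case_M:
  assumes \<sigma>X: "s = monom 1 q" and q: "q \<ge> 2" and u: "u = [:0, 1:]" and v: "v \<in> LL"
  shows "tors v"
proof (rule ccontr)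
  assume "\<not> tors v"
  obtain m r where m: "\<And>i. i < r \<Longrightarrow> m i \<in> LL" "theta_indep m r"
    and max: "\<And>m' r'. \<forall>i<r'. m' i \<in> LL \<Longrightarrow> theta_indep m' r' \<Longrightarrow> r' \<le> r"
    using maximal_theta_indep by metis
  have "r \<ge> 1" using max[of 1 "\<lambda>_. v"] v single_theta_indep[OF \<open>\<not> tors v\<close>] by simp
  have XR: "rf_X ^ t \<in> R" for t
    unfolding rf_X_def to_fract_pow[symmetric] by (rule localised_polyI)
  have \<delta>X: "\<delta> (rf_X ^ t) = rf_const (of_nat t) * rf_X ^ t" for t
  proof (induction t)
    case 0
    have "\<delta> 1 = 0" using \<delta>_const[of 1] by (simp only: rf_const_1)
    thus ?case by (simp add: rf_const_0)
  next
    case (Suc t)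
    have "\<delta> rf_X = rf_X" unfolding \<delta>_eq rf_deriv_X by (simp add: u rf_X_def)
    hence "\<delta> (rf_X ^ Suc t) = rf_X * rf_X ^ t + rf_X * (rf_const (of_nat t) * rf_X ^ t)"
      by (simp add: \<delta>_mult Suc)
    thus ?case by (simp add: rf_const_of_nat rf_const_add rf_const_1 algebra_simps)
  qed
  define m' where "m' = (\<lambda>k. ks (rf_X ^ (k mod q)) (Ph (m (k div q))))"
  have "theta_indep m' (r * q)"
    unfolding theta_indep_def
  proof (intro allI impI)
    fix P k assume P: "(\<Sum>i<r * q. pact D (P i) (m' i)) = 0" and k: "k < r * q"
    \<comment> \<open>Moving \<open>P (i * q + t)\<close> to the right past x^t replaces D by D + t;
      moving it past \<Phi> then replaces D by \<mu> D.\<close>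
    define S where "S = (\<lambda>i t. pcompose (pcompose (P (i * q + t)) [:of_nat t, 1:]) [:0, of_nat \<mu>:])"
    define w where "w = (\<lambda>t. \<Sum>i<r. pact D (S i t) (m i))"
    have "(\<Sum>i<r * q. pact D (P i) (m' i))
        = (\<Sum>k<r * q. (\<lambda>i t. pact D (P (i * q + t)) (ks (rf_X ^ t) (Ph (m i)))) (k div q) (k mod q))"
      by (simp add: m'_def)
    also have "\<dots> = (\<Sum>i<r. \<Sum>t<q. pact D (P (i * q + t)) (ks (rf_X ^ t) (Ph (m i))))"
      by (rule sum_div_mod)
    also have "\<dots> = (\<Sum>i<r. \<Sum>t<q. ks (rf_X ^ t) (Ph (pact D (S i t) (m i))))"
      by (simp add: pact_D_eigenfunction[OF \<delta>X] pact_D_Ph S_def)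
    also have "\<dots> = (\<Sum>t<q. ks (rf_X ^ t) (Ph (w t)))"
      by (subst sum.swap) (simp add: w_def Phl.T_sum ks_sum)
    finally have "(\<Sum>t<q. ks (rf_X ^ t) (Ph (w t))) = 0" using P by simp
    moreover have "w t \<in> supp n" for t
      unfolding w_def using m LL_supp by (intro supp_sum pact_D_supp) auto
    moreover have "k mod q < q" using q by simp
    ultimately have "w (k mod q) = 0" using Ph_powers_of_X_independent[OF \<sigma>X, of w] by blast
    hence "(\<Sum>i<r. pact D (S i (k mod q)) (m i)) = 0" by (simp only: w_def)
    moreover have "k div q < r" using k by (simp add: less_mult_imp_div_less)
    ultimately have "S (k div q) (k mod q) = 0" using m(2)[unfolded theta_indep_def, rule_format, of "\<lambda>i. S i (k mod q)"] by blast
    thus "P k = 0" using \<mu>_pos by (simp add: S_def pcompose_eq_0_iff)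
  qed
  moreover have "\<forall>i<r * q. m' i \<in> LL"
    unfolding m'_def using m by (auto intro!: LL_ks XR LL_Ph simp: less_mult_imp_div_less)
  ultimately have "r * q \<le> r" by (intro max)
  thus False using q \<open>r \<ge> 1\<close> by (cases q) auto
qed

section \<open>Polynomials P(D, \<Phi>) acting on vectors; rank 0 in cases Q and S\<close>

definition act2 :: "'c poly poly \<Rightarrow> (nat \<Rightarrow> 'c ratfun) \<Rightarrow> nat \<Rightarrow> 'c ratfun" where
  "act2 P v = (\<Sum>i\<le>degree P. pact D (coeff P i) ((Ph ^^ i) v))"

lemma act2_alt: "degree P \<le> N \<Longrightarrow> act2 P v = (\<Sum>i\<le>N. pact D (coeff P i) ((Ph ^^ i) v))"
  unfolding act2_def by (rule sum.mono_neutral_left) (auto simp: coeff_eq_0)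

lemma act2_0 [simp]: "act2 0 v = 0"
  by (simp add: act2_def)

lemma act2_add: "act2 (P + Q) v = act2 P v + act2 Q v"
proof -
  define N where "N = max (degree P) (degree Q)"
  have N: "degree P \<le> N" "degree Q \<le> N" "degree (P + Q) \<le> N"
    unfolding N_def by (auto intro: degree_add_le)
  show ?thesis unfolding N[THEN act2_alt] by (simp add: pact_add sum.distrib)
qed

lemma act2_smult: "act2 (Polynomial.smult p P) v = pact D p (act2 P v)"
proof -
  interpret pp: c_linear "pact D p" by (rule Dl.pact_linear)
  have N: "degree P \<le> degree P" "degree (Polynomial.smult p P) \<le> degree P"
    by (auto simp: degree_smult_le)
  show ?thesis unfolding N[THEN act2_alt] by (simp add: Dl.pact_mult pp.T_sum)
qed

lemma act2_diff: "act2 (P - Q) v = act2 P v - act2 Q v"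
  using act2_add[of P "- Q" v] act2_smult[of "-1" Q v] by (simp add: pact_uminus)

lemma act2_add_right: "act2 P (v + w) = act2 P v + act2 P w"
  by (simp add: act2_def Phl.T_pow_add Dl.pact_add_right sum.distrib)

lemma act2_sum_right: "act2 P (sum f S) = (\<Sum>i\<in>S. act2 P (f i))"
proof -
  have "act2 P 0 = 0" using act2_add_right[of P 0 0] by simp
  thus ?thesis by (induction S rule: infinite_finite_induct) (auto simp: act2_add_right)
qed

lemma act2_pCons: "act2 (pCons p P) v = pact D p v + act2 P (Ph v)"
proof -
  have "act2 (pCons p P) v = (\<Sum>i\<le>Suc (degree P). pact D (coeff (pCons p P) i) ((Ph ^^ i) v))"
    by (rule act2_alt) (simp add: degree_pCons_le)
  also have "\<dots> = pact D p v + act2 P (Ph v)"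
    by (subst sum.atMost_Suc_shift) (simp add: act2_def funpow_swap1)
  finally show ?thesis .
qed

lemma act2_monom_sum:
  "act2 (\<Sum>i\<le>N. monom (c i) i) v = (\<Sum>i\<le>N. pact D (c i) ((Ph ^^ i) v))"
proof -
  have d: "degree (\<Sum>i\<le>N. monom (c i) i) \<le> N"
    by (intro degree_sum_le) (auto intro: order_trans[OF degree_monom_le])
  show ?thesis unfolding act2_alt[OF d] by (intro sum.cong) (auto simp: coeff_sum)
qed

lemma act2_supp [simp]: "v \<in> supp n \<Longrightarrow> act2 P v \<in> supp n"
  unfolding act2_def by (intro supp_sum pact_D_supp Ph_pow_supp)

lemma LL_Ph_pow: "v \<in> LL \<Longrightarrow> (Ph ^^ i) v \<in> LL"
  by (induction i) (auto intro: LL_Ph)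

text \<open>P annihilates \<open>LL\<close> modulo torsion, that is, after extension of scalars to
  C(D).\<close>

definition kills :: "'c poly poly \<Rightarrow> bool" where
  "kills P \<longleftrightarrow> (\<forall>v\<in>LL. tors (act2 P v))"

context
  assumes \<mu>1: "\<mu> = 1"
begin

lemma pact_D_Ph1: "pact D p (Ph v) = Ph (pact D p v)"
proof -
  have "pcompose p [:0, 1:] = p" by (rule pcompose_idR)
  thus ?thesis using pact_D_Ph[of p v] \<mu>1 by simp
qed

lemma act2_Ph: "act2 P (Ph v) = Ph (act2 P v)"
  by (simp add: act2_def Phl.T_sum funpow_swap1 flip: pact_D_Ph1)

lemma act2_pact: "act2 P (pact D p v) = pact D p (act2 P v)"
proof -
  interpret pp: c_linear "pact D p" by (rule Dl.pact_linear)
  have "(Ph ^^ i) (pact D p v) = pact D p ((Ph ^^ i) v)" for i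
    by (induction i) (auto simp: pact_D_Ph1)
  thus ?thesis by (simp add: act2_def pp.T_sum Dl.pact_commute[of _ p])
qed

lemma act2_mult: "act2 (P * Q) v = act2 P (act2 Q v)"
  by (induction P arbitrary: v) (simp_all add: act2_add act2_smult act2_pCons act2_Ph)

text \<open>For v in \<open>LL\<close> the r + 1 vectors v, ..., \<Phi>^r v exceed the rank, so a
  nonzero polynomial annihilates v. The product of such polynomials over a maximal independent
  family annihilates that family, and every v has a nonzero C[D]-multiple in its span.\<close>

lemma kills_exists: "\<exists>P. P \<noteq> 0 \<and> kills P"
proof -
  obtain m r where m: "\<And>i. i < r \<Longrightarrow> m i \<in> LL" "theta_indep m r"
    and max: "\<And>m' r'. \<forall>i<r'. m' i \<in> LL \<Longrightarrow> theta_indep m' r' \<Longrightarrow> r' \<le> r"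
    using maximal_theta_indep by metis
  have single: "\<exists>P. P \<noteq> 0 \<and> act2 P v = 0" if v: "v \<in> LL" for v
  proof -
    have "\<not> theta_indep (\<lambda>i. (Ph ^^ i) v) (Suc r)"
      using max[of "Suc r" "\<lambda>i. (Ph ^^ i) v"] LL_Ph_pow[OF v] by auto
    then obtain P where P: "(\<Sum>i<Suc r. pact D (P i) ((Ph ^^ i) v)) = 0" "\<exists>i<Suc r. P i \<noteq> 0"
      unfolding theta_indep_def by blast
    define Q where "Q = (\<Sum>i\<le>r. monom (P i) i)"
    have "act2 Q v = 0" unfolding Q_def act2_monom_sum using P(1) by (simp add: lessThan_Suc_atMost)
    moreover have "coeff Q i = P i" if "i \<le> r" for i using that by (simp add: Q_def coeff_sum)
    hence "Q \<noteq> 0" using P(2) by (metis coeff_0 less_Suc_eq_le)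
    ultimately show ?thesis by blast
  qed
  have "\<exists>P. P \<noteq> 0 \<and> (\<forall>i<k. act2 P (m i) = 0)" if "k \<le> r" for k
    using that
  proof (induction k)
    case 0
    show ?case by (rule exI[of _ 1]) auto
  next
    case (Suc k)
    then obtain P where P: "P \<noteq> 0" "\<forall>i<k. act2 P (m i) = 0" by auto
    obtain Q where Q: "Q \<noteq> 0" "act2 Q (m k) = 0" using single m Suc by (metis Suc_le_eq)
    have z: "act2 W 0 = 0" for W using act2_add_right[of W 0 0] by simp
    have "act2 (Q * P) (m i) = 0" if "i < Suc k" for i
    proof (cases "i < k")
      case True
      thus ?thesis using P by (simp add: act2_mult z)
    next
      case False
      hence "i = k" using that by simp
      thus ?thesis using Q by (subst mult.commute) (simp add: act2_mult z)
    qed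
    thus ?case using P Q by (intro exI[of _ "Q * P"]) auto
  qed
  then obtain P where P: "P \<noteq> 0" "\<And>i. i < r \<Longrightarrow> act2 P (m i) = 0" by blast
  have "tors (act2 P v)" if v: "v \<in> LL" for v
  proof -
    define m' where "m' = (\<lambda>i. if i < r then m i else v)"
    have "\<forall>i<Suc r. m' i \<in> LL" using m v by (auto simp: m'_def)
    hence "\<not> theta_indep m' (Suc r)" using max[of "Suc r" m'] by auto
    then obtain S where S: "(\<Sum>i<Suc r. pact D (S i) (m' i)) = 0" "\<exists>i<Suc r. S i \<noteq> 0"
      unfolding theta_indep_def by blast
    have e: "(\<Sum>i<r. pact D (S i) (m i)) + pact D (S r) v = 0"
      using S(1) by (simp add: m'_def)
    \<comment> \<open>Otherwise the relation would involve the independent m_i alone.\<close>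
    have "S r \<noteq> 0"
    proof
      assume "S r = 0"
      hence "\<forall>i<r. S i = 0" using e m(2) by (simp add: theta_indep_def)
      thus False using S(2) \<open>S r = 0\<close> by (auto simp: less_Suc_eq)
    qed
    have "act2 P 0 = 0" using act2_add_right[of P 0 0] by simp
    hence "act2 P (\<Sum>i<r. pact D (S i) (m i)) + act2 P (pact D (S r) v) = 0"
      using e by (simp flip: act2_add_right)
    hence "pact D (S r) (act2 P v) = 0"
      using P(2) by (simp add: act2_sum_right act2_pact)
    thus ?thesis using \<open>S r \<noteq> 0\<close> unfolding tors_def by blast
  qed
  thus ?thesis using P(1) unfolding kills_def by blast
qed

text \<open>A nonzero \<open>P\<close> of least \<open>T\<close>-degree killing \<open>LL\<close> generates the annihilator over \<open>C(D)\<close>, so the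
  commutator of \<open>P\<close> with \<open>x\<close>, encoded by \<open>\<kappa>\<close>, is a multiple of it.\<close>
lemma torsion_from_commutator:
  assumes \<kappa>: "\<And>P. kills P \<Longrightarrow> kills (\<Sum>i\<le>degree P. monom (\<kappa> i (coeff P i)) i)"
    and contra: "\<And>d p p0. d > 0 \<Longrightarrow> p \<noteq> 0 \<Longrightarrow> p0 \<noteq> 0 \<Longrightarrow> p * \<kappa> 0 p0 \<noteq> \<kappa> d p * p0"
    and v: "v \<in> LL"
  shows "tors v"
proof -
  define Q where "Q = (\<lambda>P. P \<noteq> 0 \<and> kills P)"
  have "\<exists>P. Q P" using kills_exists by (auto simp: Q_def)
  then obtain P where P: "Q P" and least: "\<And>P'. Q P' \<Longrightarrow> degree P \<le> degree P'"
    using ex_has_least_nat[of Q _ degree] by blast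
  define d where "d = degree P"
  have P': "P \<noteq> 0" "kills P" using P by (auto simp: Q_def)
  show ?thesis
  proof (cases "d = 0")
    case True
    then obtain p where p: "P = [:p:]" using degree_eq_zeroE d_def by metis
    hence "p \<noteq> 0" using P' by auto
    moreover have "tors (pact D p v)" using P'(2) v p by (auto simp: kills_def act2_def)
    ultimately show ?thesis by (rule tors_pact)
  next
    case False
    \<comment> \<open>If P were divisible by its variable, the quotient would kill \<open>LL\<close>
      as well, because \<Phi> reflects torsion (\<open>tors_Ph\<close>); its smaller degree
      contradicts the choice of P.\<close>
    have c0: "coeff P 0 \<noteq> 0"
    proof
      assume z: "coeff P 0 = 0"
      obtain p P1 where P1: "P = pCons p P1" by (cases P)
      hence "p = 0" using z by simp
      have "P1 \<noteq> 0" using P1 P' \<open>p = 0\<close> by auto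
      moreover have "tors (act2 P1 v)" if "v \<in> LL" for v
      proof -
        have "tors (act2 P v)" using P'(2) that by (simp add: kills_def)
        hence "tors (Ph (act2 P1 v))" using P1 \<open>p = 0\<close> by (simp add: act2_pCons act2_Ph)
        thus ?thesis using that LL_supp by (intro tors_Ph[of "act2 P1 v"]) auto
      qed
      ultimately have "degree P \<le> degree P1" by (intro least) (auto simp: Q_def kills_def)
      thus False using P1 \<open>P1 \<noteq> 0\<close> by (simp add: degree_pCons_eq)
    qed
    define H where "H = (\<Sum>i\<le>d. monom (\<kappa> i (coeff P i)) i)"
    have H: "kills H" unfolding H_def d_def by (rule \<kappa>[OF P'(2)])
    define lc where "lc = coeff P d"
    \<comment> \<open>W is the combination of H and P in which the coefficients of degree d cancel.
      Least degree forces W = 0, and its constant coefficient gives the identity that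
      \<open>contra\<close> excludes.\<close>
    define W where "W = Polynomial.smult lc H - Polynomial.smult (\<kappa> d lc) P"
    have cH: "coeff H i = \<kappa> i (coeff P i)" if "i \<le> d" for i
      using that by (simp add: H_def coeff_sum)
    have "kills W" using H P'(2)
      by (auto simp: kills_def W_def act2_diff act2_smult intro!: tors_diff tors_pactI)
    have dW: "degree W \<le> d"
    proof -
      have "degree H \<le> d" unfolding H_def
        by (intro degree_sum_le) (auto intro: order_trans[OF degree_monom_le])
      thus ?thesis unfolding W_def d_def
        by (intro degree_diff_le order_trans[OF degree_smult_le]) auto
    qed
    have "coeff W d = 0" by (simp add: W_def cH lc_def mult.commute)
    have "W = 0"
    proof (rule ccontr)
      assume "W \<noteq> 0"
      hence "d \<le> degree W" using least[of W] \<open>kills W\<close> by (simp add: Q_def d_def)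
      hence "degree W = d" using dW by simp
      thus False using \<open>coeff W d = 0\<close> \<open>W \<noteq> 0\<close> by (metis leading_coeff_0_iff)
    qed
    hence "coeff W 0 = 0" by simp
    hence "lc * \<kappa> 0 (coeff P 0) = \<kappa> d lc * coeff P 0" by (simp add: W_def cH)
    moreover have "lc \<noteq> 0" using P' by (simp add: lc_def d_def)
    ultimately show ?thesis using contra[of d lc "coeff P 0"] c0 False by blast
  qed
qed

text \<open>From D x = x (D + 1) and \<Phi> x = q x \<Phi> follows P(D, \<Phi>) x = x H(D, \<Phi>),
  where the i-th coefficient p of P becomes q^i p(D + 1) in H. The shift keeps leading coefficients,
  so equality in the commutator identity would give q^d = 1.\<close>

lemma torsion_case_Q:
  assumes \<sigma>X: "s = [:0, q:]" and u: "u = [:0, 1:]" and q: "\<And>m::nat. m > 0 \<Longrightarrow> q ^ m \<noteq> 1"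
    and v: "v \<in> LL"
  shows "tors v"
proof (rule torsion_from_commutator[OF _ _ v])
  have \<delta>X: "\<delta> rf_X = rf_const 1 * rf_X" unfolding \<delta>_eq rf_deriv_X by (simp add: u rf_X_def rf_const_1)
  have \<sigma>rX: "\<sigma> rf_X = rf_const q * rf_X"
  proof -
    have "\<sigma> rf_X = to_fract [:0, q:]" using deg_s \<sigma>X by (simp add: \<sigma>_eq rf_subst_X)
    thus ?thesis by (simp add: rf_const_def rf_X_def flip: to_fract_mult)
  qed
  have PhX: "(Ph ^^ i) (ks rf_X w) = sc (q ^ i) (ks rf_X ((Ph ^^ i) w))" for i w
  proof (induction i)
    case (Suc i)
    have "(Ph ^^ Suc i) (ks rf_X w) = sc (q ^ i) (ks (rf_const q * rf_X) ((Ph ^^ Suc i) w))"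
      by (simp add: Suc Ph_sc Ph_ks \<sigma>rX)
    thus ?case by (simp add: sc_def ks_ks rf_const_mult ac_simps)
  qed simp
  define \<kappa> where "\<kappa> = (\<lambda>i p. Polynomial.smult (q ^ i) (pcompose p [:1, 1:]))"
  {
    fix P assume P: "kills P"
    let ?H = "\<Sum>i\<le>degree P. monom (\<kappa> i (coeff P i)) i"
    show "kills ?H" unfolding kills_def
    proof
      fix w assume w: "w \<in> LL"
      have ws: "(Ph ^^ i) w \<in> supp n" for i using LL_supp[OF w] by simp
      have "ks rf_X w \<in> LL" using w by (intro LL_ks) (auto simp: rf_X_def)
      hence "tors (act2 P (ks rf_X w))" using P by (simp add: kills_def)
      also have "act2 P (ks rf_X w) = ks rf_X (act2 ?H w)"
      proof -
        have "act2 P (ks rf_X w)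
            = (\<Sum>i\<le>degree P. sc (q ^ i) (pact D (coeff P i) (ks rf_X ((Ph ^^ i) w))))"
          by (simp add: act2_def PhX Dl.pact_sc_right)
        also have "\<dots> = (\<Sum>i\<le>degree P. ks rf_X (pact D (\<kappa> i (coeff P i)) ((Ph ^^ i) w)))"
          by (simp add: pact_D_eigenfunction[OF \<delta>X ws] \<kappa>_def pact_smult ks_sc)
        also have "\<dots> = ks rf_X (act2 ?H w)" by (simp add: act2_monom_sum ks_sum)
        finally show ?thesis .
      qed
      finally have "tors (ks rf_X (act2 ?H w))" .
      thus "tors (act2 ?H w)"
        by (rule tors_eigenfunction[OF \<delta>X, rotated 2]) (use LL_supp[OF w] in \<open>auto simp: rf_X_def\<close>)
    qed
  }
  fix d :: nat and p p0 :: "'c poly" assume dp: "d > 0" "p \<noteq> 0" "p0 \<noteq> 0"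
  have lc: "lead_coeff (pcompose r [:1, 1:]) = lead_coeff r" for r :: "'c poly"
    by (subst lead_coeff_comp) auto
  show "p * \<kappa> 0 p0 \<noteq> \<kappa> d p * p0"
  proof
    assume "p * \<kappa> 0 p0 = \<kappa> d p * p0"
    hence "p * pcompose p0 [:1, 1:] = Polynomial.smult (q ^ d) (pcompose p [:1, 1:] * p0)"
      by (simp add: \<kappa>_def)
    from arg_cong[OF this, of lead_coeff]
    have "lead_coeff p * lead_coeff p0 = q ^ d * (lead_coeff p * lead_coeff p0)"
      by (simp only: lead_coeff_mult lead_coeff_smult lc)
    hence "q ^ d = 1" using dp by simp
    thus False using q[OF dp(1)] by simp
  qed
qed

text \<open>From D x = x D + 1 and \<Phi>^i x = (x + i) \<Phi>^i the commutator P x - x P has the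
  coefficients p' + i p. For d > 0 the polynomial p' + d p keeps the degree of p, whereas p0' has
  smaller degree than p0, so the commutator identity fails.\<close>

lemma torsion_case_S:
  assumes \<sigma>X: "s = [:1, 1:]" and u: "u = 1" and v: "v \<in> LL"
  shows "tors v"
proof (rule torsion_from_commutator[OF _ _ v])
  have \<delta>X: "\<delta> rf_X = 1" by (simp add: \<delta>_eq rf_deriv_X u)
  have \<sigma>rX: "\<sigma> rf_X = rf_X + 1"
  proof -
    have "\<sigma> rf_X = to_fract [:1, 1:]" using deg_s \<sigma>X by (simp add: \<sigma>_eq rf_subst_X)
    also have "[:1, 1:] = [:0, 1:] + (1 :: 'c poly)" by (simp add: one_pCons)
    finally show ?thesis by (simp add: rf_X_def)
  qed
  have ksX1: "ks (rf_X + 1) w = ks rf_X w + w" for w :: "nat \<Rightarrow> 'c ratfun"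
    by (simp add: kv.scale_left_distrib)
  have PhX: "(Ph ^^ i) (ks rf_X w) = ks rf_X ((Ph ^^ i) w) + sc (of_nat i) ((Ph ^^ i) w)" for i w
    by (induction i) (simp_all add: Ph_add Ph_sc Ph_ks \<sigma>rX ksX1 cv.scale_left_distrib add.assoc)
  have DX: "pact D p (ks rf_X w) = ks rf_X (pact D p w) + pact D (pderiv p) w" if w: "w \<in> supp n" for p w
  proof (induction p)
    case (pCons a p)
    have pw: "pact D p w \<in> supp n" using w by simp
    have "D (ks rf_X (pact D p w)) = pact D p w + ks rf_X (D (pact D p w))"
      by (simp add: D_ks[OF pw] \<delta>X)
    thus ?case using pCons
      by (simp add: Dl.pact_pCons pderiv_pCons pact_add D_add ks_add ks_sc ac_simps)
  qed simp
  define \<kappa> where "\<kappa> = (\<lambda>i p. pderiv p + of_nat i * (p :: 'c poly))"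
  \<comment> \<open>The square p^2 is used because p divides both p^2 and its derivative, the two
    polynomials that \<open>DX\<close> applies to w.\<close>
  have torsX: "tors (ks rf_X w)" if t: "tors w" and ws: "w \<in> supp n" for w
  proof -
    obtain p where p: "p \<noteq> 0" "pact D p w = 0" using t unfolding tors_def by blast
    have e: "pderiv (p * p) = (2 * pderiv p) * p" by (simp add: pderiv_mult)
    have "pact D (p * p) w = 0" "pact D (pderiv (p * p)) w = 0"
      unfolding e Dl.pact_mult p(2) by simp_all
    hence "pact D (p * p) (ks rf_X w) = 0" by (simp only: DX[OF ws] ks_0 add_0_left)
    moreover have "p * p \<noteq> 0" using p by simp
    ultimately show ?thesis unfolding tors_def by blast
  qed
  {
    fix P assume P: "kills P"
    let ?H = "\<Sum>i\<le>degree P. monom (\<kappa> i (coeff P i)) i"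
    show "kills ?H" unfolding kills_def
    proof
      fix w assume w: "w \<in> LL"
      have ws: "(Ph ^^ i) w \<in> supp n" for i using LL_supp[OF w] by simp
      have on: "pact D (of_nat i * p) y = sc (of_nat i) (pact D p y)" for i p y
        by (simp add: of_nat_poly pact_smult)
      have "ks rf_X w \<in> LL" using w by (intro LL_ks) (auto simp: rf_X_def)
      hence 1: "tors (act2 P (ks rf_X w))" using P by (simp add: kills_def)
      have 2: "tors (ks rf_X (act2 P w))"
        using P w LL_supp[OF w] by (intro torsX) (auto simp: kills_def)
      have "act2 P (ks rf_X w) = ks rf_X (act2 P w) + act2 ?H w"
        unfolding act2_monom_sum
        by (simp add: act2_def PhX Dl.pact_add_right Dl.pact_sc_right DX[OF ws] \<kappa>_def pact_add on
            sum.distrib ks_sum add.assoc)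
      hence "act2 ?H w = act2 P (ks rf_X w) - ks rf_X (act2 P w)" by simp
      thus "tors (act2 ?H w)" using tors_diff[OF 1 2] by simp
    qed
  }
  fix d :: nat and p p0 :: "'c poly" assume dp: "d > 0" "p \<noteq> 0" "p0 \<noteq> 0"
  show "p * \<kappa> 0 p0 \<noteq> \<kappa> d p * p0"
  proof
    assume e: "p * \<kappa> 0 p0 = \<kappa> d p * p0"
    have k: "coeff (\<kappa> d p) (degree p) = of_nat d * lead_coeff p"
      by (simp add: \<kappa>_def coeff_pderiv coeff_eq_0 of_nat_poly)
    have "degree (\<kappa> d p) \<le> degree p" unfolding \<kappa>_def of_nat_poly
      by (intro degree_add_le) (auto simp: degree_pderiv)
    moreover have "degree (\<kappa> d p) \<ge> degree p"
      by (rule le_degree) (use k dp in simp)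
    ultimately have dk: "degree (\<kappa> d p) = degree p" by simp
    have "\<kappa> d p \<noteq> 0" using k dp by auto
    hence "\<kappa> d p * p0 \<noteq> 0" using dp by simp
    hence "pderiv p0 \<noteq> 0" using e by (auto simp: \<kappa>_def)
    hence "degree (pderiv p0) < degree p0" by (auto simp: degree_pderiv pderiv_eq_0_iff)
    moreover have "degree p + degree (pderiv p0) = degree p + degree p0"
      using arg_cong[OF e, of degree] dk \<open>\<kappa> d p \<noteq> 0\<close> dp \<open>pderiv p0 \<noteq> 0\<close>
      by (simp add: degree_mult_eq \<kappa>_def)
    ultimately show False by simp
  qed
qed

end

end

section \<open>Generalised eigenvectors\<close>

lemma coeff_mult_le_degrees:
  fixes p q :: "'a::comm_semiring_0 poly"
  assumes "degree p \<le> m" "degree q \<le> k"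
  shows "coeff (p * q) (m + k) = coeff p m * coeff q k"
proof -
  have "coeff (p * q) (m + k) = (\<Sum>i\<le>m + k. if i = m then coeff p m * coeff q k else 0)"
    unfolding coeff_mult
  proof (rule sum.cong)
    fix i assume "i \<in> {..m + k}"
    show "coeff p i * coeff q (m + k - i) = (if i = m then coeff p m * coeff q k else 0)"
    proof (cases "i = m")
      case False
      hence "degree p < i \<or> degree q < m + k - i" using assms by auto
      thus ?thesis using False by (auto simp: coeff_eq_0)
    qed simp
  qed simp
  thus ?thesis by simp
qed

text \<open>The identity for exponent 1 comes from p being congruent to p(z) modulo x - z;
  multiplying it with the identity for e gives the one for e + 1.\<close>

lemma bezout_linear_power:
  fixes p :: "'a::field poly"
  assumes "poly p z \<noteq> 0"
  shows "\<exists>r t. r * p + t * [:-z, 1:] ^ e = 1"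
proof -
  define c where "c = poly p z"
  have "[:-z, 1:] dvd p - [:c:]" by (simp add: c_def dvd_iff_poly_eq_0)
  then obtain w where w: "p - [:c:] = [:-z, 1:] * w" by (elim dvdE)
  have one: "[:1 / c:] * p + (- ([:1 / c:] * w)) * [:-z, 1:] = 1"
  proof -
    have "[:1 / c:] * p + (- ([:1 / c:] * w)) * [:-z, 1:] = [:1 / c:] * (p - [:-z, 1:] * w)"
      by (simp add: algebra_simps del: mult_pCons_left mult_pCons_right)
    also have "\<dots> = [:1 / c:] * [:c:]" unfolding w[symmetric] by simp
    also have "\<dots> = 1" using assms by (simp add: c_def one_pCons)
    finally show ?thesis .
  qed
  show ?thesis
  proof (induction e)
    case 0
    show ?case by (rule exI[of _ 0], rule exI[of _ 1]) simp
  next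
    case (Suc e)
    then obtain r t where rt: "r * p + t * [:-z, 1:] ^ e = 1" by blast
    define al where "al = [:1 / c:]"
    define be where "be = - ([:1 / c:] * w)"
    have one: "al * p + be * [:-z, 1:] = 1" unfolding al_def be_def by (rule one)
    have "1 = (r * p + t * [:-z, 1:] ^ e) * (al * p + be * [:-z, 1:])" unfolding rt one by simp
    also have "\<dots> = (r * (al * p + be * [:-z, 1:]) + t * [:-z, 1:] ^ e * al) * p
        + (t * be) * [:-z, 1:] ^ Suc e"
      by (simp only: algebra_simps power_Suc)
    finally show ?case by metis
  qed
qed

context system_cases
begin

section \<open>Rational solutions of the scalar equations \<delta> f = c f and \<delta> f =
  c\<close>

lemma \<delta>_eq_zero: "\<delta> f = 0 \<Longrightarrow> \<exists>c. f = rf_const c"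
  using rf_deriv_eq_0_iff[of f] u_nz by (auto simp: \<delta>_eq)

lemma coeff_u_pderiv:
  "coeff (u * pderiv p) (degree p) = (if u = 1 then 0 else of_nat (degree p) * lead_coeff p)"
proof (cases "u = 1")
  case True
  thus ?thesis by (simp add: coeff_pderiv coeff_eq_0)
next
  case False
  hence "u = [:0, 1:]" using u_cases by blast
  thus ?thesis using False by (cases "degree p") (auto simp: coeff_pderiv)
qed

text \<open>Behaviour at infinity of \<delta>(p/q): x d/dx multiplies the leading term by degree p -
  degree q, whereas d/dx lowers the degree.\<close>

lemma coeff_\<delta>_numerator:
  "coeff (u * pderiv p * q - p * (u * pderiv q)) (degree p + degree q)
    = (if u = 1 then 0 else (of_nat (degree p) - of_nat (degree q)) * (lead_coeff p * lead_coeff q))"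
  unfolding coeff_diff coeff_mult_le_degrees[OF degree_u_pderiv order_refl]
    coeff_mult_le_degrees[OF order_refl degree_u_pderiv] coeff_u_pderiv
  by (simp add: algebra_simps)

text \<open>Comparing leading coefficients at infinity gives c = degree p - degree q if u = x, and c
  = 0 if u = 1.\<close>

lemma \<delta>_exponential:
  assumes "\<delta> f = rf_const c * f" "f \<noteq> 0"
  shows "c = 0 \<or> u = [:0, 1:] \<and> c \<in> \<int>"
proof -
  obtain p q where f: "q \<noteq> 0" "f = to_fract p / to_fract q" using to_fract_div by blast
  have p: "p \<noteq> 0" using assms f by auto
  have "to_fract (u * pderiv p * q - p * (u * pderiv q)) / to_fract (q * q)
      = rf_const c * (to_fract p / to_fract q)"
    using assms(1) unfolding f(2) \<delta>_div[OF f(1)] .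
  also have "\<dots> = to_fract ([:c:] * p * q) / to_fract (q * q)"
    using f(1) by (simp add: rf_const_def del: mult_pCons_left)
  finally have "to_fract (u * pderiv p * q - p * (u * pderiv q)) = to_fract ([:c:] * p * q)"
    using f(1) by (simp del: to_fract_diff)
  hence e: "u * pderiv p * q - p * (u * pderiv q) = [:c:] * p * q"
    by (simp only: to_fract_eq_iff)
  have "coeff ([:c:] * p * q) (degree p + degree q) = c * (lead_coeff p * lead_coeff q)"
    by (simp add: coeff_mult_le_degrees)
  hence "(if u = 1 then 0 else (of_nat (degree p) - of_nat (degree q)) * (lead_coeff p * lead_coeff q))
      = c * (lead_coeff p * lead_coeff q)"
    unfolding e[symmetric] coeff_\<delta>_numerator .
  hence "c = (if u = 1 then 0 else of_nat (degree p) - of_nat (degree q))"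
    using p f by (auto split: if_splits)
  thus ?thesis using u_cases by auto
qed

text \<open>There is no rational logarithm. For f = p/q the numerator of \<delta>(f) would be c q^2,
  and a nonzero c forces degree q <= degree p. If the degrees agree, the top coefficient of the
  numerator vanishes but that of c q^2 does not; if degree p is larger, it is the other way
  round.\<close>

lemma \<delta>_const_antiderivative:
  assumes u: "u = [:0, 1:]" and f: "\<delta> f = rf_const c"
  shows "\<exists>d. f = rf_const d"
proof (cases "f = 0 \<or> c = 0")
  case True
  thus ?thesis using f \<delta>_eq_zero[of f] rf_const_0 by metis
next
  case False
  obtain p q where pq: "q \<noteq> 0" "f = to_fract p / to_fract q" using to_fract_div by blast
  have p: "p \<noteq> 0" using False pq by auto
  have "to_fract (u * pderiv p * q - p * (u * pderiv q)) / to_fract (q * q)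
      = rf_const c"
    using f unfolding pq(2) \<delta>_div[OF pq(1)] .
  also have "\<dots> = to_fract ([:c:] * q * q) / to_fract (q * q)"
    using pq(1) by (simp add: rf_const_def del: mult_pCons_left)
  finally have "to_fract (u * pderiv p * q - p * (u * pderiv q)) = to_fract ([:c:] * q * q)"
    using pq(1) by (simp del: to_fract_diff)
  hence e: "u * pderiv p * q - p * (u * pderiv q) = [:c:] * q * q"
    by (simp only: to_fract_eq_iff)
  have "degree ([:c:] * q * q) = 2 * degree q" using False pq by (simp add: degree_mult_eq)
  moreover have "degree (u * pderiv p * q - p * (u * pderiv q)) \<le> degree p + degree q"
    using degree_u_pderiv[of p] degree_u_pderiv[of q]
    by (intro degree_diff_le order_trans[OF degree_mult_le[of "u * pderiv p"]]
        order_trans[OF degree_mult_le[of p]] add_mono) auto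
  ultimately have d: "degree q \<le> degree p" unfolding e by simp
  have c1: "coeff ([:c:] * q * q) (degree p + degree q)
      = (of_nat (degree p) - of_nat (degree q)) * (lead_coeff p * lead_coeff q)"
    unfolding e[symmetric] coeff_\<delta>_numerator using u by (simp add: one_pCons)
  show ?thesis
  proof (cases "degree p = degree q")
    case True
    have "coeff ([:c:] * q * q) (degree q + degree q) = c * lead_coeff q * lead_coeff q"
      by (simp add: coeff_mult_le_degrees)
    thus ?thesis using c1 True False pq by simp
  next
    case ne: False
    hence "coeff ([:c:] * q * q) (degree p + degree q) = 0"
      using d \<open>degree ([:c:] * q * q) = 2 * degree q\<close> by (intro coeff_eq_0) auto
    hence "of_nat (degree p) = (of_nat (degree q) :: 'c)"
      unfolding c1 using p pq(1) by simp
    thus ?thesis using ne by (simp only: of_nat_eq_iff)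
  qed
qed

section \<open>Linear algebra over k\<close>

definition kindep :: "(nat \<Rightarrow> nat \<Rightarrow> 'c ratfun) \<Rightarrow> nat \<Rightarrow> bool" where
  "kindep v m \<longleftrightarrow> (\<forall>f. (\<Sum>i<m. ks (f i) (v i)) = 0 \<longrightarrow> (\<forall>i<m. f i = 0))"

abbreviation kspan where "kspan \<equiv> (kv.span :: (nat \<Rightarrow> 'c ratfun) set \<Rightarrow> _)"

lemma sc_in_kspan: "v \<in> kspan S \<Longrightarrow> sc c v \<in> kspan S"
  unfolding sc_def by (rule kv.span_scale)

lemma cspan_in_kspan: "v \<in> cv.span S \<Longrightarrow> v \<in> kspan S"
proof (induction rule: cv.span_induct_alt)
  case (step c x y)
  thus ?case by (rule kv.span_add[OF sc_in_kspan[OF kv.span_base]])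
qed (rule kv.span_zero)

lemma kspan_family:
  fixes m :: nat
  shows "w \<in> kspan (v ` {..<m}) \<Longrightarrow> \<exists>f. w = (\<Sum>i<m. ks (f i) (v i))"
proof (induction rule: kv.span_induct_alt)
  case base
  show ?case by (rule exI[of _ "\<lambda>_. 0"]) simp
next
  case (step c x y)
  then obtain f i where "y = (\<Sum>i<m. ks (f i) (v i))" "x = v i" "i < m" by auto
  moreover from this have "(\<Sum>j<m. ks (if j = i then c else 0) (v j)) = (\<Sum>j\<in>{i}. ks c (v j))"
    by (intro sum.mono_neutral_cong_right) auto
  ultimately have "ks c x + y = (\<Sum>j<m. ks (f j + (if j = i then c else 0)) (v j))"
    by (simp add: kv.scale_left_distrib sum.distrib add.commute)
  thus ?case by (intro exI[of _ "\<lambda>j. f j + (if j = i then c else 0)"])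
qed

lemma family_in_kspan: "(\<Sum>i<m. ks (f i) (v i)) \<in> kspan (v ` {..<m})"
  by (intro kv.span_sum kv.span_scale kv.span_base) auto

lemma kindep_unitv: "kindep unitv n"
  unfolding kindep_def
proof (intro allI impI)
  fix f i assume f: "(\<Sum>i<n. ks (f i) (unitv i)) = 0" and i: "i < n"
  have "(\<Sum>i<n. ks (f i) (unitv i)) i = (\<Sum>j<n. if i = j then f j else 0)"
    by (simp add: sum_fun_app ks_def unitv_def if_distrib cong: if_cong)
  also have "\<dots> = f i" using i by simp
  finally show "f i = 0" using f by (simp add: pointwise)
qed

lemma supp_in_kspan_unitv: "w \<in> supp n \<Longrightarrow> w \<in> kspan (unitv ` {..<n})"
proof -
  assume w: "w \<in> supp n"
  have "w = (\<Sum>j<n. ks (w j) (unitv j))"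
  proof
    fix i
    have "(\<Sum>j<n. ks (w j) (unitv j)) i = (\<Sum>j<n. if i = j then w j else 0)"
      by (simp add: sum_fun_app ks_def unitv_def if_distrib cong: if_cong)
    also have "\<dots> = w i" using w by (auto simp: supp_def)
    finally show "w i = (\<Sum>j<n. ks (w j) (unitv j)) i" ..
  qed
  thus ?thesis using family_in_kspan by metis
qed

lemma kindep_card_le:
  assumes "kindep v m" "\<And>i. i < m \<Longrightarrow> v i \<in> kspan (w ` {..<k})"
  shows "m \<le> k"
proof -
  have "card {..<m} \<le> card (w ` {..<k})"
    by (rule kv.family_card_le[where f = v]) (use assms in \<open>auto simp: kindep_def\<close>)
  also have "\<dots> \<le> k" using card_image_le[of "{..<k}" w] by simp
  finally show ?thesis by simp
qed

lemma kindep_extend: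
  assumes "kindep v m" "w \<notin> kspan (v ` {..<m})"
  shows "kindep (v(m := w)) (Suc m)"
  unfolding kindep_def
proof (intro allI impI)
  fix f i assume f: "(\<Sum>i<Suc m. ks (f i) ((v(m := w)) i)) = 0" and i: "i < Suc m"
  have e: "(\<Sum>i<m. ks (f i) (v i)) + ks (f m) w = 0" using f by simp
  have "f m = 0"
  proof (rule ccontr)
    assume fm: "f m \<noteq> 0"
    have "ks (f m) w = - (\<Sum>i<m. ks (f i) (v i))" using e by (simp add: eq_neg_iff_add_eq_0 add.commute)
    hence "ks (inverse (f m)) (ks (f m) w) \<in> kspan (v ` {..<m})"
      by (simp only: kv.span_scale[OF kv.span_neg[OF family_in_kspan]])
    thus False using fm assms(2) by (simp add: ks_ks)
  qed
  thus "f i = 0" using e assms(1) i by (auto simp: kindep_def less_Suc_eq)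
qed

lemma generator_outside:
  assumes "\<And>i. i < n \<Longrightarrow> unitv i \<in> kspan G" "m < n"
  shows "\<exists>w\<in>G. w \<notin> kspan (v ` {..<m})"
proof (rule ccontr)
  assume "\<not> ?thesis"
  hence "G \<subseteq> kspan (v ` {..<m})" by blast
  hence "kspan G \<subseteq> kspan (v ` {..<m})" by (simp add: kv.span_minimal)
  hence "n \<le> m" using assms(1) by (intro kindep_card_le[OF kindep_unitv]) auto
  thus False using assms(2) by simp
qed

section \<open>Decomposition of torsion elements\<close>

definition gen :: "'c \<Rightarrow> (nat \<Rightarrow> 'c ratfun) \<Rightarrow> bool" where
  "gen l v \<longleftrightarrow> v \<in> supp n \<and> (\<exists>N. pact D ([:-l, 1:] ^ N) v = 0)"

lemma pact_linear_factor: "pact D [:-l, 1:] v = D v - sc l v"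
  by (simp add: Dl.pact_pCons cv.scale_minus_left)

text \<open>Primary decomposition, one root l of p at a time: the full power (D - l)^e and the
  cofactor p1 are coprime, and a Bezout identity splits v into a part killed by the one and a part
  killed by the other.\<close>

lemma tors_in_span_gen:
  assumes "p \<noteq> 0" "pact D p v = 0" "v \<in> supp n"
  shows "v \<in> cv.span {w. \<exists>l. gen l w}"
  using assms
proof (induction "degree p" arbitrary: p v rule: less_induct)
  case less
  show ?case
  proof (cases "degree p = 0")
    case True
    then obtain c where c: "p = [:c:]" by (rule degree_eq_zeroE)
    hence "v = 0" using less.prems by (simp add: Dl.pact_const)
    thus ?thesis by (simp add: cv.span_zero)
  next
    case False
    then obtain l where l: "poly p l = 0" using alg_closed_imp_poly_has_root by blast
    obtain p1 where p1: "p = [:-l, 1:] ^ order l p * p1" "\<not> [:-l, 1:] dvd p1"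
      using order_decomp[OF less.prems(1)] by blast
    define e where "e = order l p"
    have e: "e > 0" unfolding e_def using l less.prems(1) by (simp add: order_gt_0_iff)
    have p1nz: "p1 \<noteq> 0" using p1 by auto
    have "degree p = degree ([:-l, 1:] ^ e) + degree p1"
      using p1(1) p1nz unfolding e_def[symmetric] by (metis degree_mult_eq power_eq_0_iff pCons_eq_0_iff one_neq_zero)
    hence deg: "degree p1 < degree p" using e by (simp add: degree_linear_power)
    obtain r t where rt: "r * p1 + t * [:-l, 1:] ^ e = 1"
      using bezout_linear_power[of p1 l e] p1(2) by (auto simp: dvd_iff_poly_eq_0)
    define v1 where "v1 = pact D (r * p1) v"
    define v2 where "v2 = pact D (t * [:-l, 1:] ^ e) v"
    have v: "v = v1 + v2" unfolding v1_def v2_def pact_add[symmetric] rt by simp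
    have pe: "p = [:-l, 1:] ^ e * p1" unfolding e_def by (rule p1(1))
    have "[:-l, 1:] ^ e * (r * p1) = r * p" "p1 * (t * [:-l, 1:] ^ e) = t * p"
      unfolding pe by (simp_all only: ac_simps)
    note eqs = this
    have "pact D ([:-l, 1:] ^ e) v1 = pact D (r * p) v"
      unfolding v1_def Dl.pact_mult[symmetric] eqs ..
    hence "gen l v1" using less.prems unfolding gen_def v1_def
      by (intro conjI exI[of _ e]) (auto simp: Dl.pact_mult)
    hence "v1 \<in> cv.span {w. \<exists>l. gen l w}" by (intro cv.span_base) auto
    moreover have "pact D p1 v2 = pact D (t * p) v"
      unfolding v2_def Dl.pact_mult[symmetric] eqs ..
    hence "v2 \<in> cv.span {w. \<exists>l. gen l w}"
      using less.prems deg p1nz by (intro less.hyps[of p1]) (auto simp: v2_def Dl.pact_mult)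
    ultimately show ?thesis unfolding v by (rule cv.span_add)
  qed
qed

text \<open>Only a multiple g e_i is known to lie in \<open>LL\<close>, so the span is taken over k,
  where g is invertible.\<close>

lemma gen_span:
  assumes tors: "\<And>v. v \<in> LL \<Longrightarrow> tors v" and i: "i < n"
  shows "unitv i \<in> kspan {w. \<exists>l. gen l w}"
proof -
  obtain g where g: "g \<noteq> 0" "\<And>i. i < n \<Longrightarrow> ks (to_fract g) (unitv i) \<in> LL"
    using LL_large by blast
  have "tors (ks (to_fract g) (unitv i))" using g i tors by blast
  hence "ks (to_fract g) (unitv i) \<in> cv.span {w. \<exists>l. gen l w}"
    using tors_in_span_gen LL_supp[OF g(2)[OF i]] unfolding tors_def by blast
  hence "ks (to_fract g) (unitv i) \<in> kspan {w. \<exists>l. gen l w}" by (rule cspan_in_kspan)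
  hence "ks (inverse (to_fract g)) (ks (to_fract g) (unitv i)) \<in> kspan {w. \<exists>l. gen l w}"
    by (rule kv.span_scale)
  thus ?thesis using g(1) by (simp add: ks_ks)
qed

definition eigenv :: "'c \<Rightarrow> (nat \<Rightarrow> 'c ratfun) \<Rightarrow> bool" where
  "eigenv l v \<longleftrightarrow> v \<in> supp n \<and> D v = sc l v"

text \<open>As \<delta> x = 1, an eigenvector w satisfies (D - l)^N (x^N w) = N! w. Subtracting x^N
  w / N! with w = (D - l)^N v lowers the power of D - l needed to kill v; iterated, this is the
  Taylor expansion of v.\<close>

lemma gen_in_kspan_eigenv:
  assumes u: "u = 1" and "gen l v"
  shows "v \<in> kspan {w. eigenv l w}"
proof -
  obtain N where N: "pact D ([:-l, 1:] ^ N) v = 0" and v: "v \<in> supp n"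
    using assms(2) unfolding gen_def by blast
  have \<delta>X: "\<delta> (rf_X ^ Suc k) = of_nat (Suc k) * rf_X ^ k" for k
  proof -
    have "\<delta> rf_X = 1" unfolding \<delta>_eq rf_deriv_X by (simp add: u)
    hence "rf_X * \<delta> (rf_X ^ Suc k) = rf_X * (of_nat (Suc k) * rf_X ^ k)"
      unfolding \<delta>_power by (simp only: power_Suc mult_1_right mult_1_left ac_simps)
    moreover have "rf_X \<noteq> (0 :: 'c ratfun)" by (simp add: rf_X_def)
    ultimately show ?thesis by simp
  qed
  have fact: "pact D ([:-l, 1:] ^ k) (ks (rf_X ^ k) w) = sc (fact k) w" if w: "eigenv l w" for w k
  proof (induction k)
    case (Suc k)
    have "pact D [:-l, 1:] (ks (rf_X ^ Suc k) w) = sc (of_nat (Suc k)) (ks (rf_X ^ k) w)"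
    proof -
      have "D (ks (rf_X ^ Suc k) w) = ks (of_nat (Suc k) * rf_X ^ k) w + ks (rf_X ^ Suc k) (sc l w)"
        using w unfolding eigenv_def by (simp only: D_ks \<delta>X)
      thus ?thesis unfolding pact_linear_factor
        by (simp only: ks_sc ks_ks rf_const_of_nat sc_def mult.commute add_diff_cancel_right')
    qed
    hence "pact D ([:-l, 1:] ^ Suc k) (ks (rf_X ^ Suc k) w) = sc (of_nat (Suc k)) (sc (fact k) w)"
      unfolding power_Suc2 Dl.pact_mult by (simp only: Dl.pact_sc_right Suc)
    thus ?case by (simp add: algebra_simps)
  qed simp
  show ?thesis using N v
  proof (induction N arbitrary: v)
    case 0
    thus ?case by (simp add: kv.span_zero)
  next
    case (Suc N)
    define w where "w = pact D ([:-l, 1:] ^ N) v"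
    have "pact D [:-l, 1:] w = 0"
      using Suc.prems(1) unfolding w_def power_Suc Dl.pact_mult .
    hence w: "eigenv l w" using Suc.prems(2) unfolding pact_linear_factor eigenv_def w_def by simp
    define y where "y = ks (rf_X ^ N) (sc (1 / fact N) w)"
    have "pact D ([:-l, 1:] ^ N) y = w"
      unfolding y_def ks_sc Dl.pact_sc_right fact[OF w] by simp
    hence "pact D ([:-l, 1:] ^ N) (v - y) = 0"
      using c_linear.T_diff[OF Dl.pact_linear] by (simp add: w_def)
    moreover have "v - y \<in> supp n"
      using Suc.prems(2) w unfolding y_def eigenv_def by (intro supp_diff supp_ks supp_sc) auto
    ultimately have "v - y \<in> kspan {w. eigenv l w}" by (rule Suc.IH)
    moreover have "y \<in> kspan {w. eigenv l w}"
      unfolding y_def using w by (intro kv.span_scale sc_in_kspan kv.span_base) auto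
    ultimately have "(v - y) + y \<in> kspan {w. eigenv l w}" by (rule kv.span_add)
    thus ?case by simp
  qed
qed

lemma sum_ks_D:
  assumes "\<And>i. i < m \<Longrightarrow> v i \<in> supp n"
  shows "D (\<Sum>i<m. ks (f i) (v i)) = (\<Sum>i<m. ks (\<delta> (f i)) (v i)) + (\<Sum>i<m. ks (f i) (D (v i)))"
  using assms by (simp add: Dl.T_sum D_ks sum.distrib)

text \<open>Each coordinate solves \<delta> f = (lw - l_i) f, and for d/dx the rational solutions of
  such an equation are constants.\<close>

lemma eigenv_const_coeffs:
  assumes u: "u = 1" and v: "\<And>i. i < m \<Longrightarrow> eigenv (l i) (v i)" and ind: "kindep v m"
    and w: "eigenv lw w" "w \<in> kspan (v ` {..<m})"
  shows "\<exists>c. w = (\<Sum>i<m. sc (c i) (v i))"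
proof -
  obtain f where f: "w = (\<Sum>i<m. ks (f i) (v i))" using kspan_family[OF w(2)] by blast
  have Dv: "D (v i) = ks (rf_const (l i)) (v i)" if "i < m" for i
    using v[OF that] by (simp add: eigenv_def sc_def)
  have "0 = D w - sc lw w" using w(1) by (simp add: eigenv_def)
  also have "\<dots> = (\<Sum>i<m. ks (\<delta> (f i)) (v i)) + (\<Sum>i<m. ks (f i * rf_const (l i)) (v i))
      - (\<Sum>i<m. ks (rf_const lw * f i) (v i))"
    unfolding f using v by (subst sum_ks_D) (auto simp: eigenv_def Dv ks_ks sc_def ks_sum)
  also have "\<dots> = (\<Sum>i<m. ks (\<delta> (f i) + f i * rf_const (l i) - rf_const lw * f i) (v i))"
    by (simp add: kv.scale_left_distrib kv.scale_left_diff_distrib sum.distrib sum_subtractf)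
  finally have "\<forall>i<m. \<delta> (f i) + f i * rf_const (l i) - rf_const lw * f i = 0"
    using ind[unfolded kindep_def, rule_format, of "\<lambda>i. \<delta> (f i) + f i * rf_const (l i) - rf_const lw * f i"]
    by metis
  hence e: "\<delta> (f i) = rf_const (lw + - l i) * f i" if "i < m" for i
    using that unfolding rf_const_add rf_const_minus by (simp add: algebra_simps)
  have "\<exists>c. f i = rf_const c" if "i < m" for i
  proof (cases "f i = 0")
    case True
    thus ?thesis by (metis rf_const_0)
  next
    case False
    hence "lw + - l i = 0" using \<delta>_exponential[OF e[OF that]] u by (auto simp: one_pCons)
    hence "\<delta> (f i) = 0" using e[OF that] by (simp add: rf_const_0)
    thus ?thesis by (rule \<delta>_eq_zero)
  qed
  then obtain c where "\<And>i. i < m \<Longrightarrow> f i = rf_const (c i)" by metis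
  hence "w = (\<Sum>i<m. sc (c i) (v i))" unfolding f sc_def by simp
  thus ?thesis by blast
qed

lemma kindep_bound: "kindep v m \<Longrightarrow> (\<And>i. i < m \<Longrightarrow> v i \<in> supp n) \<Longrightarrow> m \<le> n"
  by (rule kindep_card_le[of v m unitv n]) (auto intro: supp_in_kspan_unitv)

section \<open>Case S: a basis of eigenvectors of D on which \<Phi> is triangular\<close>

lemma eigenv_Ph:
  assumes "\<mu> = 1" "eigenv l w"
  shows "eigenv l (Ph w)"
  using assms by (simp add: eigenv_def D_Ph Ph_sc)

lemma eigenv_add: "eigenv l v \<Longrightarrow> eigenv l w \<Longrightarrow> eigenv l (v + w)"
  by (auto simp: eigenv_def D_add cv.scale_right_distrib intro: supp_add)

lemma eigenv_sc: "eigenv l v \<Longrightarrow> eigenv l (sc c v)"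
  by (auto simp: eigenv_def D_sc mult.commute intro: supp_sc)

lemma eigenv_pact_Ph: "\<mu> = 1 \<Longrightarrow> eigenv l w \<Longrightarrow> eigenv l (pact Ph p w)"
proof (induction p)
  case 0
  show ?case by (simp add: eigenv_def)
next
  case (pCons a p)
  thus ?case by (simp add: Phl.pact_pCons eigenv_add eigenv_sc eigenv_Ph)
qed

text \<open>All \<Phi>^i w lie in the same eigenspace of D. The first one that depends over k on its
  predecessors does so with constant coefficients (\<open>eigenv_const_coeffs\<close>), and these
  form p.\<close>

lemma Ph_annihilator:
  assumes u: "u = 1" and \<mu>1: "\<mu> = 1" and w: "eigenv l w"
  shows "\<exists>p. p \<noteq> 0 \<and> pact Ph p w = 0"
proof -
  define y where "y = (\<lambda>i. (Ph ^^ i) w)"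
  have y: "eigenv l (y i)" for i unfolding y_def using w by (induction i) (auto intro: eigenv_Ph[OF \<mu>1])
  have "\<not> kindep y (Suc n)" using kindep_bound[of y "Suc n"] y by (auto simp: eigenv_def)
  moreover have "kindep y 0" by (simp add: kindep_def)
  ultimately obtain k where k: "kindep y k" "\<not> kindep y (Suc k)"
    using nat_induct[of "kindep y" "Suc n"] by blast
  have "y k \<in> kspan (y ` {..<k})"
  proof (rule ccontr)
    assume "y k \<notin> kspan (y ` {..<k})"
    hence "kindep (y(k := y k)) (Suc k)" using k(1) by (intro kindep_extend)
    thus False using k(2) by simp
  qed
  then obtain c where c: "y k = (\<Sum>i<k. sc (c i) (y i))"
    using eigenv_const_coeffs[OF u, of k "\<lambda>_. l" y l "y k"] y k(1) by blast
  define p where "p = monom 1 k - (\<Sum>i<k. monom (c i) i)"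
  have "pact Ph p w = y k - (\<Sum>i<k. sc (c i) (y i))"
    by (simp add: p_def pact_diff pact_sum Phl.pact_monom y_def)
  hence "pact Ph p w = 0" using c by simp
  moreover have "coeff p k = 1" by (simp add: p_def coeff_sum)
  hence "p \<noteq> 0" by auto
  ultimately show ?thesis by blast
qed

text \<open>With U the span of the vectors found so far, let p of least degree satisfy p(\<Phi>) w0
  in U, and split off a root: p = (T - \<beta>) p1. Then p1(\<Phi>) w0 lies outside U and is an
  eigenvector of \<Phi> modulo U.\<close>

lemma eigenv_chain_extend:
  assumes u: "u = 1" and \<mu>1: "\<mu> = 1" and span: "\<And>i. i < n \<Longrightarrow> unitv i \<in> kspan {w. \<exists>l. eigenv l w}"
    and v: "\<And>i. i < m \<Longrightarrow> eigenv (l i) (v i)" and ind: "kindep v m" and m: "m < n"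
  shows "\<exists>w lw \<beta> c. eigenv lw w \<and> w \<notin> kspan (v ` {..<m}) \<and> Ph w = sc \<beta> w + (\<Sum>i<m. sc (c i) (v i))"
proof -
  let ?U = "kspan (v ` {..<m})"
  obtain w0 lw where w0: "eigenv lw w0" "w0 \<notin> ?U" using generator_outside[OF span m] by blast
  define Q where "Q = (\<lambda>p. p \<noteq> 0 \<and> pact Ph p w0 \<in> ?U)"
  have "\<exists>p. Q p" using Ph_annihilator[OF u \<mu>1 w0(1)] kv.span_zero unfolding Q_def by metis
  then obtain p where p: "Q p" and least: "\<And>p'. Q p' \<Longrightarrow> degree p \<le> degree p'"
    using ex_has_least_nat[of Q _ degree] by blast
  have "degree p \<noteq> 0"
  proof
    assume "degree p = 0"
    then obtain c where c: "p = [:c:]" by (rule degree_eq_zeroE)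
    hence c: "c \<noteq> 0" "sc c w0 \<in> ?U" using p by (auto simp: Q_def Phl.pact_const)
    have "sc (1 / c) (sc c w0) \<in> ?U" by (rule sc_in_kspan[OF c(2)])
    thus False using w0(2) c(1) by simp
  qed
  then obtain \<beta> where "poly p \<beta> = 0" using alg_closed_imp_poly_has_root by blast
  then obtain p1 where p1: "p = [:-\<beta>, 1:] * p1" by (metis dvdE poly_eq_0_iff_dvd)
  have p1nz: "p1 \<noteq> 0" using p p1 by (auto simp: Q_def)
  define w where "w = pact Ph p1 w0"
  have w: "eigenv lw w" unfolding w_def by (rule eigenv_pact_Ph[OF \<mu>1 w0(1)])
  have "w \<notin> ?U"
  proof
    assume "w \<in> ?U"
    hence "degree p \<le> degree p1" using p1nz by (intro least) (simp add: Q_def w_def)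
    moreover have "degree p = Suc (degree p1)" unfolding p1 using p1nz by (subst degree_mult_eq) auto
    ultimately show False by simp
  qed
  have e: "pact Ph p w0 = Ph w - sc \<beta> w"
    unfolding p1 Phl.pact_mult w_def[symmetric] by (simp add: Phl.pact_pCons cv.scale_minus_left)
  hence "Ph w - sc \<beta> w \<in> ?U" using p by (simp add: Q_def)
  moreover have "eigenv lw (Ph w - sc \<beta> w)" unfolding e[symmetric] by (rule eigenv_pact_Ph[OF \<mu>1 w0(1)])
  ultimately obtain c where "Ph w - sc \<beta> w = (\<Sum>i<m. sc (c i) (v i))"
    using eigenv_const_coeffs[OF u v ind] by blast
  hence "Ph w = sc \<beta> w + (\<Sum>i<m. sc (c i) (v i))" by (simp add: diff_eq_eq add.commute)
  thus ?thesis using w \<open>w \<notin> ?U\<close> by blast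
qed

lemma basis_case_S:
  assumes u: "u = 1" and \<mu>1: "\<mu> = 1" and tors: "\<And>v. v \<in> LL \<Longrightarrow> tors v"
  shows "\<exists>v l C. kindep v n \<and> (\<forall>i<n. eigenv (l i) (v i)) \<and>
      (\<forall>i<n. \<forall>j. C i j \<noteq> 0 \<longrightarrow> j \<le> i) \<and> (\<forall>i<n. Ph (v i) = (\<Sum>j<n. sc (C i j) (v j)))"
proof -
  have span: "unitv i \<in> kspan {w. \<exists>l. eigenv l w}" if "i < n" for i
  proof -
    have "{w. \<exists>l. gen l w} \<subseteq> kspan {w. \<exists>l. eigenv l w}"
      using gen_in_kspan_eigenv[OF u] kv.span_mono[of "{w. eigenv _ w}" "{w. \<exists>l. eigenv l w}"] by blast
    hence "kspan {w. \<exists>l. gen l w} \<subseteq> kspan {w. \<exists>l. eigenv l w}" by (simp add: kv.span_minimal)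
    thus ?thesis using gen_span[OF tors that] by blast
  qed
  have "\<exists>v l C. kindep v m \<and> (\<forall>i<m. eigenv (l i) (v i)) \<and>
      (\<forall>i<m. \<forall>j. C i j \<noteq> 0 \<longrightarrow> j \<le> i) \<and> (\<forall>i<m. Ph (v i) = (\<Sum>j\<le>i. sc (C i j) (v j)))" if "m \<le> n" for m
    using that
  proof (induction m)
    case 0
    show ?case by (auto simp: kindep_def)
  next
    case (Suc m)
    then obtain v l C where "kindep v m \<and> (\<forall>i<m. eigenv (l i) (v i)) \<and>
      (\<forall>i<m. \<forall>j. C i j \<noteq> 0 \<longrightarrow> j \<le> i) \<and> (\<forall>i<m. Ph (v i) = (\<Sum>j\<le>i. sc (C i j) (v j)))"
      using Suc_leD by blast
    hence h: "kindep v m" "\<And>i. i < m \<Longrightarrow> eigenv (l i) (v i)"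
      "\<And>i j. i < m \<Longrightarrow> C i j \<noteq> 0 \<Longrightarrow> j \<le> i" "\<And>i. i < m \<Longrightarrow> Ph (v i) = (\<Sum>j\<le>i. sc (C i j) (v j))"
      by blast+
    have mn: "m < n" using Suc.prems by simp
    obtain w lw \<beta> c where w: "eigenv lw w" "w \<notin> kspan (v ` {..<m})"
      "Ph w = sc \<beta> w + (\<Sum>i<m. sc (c i) (v i))"
      using eigenv_chain_extend[OF u \<mu>1 span h(2,1) mn] by blast
    let ?v = "v(m := w)" and ?l = "l(m := lw)"
    let ?C = "C(m := (\<lambda>j. if j < m then c j else if j = m then \<beta> else 0))"
    have "kindep ?v (Suc m)" using h(1) w(2) by (rule kindep_extend)
    moreover have "\<forall>i<Suc m. eigenv (?l i) (?v i)" using h(2) w(1) by (auto simp: less_Suc_eq)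
    moreover have "\<forall>i<Suc m. \<forall>j. ?C i j \<noteq> 0 \<longrightarrow> j \<le> i" using h(3) by (auto simp: less_Suc_eq split: if_splits)
    moreover have "Ph (?v i) = (\<Sum>j\<le>i. sc (?C i j) (?v j))" if "i < Suc m" for i
    proof (cases "i < m")
      case True
      hence "(\<Sum>j\<le>i. sc (?C i j) (?v j)) = (\<Sum>j\<le>i. sc (C i j) (v j))"
        by (intro sum.cong) auto
      thus ?thesis using True h(4) by simp
    next
      case False
      hence i: "i = m" using that by simp
      have "(\<Sum>j\<le>m. sc (?C m j) (?v j)) = (\<Sum>j<m. sc (?C m j) (?v j)) + sc \<beta> w"
        by (simp add: lessThan_Suc_atMost[symmetric])
      also have "(\<Sum>j<m. sc (?C m j) (?v j)) = (\<Sum>j<m. sc (c j) (v j))" by (intro sum.cong) auto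
      finally show ?thesis using w(3) i by (simp add: add.commute)
    qed
    ultimately show ?case by blast
  qed
  from this[OF order_refl] obtain v l C where "kindep v n \<and> (\<forall>i<n. eigenv (l i) (v i)) \<and>
      (\<forall>i<n. \<forall>j. C i j \<noteq> 0 \<longrightarrow> j \<le> i) \<and> (\<forall>i<n. Ph (v i) = (\<Sum>j\<le>i. sc (C i j) (v j)))"
    by blast
  hence h: "kindep v n" "\<And>i. i < n \<Longrightarrow> eigenv (l i) (v i)"
      "\<And>i j. i < n \<Longrightarrow> C i j \<noteq> 0 \<Longrightarrow> j \<le> i" "\<And>i. i < n \<Longrightarrow> Ph (v i) = (\<Sum>j\<le>i. sc (C i j) (v j))"
    by blast+
  have "Ph (v i) = (\<Sum>j<n. sc (C i j) (v j))" if i: "i < n" for i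
  proof -
    have "sc (C i j) (v j) = 0" if "j > i" for j using h(3)[OF i, of j] that by (metis cv.scale_zero_left not_less)
    hence "(\<Sum>j\<le>i. sc (C i j) (v j)) = (\<Sum>j<n. sc (C i j) (v j))"
      using i by (intro sum.mono_neutral_left) auto
    thus ?thesis using h(4)[OF i] by simp
  qed
  hence "\<forall>i<n. Ph (v i) = (\<Sum>j<n. sc (C i j) (v j))" by blast
  moreover have "\<forall>i<n. eigenv (l i) (v i)" "\<forall>i<n. \<forall>j. C i j \<noteq> 0 \<longrightarrow> j \<le> i" using h by blast+
  ultimately show ?thesis using h(1) by (intro exI[of _ v] exI[of _ l] exI[of _ C] conjI)
qed

end

section \<open>Bases without resonances\<close>

lemma triangular_sum:
  fixes v :: "nat \<Rightarrow> nat \<Rightarrow> 'c::field ratfun"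
  assumes "i < m" "\<And>j. c j \<noteq> 0 \<Longrightarrow> j < i"
  shows "(\<Sum>j<i. sc (c j) (v j)) = (\<Sum>j<m. sc (c j) (v j))"
proof (rule sum.mono_neutral_left)
  have "c j = 0" if "j \<in> {..<m} - {..<i}" for j using assms(2)[of j] that by auto
  thus "\<forall>j\<in>{..<m} - {..<i}. sc (c j) (v j) = 0" by simp
qed (use assms in auto)

context system_cases
begin

context
  assumes u: "u = [:0, 1:]"
begin

lemma \<delta>_X_powi: "\<delta> (rf_X powi k) = rf_const (of_int k) * rf_X powi k"
proof (induction k rule: int_induct[of _ 0])
  case base
  have "\<delta> 1 = 0" using \<delta>_const[of 1] by (simp only: rf_const_1)
  thus ?case by (simp add: rf_const_0)
next
  case (step1 i)
  have X: "rf_X \<noteq> (0 :: 'c ratfun)" by (simp add: rf_X_def)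
  have \<delta>X: "\<delta> rf_X = rf_X" unfolding \<delta>_eq rf_deriv_X by (simp add: u rf_X_def)
  have "rf_X powi (i + 1) = rf_X powi i * (rf_X :: 'c ratfun)" using X by (simp add: power_int_add_1)
  thus ?case by (simp add: \<delta>_mult step1 \<delta>X rf_const_add rf_const_1 algebra_simps)
next
  case (step2 i)
  have X: "rf_X \<noteq> (0 :: 'c ratfun)" by (simp add: rf_X_def)
  have \<delta>X: "\<delta> rf_X = rf_X" unfolding \<delta>_eq rf_deriv_X by (simp add: u rf_X_def)
  have e: "rf_X powi i = rf_X powi (i - 1) * (rf_X :: 'c ratfun)"
    using power_int_add_1[of rf_X "i - 1"] X by (metis diff_add_cancel)
  have "\<delta> (rf_X powi i) = rf_const (of_int i) * (rf_X powi (i - 1) * rf_X)"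
    using step2 by (simp only: e)
  moreover have "\<delta> (rf_X powi i) = \<delta> (rf_X powi (i - 1)) * rf_X + rf_X powi (i - 1) * rf_X"
    unfolding e \<delta>_mult \<delta>X ..
  ultimately have "rf_X * \<delta> (rf_X powi (i - 1))
      = rf_X * ((rf_const (of_int i) - 1) * rf_X powi (i - 1))"
    by (simp add: algebra_simps)
  moreover have "rf_const (of_int i) - 1 = rf_const (of_int (i - 1) :: 'c)"
  proof -
    have "rf_const (of_int i :: 'c) = rf_const (of_int (i - 1) + 1)" by simp
    thus ?thesis unfolding rf_const_add rf_const_1 by simp
  qed
  ultimately show ?case using X by simp
qed

text \<open>Multiplication by x^k is the shearing transformation that makes it possible to remove
  resonances.\<close>

lemma gen_shift:
  assumes "gen l v"
  shows "gen (l + of_int k) (ks (rf_X powi k) v)"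
proof -
  obtain N where N: "pact D ([:-l, 1:] ^ N) v = 0" and v: "v \<in> supp n"
    using assms unfolding gen_def by blast
  have "pcompose [:-(l + of_int k), 1:] [:of_int k, 1:] = [:-l, 1:]"
    by (simp add: pcompose_pCons)
  hence "pact D ([:-(l + of_int k), 1:] ^ N) (ks (rf_X powi k) v) = ks (rf_X powi k) 0"
    unfolding pact_D_eigenfunction[OF \<delta>_X_powi v] pcompose_pow using N by simp
  thus ?thesis unfolding gen_def using v by (auto intro: supp_ks)
qed

lemma gen_pact: "gen l v \<Longrightarrow> gen l (pact D p v)"
  unfolding gen_def by (metis Dl.pact_commute Dl.pact_zero_right pact_D_supp)

text \<open>A partial basis on which D is triangular with constant entries. T links only vectors of
  equal eigenvalue, which keeps the generalised eigenspaces apart.\<close>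

definition chain :: "'c set \<Rightarrow> nat \<Rightarrow> (nat \<Rightarrow> nat \<Rightarrow> 'c ratfun) \<Rightarrow> (nat \<Rightarrow> 'c) \<Rightarrow> (nat \<Rightarrow> nat \<Rightarrow> 'c) \<Rightarrow> bool" where
  "chain \<Lambda> m v l T \<longleftrightarrow> kindep v m \<and> (\<forall>i<m. v i \<in> supp n) \<and> (\<forall>i<m. l i \<in> \<Lambda>) \<and>
    (\<forall>i<m. \<forall>j. T i j \<noteq> 0 \<longrightarrow> j < i \<and> l j = l i) \<and>
    (\<forall>i<m. D (v i) = sc (l i) (v i) + (\<Sum>j<i. sc (T i j) (v j)))"

context
  fixes \<Lambda> :: "'c set"
  assumes nonres: "\<And>x y. x \<in> \<Lambda> \<Longrightarrow> y \<in> \<Lambda> \<Longrightarrow> x - y \<in> \<int> \<Longrightarrow> x = y"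
begin

text \<open>The coefficients of \<open>w\<close> satisfy a triangular system \<open>\<delta> f\<^sub>i = (\<lambda> - l\<^sub>i) f\<^sub>i + \<dots>\<close>, whose rational
  solutions are constant because \<open>\<Lambda>\<close> is free of resonances.\<close>
lemma gen_const_coeffs:
  assumes ch: "chain \<Lambda> m v l T" and lw: "lw \<in> \<Lambda>"
    and w: "pact D ([:-lw, 1:] ^ N) w = 0" "w = (\<Sum>i<m. ks (f i) (v i))"
  shows "\<exists>c. (\<forall>i<m. f i = rf_const (c i)) \<and> (\<forall>i<m. l i \<noteq> lw \<longrightarrow> c i = 0)"
  using w
proof (induction N arbitrary: w f)
  case 0
  hence "(\<Sum>i<m. ks (f i) (v i)) = 0" by simp
  hence "\<forall>i<m. f i = 0" using ch unfolding chain_def kindep_def by blast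
  thus ?case by (intro exI[of _ "\<lambda>_. 0"]) (simp add: rf_const_0)
next
  case (Suc N)
  have ind: "kindep v m" and vs: "\<And>i. i < m \<Longrightarrow> v i \<in> supp n" and l\<Lambda>: "\<And>i. i < m \<Longrightarrow> l i \<in> \<Lambda>"
    and T: "\<And>i j. i < m \<Longrightarrow> T i j \<noteq> 0 \<Longrightarrow> j < i \<and> l j = l i"
    and Dv: "\<And>i. i < m \<Longrightarrow> D (v i) = sc (l i) (v i) + (\<Sum>j<i. sc (T i j) (v j))"
    using ch unfolding chain_def by blast+
  \<comment> \<open>F i is the coefficient of v_i in (D - lw) w. One power of D - lw fewer kills
    that vector, so the induction hypothesis makes F i constant.\<close>
  define F where "F = (\<lambda>i. \<delta> (f i) + f i * rf_const (l i) - rf_const lw * f i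
      + (\<Sum>j<m. f j * rf_const (T j i)))"
  have "D w - sc lw w = (\<Sum>i<m. ks (F i) (v i))"
  proof -
    have "(\<Sum>i<m. ks (f i) (D (v i)))
        = (\<Sum>i<m. ks (f i * rf_const (l i)) (v i)) + (\<Sum>i<m. \<Sum>j<m. ks (f i * rf_const (T i j)) (v j))"
    proof -
      have "ks (f i) (D (v i)) = ks (f i * rf_const (l i)) (v i) + (\<Sum>j<m. ks (f i * rf_const (T i j)) (v j))"
        if i: "i < m" for i
      proof -
        have "(\<Sum>j<i. sc (T i j) (v j)) = (\<Sum>j<m. sc (T i j) (v j))"
          using T[OF i] by (intro triangular_sum[OF i]) blast
        thus ?thesis unfolding Dv[OF i] by (simp add: ks_add ks_sum sc_def ks_ks)
      qed
      thus ?thesis by (simp add: sum.distrib)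
    qed
    also have "(\<Sum>i<m. \<Sum>j<m. ks (f i * rf_const (T i j)) (v j))
        = (\<Sum>i<m. ks (\<Sum>j<m. f j * rf_const (T j i)) (v i))"
      by (subst sum.swap) (simp add: kv.scale_sum_left)
    finally have "D w - sc lw w = (\<Sum>i<m. ks (\<delta> (f i)) (v i)) + ((\<Sum>i<m. ks (f i * rf_const (l i)) (v i))
        + (\<Sum>i<m. ks (\<Sum>j<m. f j * rf_const (T j i)) (v i))) - (\<Sum>i<m. ks (rf_const lw * f i) (v i))"
      unfolding Suc.prems(2) using vs by (subst sum_ks_D) (auto simp: sc_def ks_sum ks_ks)
    also have "\<dots> = (\<Sum>i<m. ks (F i) (v i))"
      by (simp add: F_def kv.scale_left_distrib kv.scale_left_diff_distrib sum.distrib sum_subtractf)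
    finally show ?thesis .
  qed
  moreover have "pact D ([:-lw, 1:] ^ N) (D w - sc lw w) = 0"
    using Suc.prems(1) unfolding power_Suc2 Dl.pact_mult pact_linear_factor .
  ultimately obtain c where c: "\<And>i. i < m \<Longrightarrow> F i = rf_const (c i)"
    "\<And>i. i < m \<Longrightarrow> l i \<noteq> lw \<Longrightarrow> c i = 0" using Suc.IH by blast
  \<comment> \<open>Besides f_i, the equation for index i involves only f_j with j > i, so the
    indices are treated downwards from m - 1.\<close>
  have "\<exists>d. f i = rf_const d \<and> (l i \<noteq> lw \<longrightarrow> d = 0)" if "i < m" for i
    using that
  proof (induction "m - i" arbitrary: i rule: less_induct)
    case less
    have later: "\<exists>d. f j = rf_const d \<and> (l j \<noteq> lw \<longrightarrow> d = 0)" if "i < j" "j < m" for j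
      using less.hyps[of j] that by auto
    then obtain d where d: "\<And>j. i < j \<Longrightarrow> j < m \<Longrightarrow> f j = rf_const (d j) \<and> (l j \<noteq> lw \<longrightarrow> d j = 0)"
      by metis
    have S: "(\<Sum>j<m. f j * rf_const (T j i)) = rf_const (\<Sum>j\<in>{i<..<m}. d j * T j i)"
    proof -
      have "(\<Sum>j<m. f j * rf_const (T j i)) = (\<Sum>j\<in>{i<..<m}. f j * rf_const (T j i))"
      proof (rule sum.mono_neutral_right)
        show "\<forall>j\<in>{..<m} - {i<..<m}. f j * rf_const (T j i) = 0"
        proof
          fix j assume "j \<in> {..<m} - {i<..<m}"
          hence "j < m" "\<not> i < j" by auto
          hence "T j i = 0" using T by blast
          thus "f j * rf_const (T j i) = 0" by (simp add: rf_const_0)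
        qed
      qed auto
      also have "\<dots> = (\<Sum>j\<in>{i<..<m}. rf_const (d j * T j i))"
        using d by (intro sum.cong) (auto simp: rf_const_mult)
      finally show ?thesis by (simp add: rf_const_sum)
    qed
    have e: "\<delta> (f i) + f i * rf_const (l i) - rf_const lw * f i
        + rf_const (\<Sum>j\<in>{i<..<m}. d j * T j i) = rf_const (c i)"
      using c(1)[OF less.prems] unfolding F_def S .
    show ?case
    proof (cases "l i = lw")
      case True
      hence "\<delta> (f i) = rf_const (c i + - (\<Sum>j\<in>{i<..<m}. d j * T j i))"
        using e unfolding rf_const_add rf_const_minus by (simp add: algebra_simps)
      then obtain d' where "f i = rf_const d'" using \<delta>_const_antiderivative[OF u] by blast
      thus ?thesis using True by blast
    next
      case False
      have "d j * T j i = 0" if "j \<in> {i<..<m}" for j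
      proof (rule ccontr)
        assume nz: "d j * T j i \<noteq> 0"
        have "i < j" "j < m" using that by auto
        hence "l i = l j" using T[of j i] nz by auto
        thus False using d[OF \<open>i < j\<close> \<open>j < m\<close>] nz False by simp
      qed
      hence "(\<Sum>j\<in>{i<..<m}. d j * T j i) = 0" by (intro sum.neutral ballI)
      hence "\<delta> (f i) = rf_const (lw + - l i) * f i"
        using e c(2)[OF less.prems False] unfolding rf_const_add rf_const_minus
        by (simp add: rf_const_0 algebra_simps)
      moreover have "lw + - l i \<notin> \<int>" using nonres[OF lw l\<Lambda>[OF less.prems]] False by auto
      ultimately have "f i = 0" using \<delta>_exponential[of "f i" "lw + - l i"] by (metis Ints_0)
      thus ?thesis by (metis rf_const_0)
    qed
  qed
  thus ?case by metis
qed

text \<open>By \<open>reps\<close> every generalised eigenvector can be shifted to an eigenvalue in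
  \<Lambda>, so some w0 of this kind lies outside the span U of the chain. The last (D - lw)^k w0
  outside U is the new vector: D - lw maps it into U, with constant coordinates by
  \<open>gen_const_coeffs\<close>.\<close>

lemma chain_extend:
  assumes reps: "\<And>z. \<exists>k. z + of_int k \<in> \<Lambda>" and tors: "\<And>v. v \<in> LL \<Longrightarrow> tors v"
    and ch: "chain \<Lambda> m v l T" and m: "m < n"
  shows "\<exists>w lw c. chain \<Lambda> (Suc m) (v(m := w)) (l(m := lw)) (T(m := c))"
proof -
  let ?U = "kspan (v ` {..<m})"
  have span: "unitv i \<in> kspan {w. \<exists>l\<in>\<Lambda>. gen l w}" if "i < n" for i
  proof -
    have "{w. \<exists>l. gen l w} \<subseteq> kspan {w. \<exists>l\<in>\<Lambda>. gen l w}"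
    proof
      fix w assume "w \<in> {w. \<exists>l. gen l w}"
      then obtain z where z: "gen z w" by blast
      obtain k where k: "z + of_int k \<in> \<Lambda>" using reps by blast
      have "ks (rf_X powi k) w \<in> kspan {w. \<exists>l\<in>\<Lambda>. gen l w}"
        using gen_shift[OF z] k by (intro kv.span_base) blast
      hence "ks (inverse (rf_X powi k)) (ks (rf_X powi k) w) \<in> kspan {w. \<exists>l\<in>\<Lambda>. gen l w}"
        by (rule kv.span_scale)
      moreover have "rf_X powi k \<noteq> (0 :: 'c ratfun)" by (simp add: rf_X_def)
      ultimately show "w \<in> kspan {w. \<exists>l\<in>\<Lambda>. gen l w}" by (simp add: ks_ks)
    qed
    hence "kspan {w. \<exists>l. gen l w} \<subseteq> kspan {w. \<exists>l\<in>\<Lambda>. gen l w}" by (simp add: kv.span_minimal)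
    thus ?thesis using gen_span[OF tors that] by blast
  qed
  obtain w0 lw where w0: "lw \<in> \<Lambda>" "gen lw w0" "w0 \<notin> ?U" using generator_outside[OF span m, of v] by blast
  obtain N where N: "pact D ([:-lw, 1:] ^ N) w0 = 0" using w0 unfolding gen_def by blast
  have "pact D ([:-lw, 1:] ^ N) w0 \<in> ?U" "\<not> pact D ([:-lw, 1:] ^ 0) w0 \<in> ?U"
    using N w0 kv.span_zero by auto
  then obtain k where k: "pact D ([:-lw, 1:] ^ k) w0 \<notin> ?U" "pact D ([:-lw, 1:] ^ Suc k) w0 \<in> ?U"
    using nat_induct[of "\<lambda>k. pact D ([:-lw, 1:] ^ k) w0 \<notin> ?U" N] by blast
  define w where "w = pact D ([:-lw, 1:] ^ k) w0"
  have gw: "gen lw w" unfolding w_def by (rule gen_pact[OF w0(2)])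
  define y where "y = D w - sc lw w"
  have y: "y = pact D [:-lw, 1:] w" unfolding y_def pact_linear_factor ..
  have "y \<in> ?U" using k(2) unfolding y w_def power_Suc Dl.pact_mult .
  then obtain f where f: "y = (\<Sum>i<m. ks (f i) (v i))" using kspan_family by blast
  have "gen lw y" unfolding y by (rule gen_pact[OF gw])
  then obtain M where "pact D ([:-lw, 1:] ^ M) y = 0" unfolding gen_def by blast
  then obtain c where c: "\<And>i. i < m \<Longrightarrow> f i = rf_const (c i)" "\<And>i. i < m \<Longrightarrow> l i \<noteq> lw \<Longrightarrow> c i = 0"
    using gen_const_coeffs[OF ch w0(1) _ f] by blast
  let ?v = "v(m := w)" and ?l = "l(m := lw)" and ?T = "T(m := (\<lambda>j. if j < m then c j else 0))"
  have ch': "kindep v m" "\<And>i. i < m \<Longrightarrow> v i \<in> supp n" "\<And>i. i < m \<Longrightarrow> l i \<in> \<Lambda>"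
    "\<And>i j. i < m \<Longrightarrow> T i j \<noteq> 0 \<Longrightarrow> j < i \<and> l j = l i"
    "\<And>i. i < m \<Longrightarrow> D (v i) = sc (l i) (v i) + (\<Sum>j<i. sc (T i j) (v j))"
    using ch unfolding chain_def by blast+
  have "chain \<Lambda> (Suc m) ?v ?l ?T"
    unfolding chain_def
  proof (intro conjI allI impI)
    show "kindep ?v (Suc m)" using ch'(1) k(1) unfolding w_def by (rule kindep_extend)
    fix i assume i: "i < Suc m"
    show "?v i \<in> supp n" using i ch'(2) gw by (auto simp: less_Suc_eq gen_def)
    show "?l i \<in> \<Lambda>" using i ch'(3) w0 by (auto simp: less_Suc_eq)
    show "D (?v i) = sc (?l i) (?v i) + (\<Sum>j<i. sc (?T i j) (?v j))"
    proof (cases "i < m")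
      case True
      hence "(\<Sum>j<i. sc (?T i j) (?v j)) = (\<Sum>j<i. sc (T i j) (v j))" by (intro sum.cong) auto
      thus ?thesis using True ch'(5) by simp
    next
      case False
      hence "i = m" using i by simp
      moreover have "(\<Sum>j<m. sc (?T m j) (?v j)) = y"
        unfolding f using c(1) by (intro sum.cong) (auto simp: sc_def)
      ultimately show ?thesis unfolding y_def by simp
    qed
  next
    fix i j assume i: "i < Suc m" and T: "?T i j \<noteq> 0"
    have "j < i \<and> ?l j = ?l i"
    proof (cases "i < m")
      case True
      thus ?thesis using ch'(4)[OF True, of j] T by auto
    next
      case False
      hence "i = m" using i by simp
      thus ?thesis using T c(2) by (auto split: if_splits)
    qed
    thus "j < i" "?l j = ?l i" by auto
  qed
  thus ?thesis by blast
qed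

lemma chain_exists:
  assumes reps: "\<And>z. \<exists>k. z + of_int k \<in> \<Lambda>" and tors: "\<And>v. v \<in> LL \<Longrightarrow> tors v" and m: "m \<le> n"
  shows "\<exists>v l T. chain \<Lambda> m v l T"
  using m
proof (induction m)
  case 0
  show ?case by (simp add: chain_def kindep_def)
next
  case (Suc m)
  then obtain v l T where "chain \<Lambda> m v l T" using Suc_leD by blast
  moreover have "m < n" using Suc.prems by simp
  ultimately show ?case using chain_extend[OF reps tors] by metis
qed

end

lemma basis_case_QM:
  fixes \<Lambda> :: "'c set"
  assumes nonres: "\<And>x y. x \<in> \<Lambda> \<Longrightarrow> y \<in> \<Lambda> \<Longrightarrow> x - y \<in> \<int> \<Longrightarrow> x = y"
    and reps: "\<And>z. \<exists>k. z + of_int k \<in> \<Lambda>" and tors: "\<And>v. v \<in> LL \<Longrightarrow> tors v"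
  shows "\<exists>v l T. kindep v n \<and> (\<forall>i<n. v i \<in> supp n) \<and> (\<forall>i<n. l i \<in> \<Lambda>) \<and>
    (\<forall>i<n. \<forall>j. T i j \<noteq> 0 \<longrightarrow> j < i \<and> l j = l i) \<and>
    (\<forall>i<n. D (v i) = sc (l i) (v i) + (\<Sum>j<n. sc (T i j) (v j)))"
proof -
  obtain v l T where ch: "chain \<Lambda> n v l T"
    using chain_exists[OF nonres reps tors order_refl] by blast
  have T: "\<And>i j. i < n \<Longrightarrow> T i j \<noteq> 0 \<Longrightarrow> j < i \<and> l j = l i"
    and Dv: "\<And>i. i < n \<Longrightarrow> D (v i) = sc (l i) (v i) + (\<Sum>j<i. sc (T i j) (v j))"
    using ch unfolding chain_def by blast+
  have "\<forall>i<n. D (v i) = sc (l i) (v i) + (\<Sum>j<n. sc (T i j) (v j))"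
  proof (intro allI impI)
    fix i assume i: "i < n"
    have "(\<Sum>j<i. sc (T i j) (v j)) = (\<Sum>j<n. sc (T i j) (v j))"
      using T[OF i] by (intro triangular_sum[OF i]) blast
    thus "D (v i) = sc (l i) (v i) + (\<Sum>j<n. sc (T i j) (v j))" using Dv[OF i] by simp
  qed
  thus ?thesis using ch unfolding chain_def
    by (intro exI[of _ v] exI[of _ l] exI[of _ T]) blast
qed

end

end

section \<open>Gauge transformations\<close>

lemma mult_mat_entry:
  "M \<in> carrier_mat n n \<Longrightarrow> N \<in> carrier_mat n n \<Longrightarrow> i < n \<Longrightarrow> j < n \<Longrightarrow>
    (M * N) $$ (i, j) = (\<Sum>k<n. M $$ (i, k) * N $$ (k, j))"
  by (simp add: scalar_prod_def atLeast0LessThan)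

text \<open>Differentiating N M = 1 gives \<delta>(N) = - N \<delta>(M) N. The rule serves for the
  inverses of B, of the frame V and of the matrix P of \<Phi>.\<close>

lemma derivation_inverse_mat:
  fixes \<delta> :: "'a::field \<Rightarrow> 'a"
  assumes add: "\<And>f g. \<delta> (f + g) = \<delta> f + \<delta> g" and mult: "\<And>f g. \<delta> (f * g) = \<delta> f * g + f * \<delta> g"
    and M: "M \<in> carrier_mat n n" and N: "N \<in> carrier_mat n n"
    and X: "X \<in> carrier_mat n n" and Y: "Y \<in> carrier_mat n n"
    and MN: "M * N = 1\<^sub>m n" "N * M = 1\<^sub>m n"
    and \<delta>M: "map_mat \<delta> M = X * M - M * Y"
  shows "map_mat \<delta> N = Y * N - N * X"
proof -
  have \<delta>0: "\<delta> 0 = 0" using add[of 0 0] by (metis add.right_neutral add_left_cancel)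
  have \<delta>1: "\<delta> 1 = 0" using mult[of 1 1] by (metis add.right_neutral add_left_cancel mult_1 mult_1_right)
  have \<delta>sum: "\<delta> (sum f S) = (\<Sum>i\<in>S. \<delta> (f i))" for f :: "nat \<Rightarrow> 'a" and S
    by (induction S rule: infinite_finite_induct) (auto simp: \<delta>0 add)
  have leib: "map_mat \<delta> (N * M) = map_mat \<delta> N * M + N * map_mat \<delta> M"
  proof (rule eq_matI)
    fix i j assume "i < dim_row (map_mat \<delta> N * M + N * map_mat \<delta> M)"
      "j < dim_col (map_mat \<delta> N * M + N * map_mat \<delta> M)"
    hence ij: "i < n" "j < n" using M N by auto
    have d: "map_mat \<delta> N \<in> carrier_mat n n" "map_mat \<delta> M \<in> carrier_mat n n" using M N by auto
    have "map_mat \<delta> (N * M) $$ (i, j) = \<delta> ((N * M) $$ (i, j))" using ij M N by simp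
    also have "\<dots> = (\<Sum>k<n. \<delta> (N $$ (i, k)) * M $$ (k, j)) + (\<Sum>k<n. N $$ (i, k) * \<delta> (M $$ (k, j)))"
      by (simp only: mult_mat_entry[OF N M ij] \<delta>sum mult sum.distrib)
    also have "(\<Sum>k<n. \<delta> (N $$ (i, k)) * M $$ (k, j)) = (map_mat \<delta> N * M) $$ (i, j)"
      unfolding mult_mat_entry[OF d(1) M ij] using ij N by (intro sum.cong) auto
    also have "(\<Sum>k<n. N $$ (i, k) * \<delta> (M $$ (k, j))) = (N * map_mat \<delta> M) $$ (i, j)"
      unfolding mult_mat_entry[OF N d(2) ij] using ij M by (intro sum.cong) auto
    finally show "map_mat \<delta> (N * M) $$ (i, j) = (map_mat \<delta> N * M + N * map_mat \<delta> M) $$ (i, j)"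
      using ij M N by simp
  qed (use M N in auto)
  have "map_mat \<delta> (N * M) = 0\<^sub>m n n" unfolding MN by (rule eq_matI) (auto simp: \<delta>0 \<delta>1)
  hence e1: "map_mat \<delta> N * M + N * map_mat \<delta> M = 0\<^sub>m n n" unfolding leib .
  have dN: "map_mat \<delta> N \<in> carrier_mat n n" using N by simp
  have NX: "N * X \<in> carrier_mat n n" using N X by simp
  have "N * map_mat \<delta> M = N * (X * M) - N * (M * Y)"
    unfolding \<delta>M using M N X Y by (intro mult_minus_distrib_mat) auto
  also have "N * (X * M) = N * X * M" using assoc_mult_mat[OF N X M] ..
  also have "N * (M * Y) = N * M * Y" using assoc_mult_mat[OF N M Y] ..
  also have "\<dots> = Y" unfolding MN using Y by simp
  finally have e2: "map_mat \<delta> N * M + (N * X * M - Y) = 0\<^sub>m n n" using e1 by simp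
  have e3: "map_mat \<delta> N * M = Y - N * X * M"
  proof (rule eq_matI)
    fix i j assume "i < dim_row (Y - N * X * M)" "j < dim_col (Y - N * X * M)"
    hence ij: "i < n" "j < n" using M N X by auto
    have c: "map_mat \<delta> N * M \<in> carrier_mat n n" "N * X * M \<in> carrier_mat n n" using M dN NX by auto
    have "(map_mat \<delta> N * M + (N * X * M - Y)) $$ (i, j) = 0" unfolding e2 using ij by simp
    thus "(map_mat \<delta> N * M) $$ (i, j) = (Y - N * X * M) $$ (i, j)"
      using ij c M N X Y by (simp add: algebra_simps del: index_mult_mat(1))
  qed (use M N X Y in auto)
  have "map_mat \<delta> N = map_mat \<delta> N * (M * N)" unfolding MN using dN by simp
  also have "\<dots> = map_mat \<delta> N * M * N" using assoc_mult_mat[OF dN M N] ..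
  also have "\<dots> = Y * N - N * X * M * N"
    unfolding e3 using M N NX Y by (intro minus_mult_distrib_mat) auto
  also have "N * X * M * N = N * X"
    unfolding assoc_mult_mat[OF NX M N] MN by (rule right_mult_one_mat[OF NX])
  finally show ?thesis .
qed

lemma cancel_left_mat:
  fixes M :: "'a::semiring_1 mat"
  assumes "M \<in> carrier_mat n n" "N \<in> carrier_mat n n" "Z \<in> carrier_mat n n" "M * N = 1\<^sub>m n"
  shows "M * (N * Z) = Z"
  using assoc_mult_mat[OF assms(1-3)] unfolding assms(4) left_mult_one_mat[OF assms(3)] ..

context system_cases
begin

lemma frame_inverse:
  assumes ind: "kindep v n" and vs: "\<And>i. i < n \<Longrightarrow> v i \<in> supp n"
  shows "\<exists>W \<in> carrier_mat n n. mat n n (\<lambda>(i, j). v j i) * W = 1\<^sub>m n"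
proof -
  have "\<exists>f. unitv j = (\<Sum>k<n. ks (f k) (v k))" if j: "j < n" for j
  proof (rule kspan_family, rule ccontr)
    assume "unitv j \<notin> kspan (v ` {..<n})"
    hence "kindep (v(n := unitv j)) (Suc n)" by (rule kindep_extend[OF ind])
    moreover have "unitv j \<in> supp n" using j by (auto simp: unitv_def supp_def)
    ultimately have "Suc n \<le> n" using vs by (intro kindep_bound[of "v(n := unitv j)"]) (auto simp: less_Suc_eq)
    thus False by simp
  qed
  then obtain f where f: "\<And>j. j < n \<Longrightarrow> unitv j = (\<Sum>k<n. ks (f j k) (v k))" by metis
  let ?V = "mat n n (\<lambda>(i, j). v j i)" and ?W = "mat n n (\<lambda>(k, j). f j k)"
  have "?V * ?W = 1\<^sub>m n"
  proof (rule eq_matI)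
    fix i j assume "i < dim_row (1\<^sub>m n)" "j < dim_col (1\<^sub>m n)"
    hence ij: "i < n" "j < n" by auto
    have "(?V * ?W) $$ (i, j) = (\<Sum>k<n. v k i * f j k)"
      using ij by (subst mult_mat_entry[of _ n]) auto
    also have "\<dots> = unitv j i" unfolding f[OF ij(2)] by (simp add: sum_fun_app ks_def mult.commute)
    finally show "(?V * ?W) $$ (i, j) = 1\<^sub>m n $$ (i, j)" using ij by (simp add: unitv_def)
  qed auto
  thus ?thesis by (intro bexI[of _ ?W]) auto
qed

text \<open>The columns of V are the v_j, so \<open>Dv\<close> reads \<delta>(V) = A V + V M, and
  the gauge matrix W = V^-1 turns A into - M; hence the sign in A'. The matrix of \<Phi> in this
  basis is P = W B^-1 \<sigma>(V), the inverse of the new B' = \<sigma>(W) B V.\<close>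

lemma gauge_reduction:
  assumes mats: "A \<in> carrier_mat n n" "B \<in> carrier_mat n n" "Bi \<in> carrier_mat n n"
    and inv: "B * Bi = 1\<^sub>m n" "Bi * B = 1\<^sub>m n"
    and ab: "\<And>i j. a i j = A $$ (i, j)" "\<And>i j. bi i j = Bi $$ (i, j)"
    and ind: "kindep v n" and vs: "\<And>i. i < n \<Longrightarrow> v i \<in> supp n"
    and Dv: "\<And>j. j < n \<Longrightarrow> D (v j) = (\<Sum>k<n. sc (M k j) (v k))"
    and A': "A' = mat n n (\<lambda>(i, j). - M i j)"
  obtains B' P where "B' \<in> carrier_mat n n" "P \<in> carrier_mat n n" "B' * P = 1\<^sub>m n" "P * B' = 1\<^sub>m n"
    "gauge_equivalent \<delta> \<sigma> n A B (map_mat rf_const A') B'"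
    "map_mat \<delta> P = map_mat rf_const A' * P - P * map_mat rf_const (of_nat \<mu> \<cdot>\<^sub>m A')"
    "map_mat \<delta> B' = map_mat rf_const (of_nat \<mu> \<cdot>\<^sub>m A') * B' - B' * map_mat rf_const A'"
    "\<And>j. j < n \<Longrightarrow> Ph (v j) = (\<Sum>k<n. ks (P $$ (k, j)) (v k))"
proof -
  define V where "V = mat n n (\<lambda>(i, j). v j i)"
  have V: "V \<in> carrier_mat n n" by (simp add: V_def)
  obtain W where W: "W \<in> carrier_mat n n" and VW: "V * W = 1\<^sub>m n"
    using frame_inverse[OF ind vs] unfolding V_def by blast
  have WV: "W * V = 1\<^sub>m n" using V W VW by (rule mat_mult_left_right_inverse)
  let ?A' = "map_mat rf_const A'" and ?\<sigma>V = "map_mat \<sigma> V" and ?\<sigma>W = "map_mat \<sigma> W"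
  have A'c: "?A' \<in> carrier_mat n n" by (simp add: A')
  have \<sigma>V: "?\<sigma>V \<in> carrier_mat n n" and \<sigma>W: "?\<sigma>W \<in> carrier_mat n n" using V W by auto
  have \<delta>V: "map_mat \<delta> V = A * V - V * ?A'"
  proof (rule eq_matI)
    fix i j assume "i < dim_row (A * V - V * ?A')" "j < dim_col (A * V - V * ?A')"
    hence ij: "i < n" "j < n" using V A'c by auto
    have "\<delta> (v j i) - (\<Sum>k<n. a i k * v j k) = D (v j) i" using ij by (simp add: D_def)
    also have "\<dots> = (\<Sum>k<n. sc (M k j) (v k)) i" unfolding Dv[OF ij(2)] ..
    also have "\<dots> = - (\<Sum>k<n. v k i * rf_const (- M k j))"
      by (simp add: sum_fun_app sc_def ks_def rf_const_minus sum_negf mult.commute)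
    also have "(\<Sum>k<n. v k i * rf_const (- M k j)) = (V * ?A') $$ (i, j)"
      unfolding mult_mat_entry[OF V A'c ij] using ij by (intro sum.cong) (auto simp: V_def A')
    also have "(\<Sum>k<n. a i k * v j k) = (A * V) $$ (i, j)"
      unfolding mult_mat_entry[OF mats(1) V ij] using ij by (intro sum.cong) (auto simp: V_def ab)
    finally show "map_mat \<delta> V $$ (i, j) = (A * V - V * ?A') $$ (i, j)"
      using ij mats V A'c by (simp add: V_def algebra_simps del: index_mult_mat(1))
  qed (use mats V A'c in auto)
  have \<delta>W: "map_mat \<delta> W = ?A' * W - W * A"
    by (rule derivation_inverse_mat[OF \<delta>_add \<delta>_mult V W mats(1) A'c VW WV \<delta>V])
  have \<sigma>VW: "?\<sigma>V * ?\<sigma>W = 1\<^sub>m n" "?\<sigma>W * ?\<sigma>V = 1\<^sub>m n"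
  proof -
    have \<sigma>h: "map_mat \<sigma> (M * N) = map_mat \<sigma> M * map_mat \<sigma> N"
      if "M \<in> carrier_mat n n" "N \<in> carrier_mat n n" for M N
    proof (rule eq_matI)
      fix i j assume "i < dim_row (map_mat \<sigma> M * map_mat \<sigma> N)" "j < dim_col (map_mat \<sigma> M * map_mat \<sigma> N)"
      hence ij: "i < n" "j < n" using that by auto
      have c: "map_mat \<sigma> M \<in> carrier_mat n n" "map_mat \<sigma> N \<in> carrier_mat n n" using that by auto
      show "map_mat \<sigma> (M * N) $$ (i, j) = (map_mat \<sigma> M * map_mat \<sigma> N) $$ (i, j)"
        unfolding mult_mat_entry[OF c ij] using ij that
        by (simp add: mult_mat_entry[OF that ij] \<sigma>_sum \<sigma>_mult del: index_mult_mat(1))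
    qed (use that in auto)
    have 1: "map_mat \<sigma> (1\<^sub>m n) = 1\<^sub>m n" by (rule eq_matI) auto
    show "?\<sigma>V * ?\<sigma>W = 1\<^sub>m n" "?\<sigma>W * ?\<sigma>V = 1\<^sub>m n"
      using \<sigma>h[OF V W] \<sigma>h[OF W V] VW WV 1 by auto
  qed
  define P where "P = W * (Bi * ?\<sigma>V)"
  define B' where "B' = ?\<sigma>W * B * V"
  have P: "P \<in> carrier_mat n n" and B': "B' \<in> carrier_mat n n"
    using W V \<sigma>V \<sigma>W mats by (auto simp: P_def B'_def)
  have B'P: "B' * P = 1\<^sub>m n"
  proof -
    have BiV: "Bi * ?\<sigma>V \<in> carrier_mat n n" using mats \<sigma>V by simp
    have WB: "?\<sigma>W * B \<in> carrier_mat n n" using mats \<sigma>W by simp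
    have "B' * P = ?\<sigma>W * B * (V * (W * (Bi * ?\<sigma>V)))"
      unfolding B'_def P_def by (rule assoc_mult_mat[OF WB V mult_carrier_mat[OF W BiV]])
    also have "V * (W * (Bi * ?\<sigma>V)) = Bi * ?\<sigma>V"
      by (rule cancel_left_mat[OF V W BiV VW])
    also have "?\<sigma>W * B * (Bi * ?\<sigma>V) = ?\<sigma>W * (B * (Bi * ?\<sigma>V))"
      by (rule assoc_mult_mat[OF \<sigma>W mats(2) BiV])
    also have "B * (Bi * ?\<sigma>V) = ?\<sigma>V" by (rule cancel_left_mat[OF mats(2,3) \<sigma>V inv(1)])
    finally show ?thesis using \<sigma>VW by simp
  qed
  have PB': "P * B' = 1\<^sub>m n" using B' P B'P by (rule mat_mult_left_right_inverse)
  have PhP: "Ph (v j) = (\<Sum>k<n. ks (P $$ (k, j)) (v k))" if j: "j < n" for j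
  proof
    fix i
    show "Ph (v j) i = (\<Sum>k<n. ks (P $$ (k, j)) (v k)) i"
    proof (cases "i < n")
      case True
      have BiV: "Bi * ?\<sigma>V \<in> carrier_mat n n" using mats \<sigma>V by simp
      have "Ph (v j) i = (Bi * ?\<sigma>V) $$ (i, j)"
        unfolding mult_mat_entry[OF mats(3) \<sigma>V True j] using True j by (simp add: Ph_def ab V_def)
      also have "Bi * ?\<sigma>V = V * P"
        unfolding P_def by (rule cancel_left_mat[OF V W BiV VW, symmetric])
      also have "(V * P) $$ (i, j) = (\<Sum>k<n. ks (P $$ (k, j)) (v k)) i"
        unfolding mult_mat_entry[OF V P True j] sum_fun_app
        using True by (intro sum.cong) (auto simp: ks_def V_def mult.commute)
      finally show ?thesis .
    next
      case False
      have "(\<Sum>k<n. ks (P $$ (k, j)) (v k)) \<in> supp n" using vs by (intro supp_sum supp_ks) auto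
      thus ?thesis using False Ph_supp[of "v j"] by (simp add: supp_def)
    qed
  qed
  have \<mu>A': "map_mat rf_const (of_nat \<mu> \<cdot>\<^sub>m A') \<in> carrier_mat n n" by (simp add: A')
  \<comment> \<open>The coordinates of D (\<Phi> v_j) are computed twice: by applying D to the
    expansion of \<Phi> v_j, and from D \<Phi> = \<mu> \<Phi> D.\<close>
  have \<delta>P: "map_mat \<delta> P = ?A' * P - P * map_mat rf_const (of_nat \<mu> \<cdot>\<^sub>m A')"
  proof (rule eq_matI)
    fix i j assume "i < dim_row (?A' * P - P * map_mat rf_const (of_nat \<mu> \<cdot>\<^sub>m A'))"
      "j < dim_col (?A' * P - P * map_mat rf_const (of_nat \<mu> \<cdot>\<^sub>m A'))"
    hence ij: "i < n" "j < n" using P by (auto simp: A')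
    let ?p = "\<lambda>i j. P $$ (i, j)"
    have "(\<Sum>i<n. ks (\<delta> (?p i j) + (\<Sum>k<n. ?p k j * rf_const (M i k))) (v i))
        = (\<Sum>i<n. ks (\<delta> (?p i j)) (v i)) + (\<Sum>k<n. ks (?p k j) (D (v k)))"
    proof -
      have "(\<Sum>k<n. ks (?p k j) (D (v k))) = (\<Sum>k<n. \<Sum>i<n. ks (?p k j * rf_const (M i k)) (v i))"
        using Dv by (simp add: ks_sum sc_def ks_ks)
      also have "\<dots> = (\<Sum>i<n. ks (\<Sum>k<n. ?p k j * rf_const (M i k)) (v i))"
        by (subst sum.swap) (simp add: kv.scale_sum_left)
      finally show ?thesis by (simp add: kv.scale_left_distrib sum.distrib)
    qed
    also have "\<dots> = D (Ph (v j))" unfolding PhP[OF ij(2)] using vs by (subst sum_ks_D) auto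
    also have "\<dots> = (\<Sum>k<n. ks (of_nat \<mu> * rf_const (M k j)) (Ph (v k)))"
      unfolding D_Ph Dv[OF ij(2)] Phl.T_sum Ph_sc ks_sum by (simp add: sc_def ks_ks)
    also have "\<dots> = (\<Sum>k<n. \<Sum>i<n. ks (of_nat \<mu> * rf_const (M k j) * ?p i k) (v i))"
      using PhP by (simp add: ks_sum ks_ks)
    also have "\<dots> = (\<Sum>i<n. ks (\<Sum>k<n. of_nat \<mu> * rf_const (M k j) * ?p i k) (v i))"
      by (subst sum.swap) (simp add: kv.scale_sum_left)
    finally have "(\<Sum>i<n. ks ((\<delta> (?p i j) + (\<Sum>k<n. ?p k j * rf_const (M i k)))
        - (\<Sum>k<n. of_nat \<mu> * rf_const (M k j) * ?p i k)) (v i)) = 0"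
      by (simp add: kv.scale_left_diff_distrib sum_subtractf)
    hence "(\<delta> (?p i j) + (\<Sum>k<n. ?p k j * rf_const (M i k)))
        - (\<Sum>k<n. of_nat \<mu> * rf_const (M k j) * ?p i k) = 0"
      using ind[unfolded kindep_def, rule_format, of "\<lambda>i. (\<delta> (?p i j) + (\<Sum>k<n. ?p k j * rf_const (M i k)))
        - (\<Sum>k<n. of_nat \<mu> * rf_const (M k j) * ?p i k)" i] ij by blast
    hence "\<delta> (?p i j) = (\<Sum>k<n. rf_const (- M i k) * ?p k j)
        - (\<Sum>k<n. ?p i k * rf_const (of_nat \<mu> * - M k j))"
      by (simp add: rf_const_minus rf_const_mult rf_const_of_nat sum_negf algebra_simps)
    also have "(\<Sum>k<n. rf_const (- M i k) * ?p k j) = (?A' * P) $$ (i, j)"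
      unfolding mult_mat_entry[OF A'c P ij] using ij by (intro sum.cong) (auto simp: A')
    also have "(\<Sum>k<n. ?p i k * rf_const (of_nat \<mu> * - M k j))
        = (P * map_mat rf_const (of_nat \<mu> \<cdot>\<^sub>m A')) $$ (i, j)"
      unfolding mult_mat_entry[OF P \<mu>A' ij] using ij by (intro sum.cong) (auto simp: A')
    finally show "map_mat \<delta> P $$ (i, j) = (?A' * P - P * map_mat rf_const (of_nat \<mu> \<cdot>\<^sub>m A')) $$ (i, j)"
      using ij P \<mu>A' by (simp add: A' del: index_mult_mat(1))
  qed (use P in \<open>auto simp: A'\<close>)
  have \<delta>B': "map_mat \<delta> B' = map_mat rf_const (of_nat \<mu> \<cdot>\<^sub>m A') * B' - B' * ?A'"
    by (rule derivation_inverse_mat[OF \<delta>_add \<delta>_mult P B' A'c \<mu>A' PB' B'P \<delta>P])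
  have "?A' = map_mat \<delta> W * V + W * A * V"
  proof -
    have WA: "W * A \<in> carrier_mat n n" using W mats by simp
    have "map_mat \<delta> W * V = ?A' * W * V - W * A * V"
      unfolding \<delta>W using W WA V A'c by (intro minus_mult_distrib_mat) auto
    also have "?A' * W * V = ?A'" unfolding assoc_mult_mat[OF A'c W V] WV using A'c by simp
    finally have "map_mat \<delta> W * V + W * A * V = (?A' - W * A * V) + W * A * V" by simp
    also have "\<dots> = ?A'" using A'c WA V by (intro eq_matI) auto
    finally show ?thesis ..
  qed
  hence g: "gauge_equivalent \<delta> \<sigma> n A B ?A' B'"
    unfolding gauge_equivalent_def B'_def using V W VW WV by blast
  show ?thesis by (rule that[OF B' P B'P PB' g \<delta>P \<delta>B' PhP])
qed

end

section \<open>The locale assumptions in the three cases\<close>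

lemma system_cases_matrix:
  fixes A B Bi :: "'c::{alg_closed_field, field_char_0} ratfun mat"
  assumes u: "u = 1 \<or> u = [:0, 1:]"
    and \<delta>: "\<delta> = (\<lambda>f. to_fract u * rf_deriv f)"
    and \<sigma>: "\<sigma> = rf_subst s" and s: "degree s > 0"
    and \<delta>\<sigma>: "\<And>f. \<delta> (\<sigma> f) = of_nat \<mu> * \<sigma> (\<delta> f)" and \<mu>: "\<mu> > 0"
    and us: "\<exists>w k. pcompose u s * w = u ^ k"
    and sep: "\<And>h. h \<noteq> 0 \<Longrightarrow> \<exists>m. \<forall>z. poly h z = 0 \<longrightarrow> poly u z \<noteq> 0 \<longrightarrow>
        (\<exists>y. poly (((\<lambda>p. pcompose p s) ^^ m) [:0, 1:]) y = z \<and> poly h y \<noteq> 0 \<and> poly u y \<noteq> 0)"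
    and A: "A \<in> carrier_mat n n" and B: "B \<in> carrier_mat n n" and Bi: "Bi \<in> carrier_mat n n"
    and inv: "B * Bi = 1\<^sub>m n" "Bi * B = 1\<^sub>m n"
    and cons: "consistent \<delta> \<sigma> \<mu> A B"
  shows "system_cases \<delta> \<sigma> u s \<mu> n (\<lambda>i j. A $$ (i, j)) (\<lambda>i j. B $$ (i, j)) (\<lambda>i j. Bi $$ (i, j))"
proof
  let ?S = "of_nat \<mu> \<cdot>\<^sub>m map_mat \<sigma> A"
  have S: "?S \<in> carrier_mat n n" using A by simp
  have \<sigma>A: "map_mat \<sigma> A \<in> carrier_mat n n" using A by simp
  have "of_nat \<mu> \<cdot>\<^sub>m (map_mat \<sigma> A * B) = ?S * B" using mult_smult_assoc_mat[OF \<sigma>A B] ..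
  hence \<delta>B: "map_mat \<delta> B = ?S * B - B * A" using cons unfolding consistent_def by simp
  have add: "\<delta> (f + g) = \<delta> f + \<delta> g" and mult: "\<delta> (f * g) = \<delta> f * g + f * \<delta> g" for f g
    by (simp_all add: \<delta> rf_deriv_add rf_deriv_mult algebra_simps)
  have \<delta>Bi: "map_mat \<delta> Bi = A * Bi - Bi * ?S"
    by (rule derivation_inverse_mat[OF add mult B Bi S A inv \<delta>B])
  fix i j assume ij: "i < n" "j < n"
  show "(\<Sum>k<n. B $$ (i, k) * Bi $$ (k, j)) = (if i = j then 1 else 0)"
    unfolding mult_mat_entry[OF B Bi ij, symmetric] inv using ij by simp
  have "\<delta> (Bi $$ (i, j)) = (A * Bi) $$ (i, j) - (Bi * ?S) $$ (i, j)"
    using arg_cong[OF \<delta>Bi, of "\<lambda>M. M $$ (i, j)"] ij A Bi S by (simp del: index_mult_mat(1))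
  also have "(Bi * ?S) $$ (i, j) = of_nat \<mu> * (\<Sum>k<n. Bi $$ (i, k) * \<sigma> (A $$ (k, j)))"
    unfolding mult_mat_entry[OF Bi S ij] sum_distrib_left
    using ij A by (intro sum.cong) (auto simp: ac_simps)
  also have "(A * Bi) $$ (i, j) = (\<Sum>k<n. A $$ (i, k) * Bi $$ (k, j))"
    by (rule mult_mat_entry[OF A Bi ij])
  finally show "\<delta> (Bi $$ (i, j)) = (\<Sum>k<n. A $$ (i, k) * Bi $$ (k, j)) -
      of_nat \<mu> * (\<Sum>k<n. Bi $$ (i, k) * \<sigma> (A $$ (k, j)))" .
qed (use assms in auto)

lemma subst_pow_S: "((\<lambda>p. pcompose p [:1, 1:]) ^^ m) [:0, 1:] = [:of_nat m, 1::'c::field:]"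
  by (induction m) (auto simp: pcompose_pCons)

lemma subst_pow_Q: "((\<lambda>p. pcompose p [:0, q:]) ^^ m) [:0, 1:] = [:0, (q::'c::field) ^ m:]"
  by (induction m) (auto simp: pcompose_pCons)

lemma subst_pow_M: "((\<lambda>p. pcompose p (monom 1 q)) ^^ m) [:0, 1:] = monom (1::'c::field) (q ^ m)"
proof (induction m)
  case 0
  show ?case by (simp add: monom_Suc monom_0)
next
  case (Suc m)
  have m: "pcompose (monom 1 i) (monom 1 q) = monom (1::'c) (i * q)" for i
    by (induction i) (auto simp: monom_0 monom_Suc pcompose_pCons mult_monom)
  show ?case by (simp add: Suc m mult.commute)
qed

lemma finite_at_most_one: "(\<And>x y. x \<in> S \<Longrightarrow> y \<in> S \<Longrightarrow> x = y) \<Longrightarrow> finite S"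
  by (metis finite.simps insertI1 is_singletonI' is_singleton_def)

text \<open>A pair (z, w) of zeros of h excludes at most one m, the one with f m z = w. Finitely
  many pairs leave some m.\<close>

lemma separating_iterate:
  fixes h :: "'c::field poly" and f :: "nat \<Rightarrow> 'c \<Rightarrow> 'c"
  assumes h: "h \<noteq> 0" and inj: "\<And>z m m'. Q z \<Longrightarrow> f m z = f m' z \<Longrightarrow> m = m'"
  shows "\<exists>m. \<forall>z. poly h z = 0 \<longrightarrow> Q z \<longrightarrow> poly h (f m z) \<noteq> 0"
proof -
  let ?Z = "{z. poly h z = 0}"
  have "finite {m. f m z = w}" if "Q z" for z w
    using inj[OF that] by (intro finite_at_most_one) auto
  moreover have "finite ?Z" using h by (rule poly_roots_finite)
  ultimately have "finite (\<Union>z\<in>{z\<in>?Z. Q z}. \<Union>w\<in>?Z. {m. f m z = w})" by auto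
  then obtain m where "m \<notin> (\<Union>z\<in>{z\<in>?Z. Q z}. \<Union>w\<in>?Z. {m. f m z = w})"
    using ex_new_if_finite infinite_UNIV_nat by blast
  thus ?thesis by auto
qed

lemma separating_S:
  fixes h :: "'c::field_char_0 poly"
  assumes "h \<noteq> 0"
  shows "\<exists>m. \<forall>z. poly h z = 0 \<longrightarrow> poly 1 z \<noteq> 0 \<longrightarrow>
    (\<exists>y. poly (((\<lambda>p. pcompose p [:1, 1:]) ^^ m) [:0, 1:]) y = z \<and> poly h y \<noteq> 0 \<and> poly 1 y \<noteq> 0)"
proof -
  obtain m where m: "\<And>z. poly h z = 0 \<Longrightarrow> poly h (z - of_nat m) \<noteq> 0"
    using separating_iterate[OF assms, of "\<lambda>_. True" "\<lambda>m z. z - of_nat m"] by auto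
  show ?thesis unfolding subst_pow_S
  proof (intro exI[of _ m] allI impI)
    fix z assume "poly h z = 0"
    thus "\<exists>y. poly [:of_nat m, 1:] y = z \<and> poly h y \<noteq> 0 \<and> poly 1 y \<noteq> 0"
      using m by (intro exI[of _ "z - of_nat m"]) auto
  qed
qed

lemma separating_Q:
  fixes h :: "'c::field poly"
  assumes h: "h \<noteq> 0" and q: "q \<noteq> 0" "\<And>m::nat. m > 0 \<Longrightarrow> q ^ m \<noteq> 1"
  shows "\<exists>m. \<forall>z. poly h z = 0 \<longrightarrow> poly [:0, 1:] z \<noteq> 0 \<longrightarrow>
    (\<exists>y. poly (((\<lambda>p. pcompose p [:0, q:]) ^^ m) [:0, 1:]) y = z \<and> poly h y \<noteq> 0 \<and> poly [:0, 1:] y \<noteq> 0)"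
proof -
  have inj: "m = m'" if "z \<noteq> 0" "z / q ^ m = z / q ^ m'" for z and m m' :: nat
  proof -
    have e: "q ^ m = q ^ m'" using that q(1) by (simp add: field_simps)
    have False if "k < k'" "q ^ k = q ^ k'" for k k' :: nat
    proof -
      have "q ^ k' = q ^ k * q ^ (k' - k)" using that(1) by (simp flip: power_add)
      hence "q ^ (k' - k) = 1" using that(2) q(1) by simp
      thus False using q(2)[of "k' - k"] that(1) by simp
    qed
    thus ?thesis using e by (metis nat_neq_iff)
  qed
  obtain m where m: "\<And>z. poly h z = 0 \<Longrightarrow> z \<noteq> 0 \<Longrightarrow> poly h (z / q ^ m) \<noteq> 0"
    using separating_iterate[OF h, of "\<lambda>z. z \<noteq> 0" "\<lambda>m z. z / q ^ m"] inj by blast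
  show ?thesis unfolding subst_pow_Q
  proof (intro exI[of _ m] allI impI)
    fix z assume "poly h z = 0" "poly [:0, 1:] z \<noteq> 0"
    thus "\<exists>y. poly [:0, q ^ m:] y = z \<and> poly h y \<noteq> 0 \<and> poly [:0, 1:] y \<noteq> 0"
      using m q by (intro exI[of _ "z / q ^ m"]) auto
  qed
qed

text \<open>A nonzero \<open>z\<close> has \<open>q\<^sup>m\<close> distinct \<open>q\<^sup>m\<close>-th roots, more than \<open>h\<close> has zeros.\<close>
lemma separating_M:
  fixes h :: "'c::{alg_closed_field, field_char_0} poly"
  assumes h: "h \<noteq> 0" and q: "q \<ge> 2"
  shows "\<exists>m. \<forall>z. poly h z = 0 \<longrightarrow> poly [:0, 1:] z \<noteq> 0 \<longrightarrow>
    (\<exists>y. poly (((\<lambda>p. pcompose p (monom 1 q)) ^^ m) [:0, 1:]) y = z \<and> poly h y \<noteq> 0 \<and> poly [:0, 1:] y \<noteq> 0)"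
  unfolding subst_pow_M
proof (intro exI[of _ "degree h"] allI impI)
  fix z :: 'c assume z: "poly [:0, 1:] z \<noteq> 0"
  define Q where "Q = q ^ degree h"
  have "degree h < 2 ^ degree h" by (rule less_exp)
  also have "\<dots> \<le> Q" unfolding Q_def using q by (intro power_mono) auto
  finally have Q: "degree h < Q" .
  define p where "p = monom (1::'c) Q - [:z:]"
  have dp: "degree p = Q" unfolding p_def using Q
    by (subst diff_conv_add_uminus, subst degree_add_eq_left) (auto simp: degree_monom_eq)
  hence p: "p \<noteq> 0" using Q by auto
  show "\<exists>y. poly (monom 1 (q ^ degree h)) y = z \<and> poly h y \<noteq> 0 \<and> poly [:0, 1:] y \<noteq> 0"
  proof (rule ccontr)
    assume neg: "\<not> ?thesis"
    have "p dvd h"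
    proof (rule dvd_of_order_le[OF h _ p])
      fix y assume y: "poly p y = 0"
      hence yQ: "y ^ Q = z" by (simp add: p_def poly_monom)
      hence "y \<noteq> 0" using z Q by (auto simp: power_0_left)
      hence "poly h y = 0" using neg yQ by (auto simp: Q_def poly_monom)
      hence "order y h \<ge> 1" using h by (simp add: order_gt_0_iff Suc_le_eq)
      \<comment> \<open>The zeros of x^Q - z are simple, because its derivative vanishes at 0
        only.\<close>
      moreover have "order y p \<le> 1"
      proof (rule ccontr)
        assume "\<not> order y p \<le> 1"
        hence "[:-y, 1:] ^ 2 dvd p" by (intro power_le_dvd[OF order_1]) simp
        then obtain r where r: "p = [:-y, 1:] ^ 2 * r" by (elim dvdE)
        have "poly (pderiv p) y = 0" unfolding r power2_eq_square by (simp add: pderiv_mult del: mult_pCons_left mult_pCons_right)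
        moreover have "pderiv p = monom (of_nat Q) (Q - 1)" by (simp add: p_def pderiv_diff pderiv_monom pderiv_pCons)
        ultimately show False using \<open>y \<noteq> 0\<close> Q by (simp add: poly_monom)
      qed
      ultimately show "order y p \<le> order y h" by simp
    qed
    hence "Q \<le> degree h" using dvd_imp_degree_le[OF _ h] dp by metis
    thus False using Q by simp
  qed
qed

section \<open>Monomial entries\<close>

interpretation rf_const_hom: inj_comm_ring_hom "rf_const :: 'c::field \<Rightarrow> 'c ratfun"
  by unfold_locales (simp_all add: rf_const_0 rf_const_1 rf_const_add rf_const_mult rf_const_eq_iff,
      metis rf_const_0 rf_const_eq_iff)

text \<open>Rational classes are represented by fractional parts; this normalisation puts the
  eigenvalues into [0,1[ in case M. The other classes may be represented arbitrarily.\<close>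

lemma residue_representatives:
  "\<exists>\<Lambda> :: 'c::field_char_0 set. (\<forall>x\<in>\<Lambda>. \<forall>y\<in>\<Lambda>. x - y \<in> \<int> \<longrightarrow> x = y) \<and>
    (\<forall>z. \<exists>k. z + of_int k \<in> \<Lambda>) \<and> (\<forall>x\<in>\<Lambda>. x \<in> \<rat> \<longrightarrow> (\<exists>r. x = of_rat r \<and> 0 \<le> r \<and> r < 1))"
proof -
  define Q where "Q = (\<lambda>(z::'c) y. z - y \<in> \<int> \<and> (z \<in> \<rat> \<longrightarrow> (\<exists>r. y = of_rat r \<and> 0 \<le> r \<and> r < 1)))"
  define rep where "rep = (\<lambda>z. SOME y. Q z y)"
  have "\<exists>y. Q z y" for z
  proof (cases "z \<in> \<rat>")
    case True
    then obtain r where r: "z = of_rat r" by (auto elim: Rats_cases)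
    have "z - of_rat (frac r) = of_int \<lfloor>r\<rfloor>" unfolding r of_rat_diff[symmetric] by (simp add: frac_def)
    hence "Q z (of_rat (frac r))" unfolding Q_def using frac_ge_0[of r] frac_lt_1[of r] by auto
    thus ?thesis by blast
  next
    case False
    hence "Q z z" by (simp add: Q_def)
    thus ?thesis by blast
  qed
  hence rep: "Q z (rep z)" for z unfolding rep_def by (rule someI_ex)
  have cong: "rep z = rep w" if "z - w \<in> \<int>" for z w
  proof -
    have "z - y \<in> \<int> \<longleftrightarrow> w - y \<in> \<int>" for y
      using Ints_diff[OF _ that, of "z - y"] Ints_add[OF _ that, of "w - y"] by auto
    moreover have "z \<in> \<rat> \<longleftrightarrow> w \<in> \<rat>"
    proof -
      have "z - w \<in> \<rat>" using that Ints_subset_Rats by auto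
      thus ?thesis using Rats_diff[of z "z - w"] Rats_add[of "z - w" w] by auto
    qed
    \<comment> \<open>Equality of the predicates makes the choice operator return the same
      representative for congruent arguments.\<close>
    ultimately have "Q z = Q w" unfolding Q_def by auto
    thus ?thesis unfolding rep_def by simp
  qed
  show ?thesis
  proof (intro exI[of _ "range rep"] conjI ballI impI allI)
    fix x y assume xy: "x \<in> range rep" "y \<in> range rep" "x - y \<in> \<int>"
    then obtain z w where zw: "x = rep z" "y = rep w" by blast
    have "z - w = (z - rep z) + (rep z - rep w) - (w - rep w)" by simp
    also have "\<dots> \<in> \<int>"
      using Ints_diff[OF Ints_add] rep[of z] rep[of w] xy(3) unfolding Q_def zw by blast
    finally show "x = y" unfolding zw by (rule cong)
  next
    fix z
    obtain k where "z - rep z = of_int k" using rep[of z] unfolding Q_def by (auto elim: Ints_cases)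
    hence "z + of_int (- k) = rep z" by (simp add: algebra_simps)
    thus "\<exists>k. z + of_int k \<in> range rep" by (metis rangeI)
  next
    fix x assume x: "x \<in> range rep" "x \<in> \<rat>"
    then obtain z where z: "x = rep z" by blast
    have "z - rep z \<in> \<rat>" using rep[of z] Ints_subset_Rats unfolding Q_def by auto
    hence "z \<in> \<rat>" using Rats_add[of "z - rep z" "rep z"] x(2) z by auto
    thus "\<exists>r. x = of_rat r \<and> 0 \<le> r \<and> r < 1" using rep[of z] unfolding Q_def z by blast
  qed
qed

text \<open>Multiplication by \<open>q\<close> permutes the classes of \<open>E\<close> modulo the integers.\<close>
lemma finite_expanding_residues:
  fixes E :: "'c::field_char_0 set" and q :: nat
  assumes fin: "finite E" and nonres: "\<And>x y. x \<in> E \<Longrightarrow> y \<in> E \<Longrightarrow> x - y \<in> \<int> \<Longrightarrow> x = y"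
    and ex: "\<And>x. x \<in> E \<Longrightarrow> \<exists>y\<in>E. of_nat q * y - x \<in> \<int>" and q: "q \<ge> 2"
  shows "\<And>x y. x \<in> E \<Longrightarrow> y \<in> E \<Longrightarrow> of_nat q * x - of_nat q * y \<in> \<int> \<Longrightarrow> x = y"
    and "\<And>x. x \<in> E \<Longrightarrow> x \<in> \<rat>"
proof -
  \<comment> \<open>p inverts multiplication by q modulo the integers. It is injective on the finite
    set E, hence a permutation of E.\<close>
  obtain p where p: "\<And>x. x \<in> E \<Longrightarrow> p x \<in> E" "\<And>x. x \<in> E \<Longrightarrow> of_nat q * p x - x \<in> \<int>"
    using ex by metis
  have "inj_on p E"
  proof (rule inj_onI)
    fix x y assume xy: "x \<in> E" "y \<in> E" "p x = p y"
    have "x - y = (of_nat q * p y - y) - (of_nat q * p x - x)" using xy by simp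
    also have "\<dots> \<in> \<int>" using Ints_diff[OF p(2)[OF xy(2)] p(2)[OF xy(1)]] .
    finally show "x = y" using nonres xy by blast
  qed
  hence surj: "p ` E = E" using fin p by (intro endo_inj_surj) auto
  {
    fix x y assume xy: "x \<in> E" "y \<in> E" "of_nat q * x - of_nat q * y \<in> \<int>"
    hence "x \<in> p ` E" "y \<in> p ` E" using surj by simp_all
    then obtain x' y' where x': "x' \<in> E" "x = p x'" and y': "y' \<in> E" "y = p y'" by blast
    have "x' - y' = (of_nat q * x - of_nat q * y) + (of_nat q * p y' - y') - (of_nat q * p x' - x')"
      unfolding x'(2) y'(2) by simp
    also have "\<dots> \<in> \<int>" using Ints_diff[OF Ints_add[OF xy(3) p(2)[OF y'(1)]] p(2)[OF x'(1)]] .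
    finally have "x' = y'" using nonres x' y' by blast
    thus "x = y" using x' y' by simp
  }
  fix x assume x: "x \<in> E"
  have pk: "(p ^^ k) x \<in> E" for k by (induction k) (auto simp: x p)
  have qk: "of_nat (q ^ k) * (p ^^ k) x - x \<in> \<int>" for k
  proof (induction k)
    case (Suc k)
    have "of_nat (q ^ Suc k) * (p ^^ Suc k) x - x
        = of_nat (q ^ k) * (of_nat q * p ((p ^^ k) x) - (p ^^ k) x) + (of_nat (q ^ k) * (p ^^ k) x - x)"
      by (simp add: algebra_simps)
    also have "\<dots> \<in> \<int>" using Ints_add[OF Ints_mult[OF Ints_of_nat p(2)[OF pk]] Suc] .
    finally show ?case .
  qed simp
  have "finite (range (\<lambda>k. (p ^^ k) x))" using pk fin by (meson finite_subset image_subsetI)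
  \<comment> \<open>q^k p^k(x) is congruent to x for every k. Two iterates of p at x share a value
    y, so (q^i - q^j) y is an integer and y is rational.\<close>
  hence "\<not> inj (\<lambda>k. (p ^^ k) x)" using finite_imageD infinite_UNIV_nat by blast
  then obtain i j where ij: "i \<noteq> j" "(p ^^ i) x = (p ^^ j) x" unfolding inj_def by blast
  define y where "y = (p ^^ i) x"
  have "(of_nat (q ^ i) - of_nat (q ^ j)) * y
      = (of_nat (q ^ i) * (p ^^ i) x - x) - (of_nat (q ^ j) * (p ^^ j) x - x)"
    using ij(2) by (simp add: y_def algebra_simps)
  also have "\<dots> \<in> \<int>" using Ints_diff[OF qk qk] .
  finally have yI: "(of_nat (q ^ i) - of_nat (q ^ j)) * y \<in> \<rat>" using Ints_subset_Rats by blast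
  have "q ^ i \<noteq> q ^ j" using ij(1) q by simp
  hence nz: "of_nat (q ^ i) - of_nat (q ^ j) \<noteq> (0::'c)" by (metis eq_iff_diff_eq_0 of_nat_eq_iff)
  have "(of_nat (q ^ i) - of_nat (q ^ j)) * y / (of_nat (q ^ i) - of_nat (q ^ j)) \<in> \<rat>"
    using yI by (intro Rats_divide Rats_diff Rats_of_nat)
  hence "y \<in> \<rat>" using nz by simp
  hence "of_nat (q ^ i) * y - (of_nat (q ^ i) * (p ^^ i) x - x) \<in> \<rat>"
    using Rats_diff[OF Rats_mult[OF Rats_of_nat \<open>y \<in> \<rat>\<close>]] qk[of i] Ints_subset_Rats by blast
  thus "x \<in> \<rat>" by (simp add: y_def)
qed

lemma eigenvalue_upper_triangular:
  fixes M :: "'a::field mat"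
  assumes "M \<in> carrier_mat n n" "upper_triangular M"
  shows "eigenvalue M x \<longleftrightarrow> (\<exists>i<n. x = M $$ (i, i))"
proof -
  have "poly (\<Prod>c\<leftarrow>cs. [:- c, 1:]) x = 0 \<longleftrightarrow> x \<in> set cs" for cs by (induction cs) auto
  moreover have "set (diag_mat M) = (\<lambda>i. M $$ (i, i)) ` {..<n}"
    using assms(1) by (auto simp: diag_mat_def)
  ultimately show ?thesis
    unfolding eigenvalue_root_char_poly[OF assms(1)] char_poly_upper_triangular[OF assms] by auto
qed

text \<open>The monomial \<open>x\<^sup>c\<close>; it is meaningful only for integral \<open>c\<close>.\<close>
definition xp :: "'c::field_char_0 \<Rightarrow> 'c ratfun" where
  "xp c = rf_X powi (THE m. of_int m = c)"

lemma xp_of_int: "xp (of_int m) = rf_X powi m"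
proof -
  have "(THE k. of_int k = (of_int m :: 'a)) = m" by (rule the_equality) auto
  thus ?thesis by (simp add: xp_def)
qed

lemma xp_nz: "xp c \<noteq> 0"
  by (simp add: xp_def rf_X_def)

lemma xp_0: "xp 0 = 1"
  using xp_of_int[of 0] by simp

lemma xp_add: "c \<in> \<int> \<Longrightarrow> d \<in> \<int> \<Longrightarrow> xp (c + d) = xp c * xp d"
proof -
  assume "c \<in> \<int>" "d \<in> \<int>"
  then obtain i j where "c = of_int i" "d = of_int j" by (metis Ints_cases)
  moreover have "rf_X powi (i + j) = rf_X powi i * (rf_X :: 'a ratfun) powi j"
    by (rule power_int_add) (simp add: rf_X_def)
  ultimately show ?thesis by (simp add: xp_of_int flip: of_int_add)
qed

text \<open>The rational solutions of x f' = c f: multiples of x^c for integral c, otherwise only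
  0.\<close>

definition is_mono :: "'c::field_char_0 \<Rightarrow> 'c ratfun \<Rightarrow> bool" where
  "is_mono c f \<longleftrightarrow> (\<exists>\<beta>. f = rf_const \<beta> * xp c \<and> (c \<notin> \<int> \<longrightarrow> \<beta> = 0))"

lemma is_mono_0: "is_mono c 0"
  unfolding is_mono_def by (rule exI[of _ 0]) (simp add: rf_const_0)

lemma is_mono_add: "is_mono c f \<Longrightarrow> is_mono c g \<Longrightarrow> is_mono c (f + g)"
proof -
  assume "is_mono c f" "is_mono c g"
  then obtain \<beta> \<gamma> where "f = rf_const \<beta> * xp c" "c \<notin> \<int> \<longrightarrow> \<beta> = 0" "g = rf_const \<gamma> * xp c" "c \<notin> \<int> \<longrightarrow> \<gamma> = 0"
    unfolding is_mono_def by blast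
  thus ?thesis unfolding is_mono_def
    by (intro exI[of _ "\<beta> + \<gamma>"]) (simp add: rf_const_add distrib_right)
qed

lemma is_mono_const: "is_mono c f \<Longrightarrow> is_mono c (rf_const k * f)"
proof -
  assume "is_mono c f"
  then obtain \<beta> where "f = rf_const \<beta> * xp c" "c \<notin> \<int> \<longrightarrow> \<beta> = 0" unfolding is_mono_def by blast
  thus ?thesis unfolding is_mono_def
    by (intro exI[of _ "k * \<beta>"]) (simp add: rf_const_mult)
qed

lemma is_mono_diff: "is_mono c f \<Longrightarrow> is_mono c g \<Longrightarrow> is_mono c (f - g)"
  using is_mono_add[of c f "rf_const (-1) * g"] is_mono_const[of c g "-1"]
  by (simp add: rf_const_minus rf_const_1)

lemma is_mono_sum: "(\<And>i. i \<in> S \<Longrightarrow> is_mono c (f i)) \<Longrightarrow> is_mono c (sum f S)"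
  by (induction S rule: infinite_finite_induct) (auto intro: is_mono_add is_mono_0)

text \<open>Sorting by diagonal entries would give one triangular block for each eigenvalue.\<close>

definition class_triangular :: "nat \<Rightarrow> 'c::zero mat \<Rightarrow> bool" where
  "class_triangular n M \<longleftrightarrow> M \<in> carrier_mat n n \<and>
    (\<forall>i<n. \<forall>j<n. i \<noteq> j \<longrightarrow> M $$ (i, j) \<noteq> 0 \<longrightarrow> i < j \<and> M $$ (i, i) = M $$ (j, j))"

lemma class_triangular_smult:
  "class_triangular n M \<Longrightarrow> class_triangular n (c \<cdot>\<^sub>m M)" for c :: "'a::field"
  by (auto simp: class_triangular_def)

lemma class_triangular_upper: "class_triangular n M \<Longrightarrow> upper_triangular M"
  unfolding class_triangular_def upper_triangular_def
  by (metis carrier_matD(1) less_imp_not_less less_trans nat_neq_iff)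

context system_cases
begin

text \<open>For integral c the function f x^(-c) has constant image under \<delta>, hence is
  constant, as k contains no logarithm. For any other c the term g vanishes and so does f.\<close>

lemma is_mono_solution:
  assumes u: "u = [:0, 1:]" and f: "\<delta> f = rf_const c * f + g" and g: "is_mono c g"
  shows "is_mono c f"
proof -
  obtain \<gamma> where \<gamma>: "g = rf_const \<gamma> * xp c" "c \<notin> \<int> \<Longrightarrow> \<gamma> = 0" using g unfolding is_mono_def by blast
  show ?thesis
  proof (cases "c \<in> \<int>")
    case False
    hence "\<delta> f = rf_const c * f" using f \<gamma> by (simp add: rf_const_0)
    hence "f = 0" using \<delta>_exponential False by (metis Ints_0)
    thus ?thesis using is_mono_0 by simp
  next
    case True
    then obtain m where m: "c = of_int m" by (auto elim: Ints_cases)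
    have X: "rf_X \<noteq> (0 :: 'c ratfun)" by (simp add: rf_X_def)
    have inv: "rf_X powi m * rf_X powi (- m) = (1 :: 'c ratfun)"
      using X by (simp add: power_int_minus)
    have "\<delta> (f * rf_X powi (- m)) = (rf_const c * f + rf_const \<gamma> * rf_X powi m) * rf_X powi (- m)
        + f * (rf_const (of_int (- m)) * rf_X powi (- m))"
      unfolding \<delta>_mult f \<gamma>(1) \<delta>_X_powi[OF u] unfolding m xp_of_int ..
    also have "\<dots> = rf_const \<gamma> * (rf_X powi m * rf_X powi (- m))"
      unfolding m of_int_minus rf_const_minus by (simp add: algebra_simps)
    finally have "\<delta> (f * rf_X powi (- m)) = rf_const \<gamma>" unfolding inv by simp
    then obtain d where "f * rf_X powi (- m) = rf_const d" using \<delta>_const_antiderivative[OF u] by blast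
    hence "f * (rf_X powi m * rf_X powi (- m)) = rf_const d * rf_X powi m" by (simp add: ac_simps)
    hence "f = rf_const d * xp c" unfolding inv m xp_of_int by simp
    thus ?thesis unfolding is_mono_def using True by blast
  qed
qed

text \<open>The equation for the entry (i, j) involves, besides itself, the entries (k, j) with k >
  i and (i, k) with k < j, which explains the measure. They carry the same exponent, because Y and Z
  join only equal diagonal entries.\<close>

lemma is_mono_entries:
  assumes u: "u = [:0, 1:]" and Y: "class_triangular n Y" and Z: "class_triangular n Z"
    and M: "M \<in> carrier_mat n n"
    and \<delta>M: "map_mat \<delta> M = map_mat rf_const Y * M - M * map_mat rf_const Z"
    and ij: "i < n" "j < n"
  shows "is_mono (Y $$ (i, i) - Z $$ (j, j)) (M $$ (i, j))"
  using ij
proof (induction "(n - i) + j" arbitrary: i j rule: less_induct)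
  case less
  note ij = less.prems
  let ?c = "Y $$ (i, i) - Z $$ (j, j)"
  have Yc: "map_mat rf_const Y \<in> carrier_mat n n" and Zc: "map_mat rf_const Z \<in> carrier_mat n n"
    using Y Z by (auto simp: class_triangular_def)
  have dims: "Y \<in> carrier_mat n n" "Z \<in> carrier_mat n n" using Y Z by (auto simp: class_triangular_def)
  have "\<delta> (M $$ (i, j)) = (map_mat rf_const Y * M) $$ (i, j) - (M * map_mat rf_const Z) $$ (i, j)"
    using arg_cong[OF \<delta>M, of "\<lambda>N. N $$ (i, j)"] ij M dims by (simp del: index_mult_mat(1))
  also have "(map_mat rf_const Y * M) $$ (i, j) = (\<Sum>k<n. rf_const (Y $$ (i, k)) * M $$ (k, j))"
    unfolding mult_mat_entry[OF Yc M ij] using ij dims by (intro sum.cong) auto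
  also have "\<dots> = rf_const (Y $$ (i, i)) * M $$ (i, j)
      + (\<Sum>k\<in>{..<n} - {i}. rf_const (Y $$ (i, k)) * M $$ (k, j))"
    using ij by (subst sum.remove[of _ i]) auto
  also have "(M * map_mat rf_const Z) $$ (i, j) = (\<Sum>k<n. rf_const (Z $$ (k, j)) * M $$ (i, k))"
    unfolding mult_mat_entry[OF M Zc ij] using ij dims by (intro sum.cong) auto
  also have "\<dots> = rf_const (Z $$ (j, j)) * M $$ (i, j)
      + (\<Sum>k\<in>{..<n} - {j}. rf_const (Z $$ (k, j)) * M $$ (i, k))"
    using ij by (subst sum.remove[of _ j]) auto
  finally have e: "\<delta> (M $$ (i, j)) = rf_const ?c * M $$ (i, j)
      + ((\<Sum>k\<in>{..<n} - {i}. rf_const (Y $$ (i, k)) * M $$ (k, j))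
       - (\<Sum>k\<in>{..<n} - {j}. rf_const (Z $$ (k, j)) * M $$ (i, k)))"
    by (simp add: rf_const_hom.hom_minus algebra_simps)
  show ?case
  proof (rule is_mono_solution[OF u e], intro is_mono_diff is_mono_sum)
    fix k assume k: "k \<in> {..<n} - {i}"
    show "is_mono ?c (rf_const (Y $$ (i, k)) * M $$ (k, j))"
    proof (cases "Y $$ (i, k) = 0")
      case True
      thus ?thesis using is_mono_0 by (simp add: rf_const_0)
    next
      case False
      hence ik: "i < k" "Y $$ (i, i) = Y $$ (k, k)" using Y k ij unfolding class_triangular_def by auto
      have "is_mono (Y $$ (k, k) - Z $$ (j, j)) (M $$ (k, j))" using ik k ij by (intro less.hyps) auto
      thus ?thesis unfolding ik(2) by (rule is_mono_const)
    qed
  next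
    fix k assume k: "k \<in> {..<n} - {j}"
    show "is_mono ?c (rf_const (Z $$ (k, j)) * M $$ (i, k))"
    proof (cases "Z $$ (k, j) = 0")
      case True
      thus ?thesis using is_mono_0 by (simp add: rf_const_0)
    next
      case False
      hence kj: "k < j" "Z $$ (k, k) = Z $$ (j, j)" using Z k ij unfolding class_triangular_def by auto
      have "is_mono (Y $$ (i, i) - Z $$ (k, k)) (M $$ (i, k))" using kj k ij by (intro less.hyps) auto
      thus ?thesis unfolding kj(2) by (rule is_mono_const)
    qed
  qed
qed

lemma normal_form_QM:
  assumes u: "u = [:0, 1:]" and tors: "\<And>v. v \<in> LL \<Longrightarrow> tors v"
    and mats: "A \<in> carrier_mat n n" "B \<in> carrier_mat n n" "Bi \<in> carrier_mat n n"
    and inv: "B * Bi = 1\<^sub>m n" "Bi * B = 1\<^sub>m n"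
    and ab: "\<And>i j. a i j = A $$ (i, j)" "\<And>i j. bi i j = Bi $$ (i, j)"
    and \<Lambda>: "\<And>x y. x \<in> \<Lambda> \<Longrightarrow> y \<in> \<Lambda> \<Longrightarrow> x - y \<in> \<int> \<Longrightarrow> x = y" "\<And>z. \<exists>k. z + of_int k \<in> \<Lambda>"
  obtains A' B' P where "class_triangular n A'" "\<And>i. i < n \<Longrightarrow> A' $$ (i, i) \<in> \<Lambda>"
    "B' \<in> carrier_mat n n" "P \<in> carrier_mat n n" "B' * P = 1\<^sub>m n" "P * B' = 1\<^sub>m n"
    "gauge_equivalent \<delta> \<sigma> n A B (map_mat rf_const A') B'"
    "map_mat \<delta> B' = map_mat rf_const (of_nat \<mu> \<cdot>\<^sub>m A') * B' - B' * map_mat rf_const A'"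
    "\<And>i j. i < n \<Longrightarrow> j < n \<Longrightarrow> is_mono (of_nat \<mu> * A' $$ (i, i) - A' $$ (j, j)) (B' $$ (i, j))"
    "\<And>i j. i < n \<Longrightarrow> j < n \<Longrightarrow> is_mono (A' $$ (i, i) - of_nat \<mu> * A' $$ (j, j)) (P $$ (i, j))"
proof -
  \<comment> \<open>The matrix of D will be - A', so the eigenvalues of D are taken from the
    negatives of \<Lambda>.\<close>
  have nonres: "x = y" if "x \<in> uminus ` \<Lambda>" "y \<in> uminus ` \<Lambda>" "x - y \<in> \<int>" for x y
  proof -
    have "- x - - y = - (x - y)" by simp
    also have "\<dots> \<in> \<int>" using that by (intro Ints_minus)
    finally show ?thesis using that(1,2) \<Lambda>(1)[of "- x" "- y"] by auto
  qed
  have reps: "\<exists>k. z + of_int k \<in> uminus ` \<Lambda>" for z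
  proof -
    obtain k where "- z + of_int k \<in> \<Lambda>" using \<Lambda>(2) by blast
    hence "- (- z + of_int k) \<in> uminus ` \<Lambda>" by (rule imageI)
    hence "z + of_int (- k) \<in> uminus ` \<Lambda>" by simp
    thus ?thesis by blast
  qed
  obtain v l T where "kindep v n \<and> (\<forall>i<n. v i \<in> supp n) \<and> (\<forall>i<n. l i \<in> uminus ` \<Lambda>) \<and>
    (\<forall>i<n. \<forall>j. T i j \<noteq> 0 \<longrightarrow> j < i \<and> l j = l i) \<and>
    (\<forall>i<n. D (v i) = sc (l i) (v i) + (\<Sum>j<n. sc (T i j) (v j)))"
    using basis_case_QM[OF u nonres reps tors] by blast
  hence ind: "kindep v n" and vs: "\<And>i. i < n \<Longrightarrow> v i \<in> supp n" and l: "\<And>i. i < n \<Longrightarrow> l i \<in> uminus ` \<Lambda>"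
    and T: "\<And>i j. i < n \<Longrightarrow> T i j \<noteq> 0 \<Longrightarrow> j < i \<and> l j = l i"
    and Dv: "\<And>i. i < n \<Longrightarrow> D (v i) = sc (l i) (v i) + (\<Sum>j<n. sc (T i j) (v j))"
    by blast+
  \<comment> \<open>Column j of M holds the coordinates of D v_j, so T enters transposed and A'
    becomes upper triangular.\<close>
  define M where "M = (\<lambda>k j. (if k = j then l j else 0) + T j k)"
  have DM: "D (v j) = (\<Sum>k<n. sc (M k j) (v k))" if j: "j < n" for j
  proof -
    have "(\<Sum>k<n. sc (if k = j then l j else 0) (v k)) = (\<Sum>k\<in>{j}. sc (l k) (v k))"
      using j by (intro sum.mono_neutral_cong_right) auto
    thus ?thesis unfolding Dv[OF j] M_def by (simp add: cv.scale_left_distrib sum.distrib)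
  qed
  define A' where "A' = mat n n (\<lambda>(i, j). - M i j)"
  have T0: "T i i = 0" if "i < n" for i using T[OF that, of i] by blast
  have diag: "A' $$ (i, i) = - l i" if "i < n" for i using that by (simp add: A'_def M_def T0)
  have ct: "class_triangular n A'" unfolding class_triangular_def
  proof (intro conjI allI impI)
    show "A' \<in> carrier_mat n n" by (simp add: A'_def)
    fix i j assume ij: "i < n" "j < n" "i \<noteq> j" "A' $$ (i, j) \<noteq> 0"
    hence "T j i \<noteq> 0" by (simp add: A'_def M_def)
    hence "i < j \<and> l i = l j" using T[OF ij(2)] by blast
    thus "i < j" "A' $$ (i, i) = A' $$ (j, j)" using diag ij by auto
  qed
  obtain B' P where BP: "B' \<in> carrier_mat n n" "P \<in> carrier_mat n n" "B' * P = 1\<^sub>m n" "P * B' = 1\<^sub>m n"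
    "gauge_equivalent \<delta> \<sigma> n A B (map_mat rf_const A') B'"
    and dP: "map_mat \<delta> P = map_mat rf_const A' * P - P * map_mat rf_const (of_nat \<mu> \<cdot>\<^sub>m A')"
    and dB: "map_mat \<delta> B' = map_mat rf_const (of_nat \<mu> \<cdot>\<^sub>m A') * B' - B' * map_mat rf_const A'"
    and "\<And>j. j < n \<Longrightarrow> Ph (v j) = (\<Sum>k<n. ks (P $$ (k, j)) (v k))"
    by (rule gauge_reduction[OF mats inv ab ind vs DM A'_def]) (assumption | rule that)+
  have A'c: "A' \<in> carrier_mat n n" by (simp add: A'_def)
  have diag\<Lambda>: "A' $$ (i, i) \<in> \<Lambda>" if "i < n" for i using l[OF that] diag[OF that] by auto
  note ct\<mu> = class_triangular_smult[OF ct, of "of_nat \<mu>"]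
  have mB: "is_mono (of_nat \<mu> * A' $$ (i, i) - A' $$ (j, j)) (B' $$ (i, j))" if "i < n" "j < n" for i j
    using is_mono_entries[OF u ct\<mu> ct BP(1) dB that] that A'c by simp
  have mP: "is_mono (A' $$ (i, i) - of_nat \<mu> * A' $$ (j, j)) (P $$ (i, j))" if "i < n" "j < n" for i j
    using is_mono_entries[OF u ct ct\<mu> BP(2) dP that] that A'c by simp
  show ?thesis by (rule that[OF ct _ BP dB]) (fact diag\<Lambda> mB mP)+
qed

end

section \<open>Normal forms\<close>

lemma GL_I:
  "M \<in> carrier_mat n n \<Longrightarrow> N \<in> carrier_mat n n \<Longrightarrow> M * N = 1\<^sub>m n \<Longrightarrow> N * M = 1\<^sub>m n \<Longrightarrow> M \<in> GL n"
  unfolding GL_def invertible_mat_def inverts_mat_def square_mat.simps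
  by (intro CollectI conjI exI[of _ N]) auto

lemma GL_E:
  assumes "M \<in> GL n"
  obtains N where "N \<in> carrier_mat n n" "M * N = 1\<^sub>m n" "N * M = 1\<^sub>m n"
proof -
  have M: "M \<in> carrier_mat n n" using assms by (simp add: GL_def)
  obtain N where N: "M * N = 1\<^sub>m (dim_row M)" "N * M = 1\<^sub>m (dim_row N)"
    using assms by (auto simp: GL_def invertible_mat_def inverts_mat_def)
  have "dim_col N = n" using arg_cong[OF N(1), of dim_col] M by simp
  moreover have "dim_row N = n" using arg_cong[OF N(2), of dim_col] M by simp
  ultimately have "N \<in> carrier_mat n n" by auto
  thus ?thesis using that N M \<open>dim_row N = n\<close> by auto
qed

text \<open>Column by column: if the columns of M before j vanish below the diagonal, the entry (i,
  j) of M N with i >= j reduces to M_ij N_jj. For i = j this shows that N_jj is nonzero, and for i >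
  j that M_ij = 0.\<close>

lemma left_inverse_upper_triangular:
  fixes M N :: "'a::field mat"
  assumes M: "M \<in> carrier_mat n n" and N: "N \<in> carrier_mat n n" and MN: "M * N = 1\<^sub>m n"
    and ut: "\<And>i j. i < n \<Longrightarrow> j < i \<Longrightarrow> N $$ (i, j) = 0"
  shows "upper_triangular M"
proof -
  have "\<forall>i<n. j < i \<longrightarrow> M $$ (i, j) = 0" for j
  proof (induction j rule: less_induct)
    case (less j)
    have e: "M $$ (i, j) * N $$ (j, j) = (if i = j then 1 else 0)" if i: "i < n" "j \<le> i" for i
    proof -
      have j: "j < n" using i by simp
      have "(\<Sum>k<n. M $$ (i, k) * N $$ (k, j)) = M $$ (i, j) * N $$ (j, j)"
      proof (subst sum.remove[of _ j])
        have "M $$ (i, k) * N $$ (k, j) = 0" if "k \<in> {..<n} - {j}" for k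
        proof (cases "k < j")
          case True
          thus ?thesis using less.IH[of k] i by simp
        next
          case False
          hence "N $$ (k, j) = 0" using that by (intro ut) auto
          thus ?thesis by simp
        qed
        hence "(\<Sum>k\<in>{..<n} - {j}. M $$ (i, k) * N $$ (k, j)) = 0" by (intro sum.neutral ballI)
        thus "M $$ (i, j) * N $$ (j, j) + (\<Sum>k\<in>{..<n} - {j}. M $$ (i, k) * N $$ (k, j))
            = M $$ (i, j) * N $$ (j, j)" by simp
      qed (use j in auto)
      thus ?thesis using i j unfolding mult_mat_entry[OF M N i(1) j, symmetric] MN by simp
    qed
    show ?case
    proof (intro allI impI)
      fix i assume i: "i < n" "j < i"
      have "N $$ (j, j) \<noteq> 0" using e[of j] i by auto
      thus "M $$ (i, j) = 0" using e[of i] i by simp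
    qed
  qed
  thus ?thesis using M by (auto simp: upper_triangular_def)
qed

lemma constant_matrix:
  assumes "M \<in> carrier_mat n n" "\<And>i j. i < n \<Longrightarrow> j < n \<Longrightarrow> \<exists>c. M $$ (i, j) = rf_const c"
  obtains M0 where "M0 \<in> carrier_mat n n" "M = map_mat rf_const M0"
proof -
  obtain c where c: "\<And>i j. i < n \<Longrightarrow> j < n \<Longrightarrow> M $$ (i, j) = rf_const (c i j)" using assms(2) by metis
  have "M = map_mat rf_const (mat n n (\<lambda>(i, j). c i j))"
    by (rule eq_matI) (use assms(1) c in auto)
  thus ?thesis using that[of "mat n n (\<lambda>(i, j). c i j)"] by simp
qed

text \<open>A constant matrix has derivative 0, so for \<mu> = 1 the consistency relation
  \<open>dB\<close> becomes a commutation relation.\<close>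

lemma (in system_cases) constant_gauge:
  assumes \<mu>1: "\<mu> = 1" and A': "A' \<in> carrier_mat n n"
    and B0: "B0 \<in> carrier_mat n n" and P0: "P0 \<in> carrier_mat n n"
    and BP: "map_mat rf_const B0 * map_mat rf_const P0 = 1\<^sub>m n"
    and dB: "map_mat \<delta> (map_mat rf_const B0)
      = map_mat rf_const (of_nat \<mu> \<cdot>\<^sub>m A') * map_mat rf_const B0 - map_mat rf_const B0 * map_mat rf_const A'"
  shows "B0 * P0 = 1\<^sub>m n" "B0 \<in> GL n" "B0 * A' = A' * B0"
proof -
  have "map_mat rf_const (B0 * P0) = map_mat rf_const (1\<^sub>m n)"
    unfolding rf_const_hom.mat_hom_mult[OF B0 P0] BP by (rule rf_const_hom.mat_hom_one[symmetric])
  thus BP0: "B0 * P0 = 1\<^sub>m n" by (rule rf_const_hom.mat_hom_inj)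
  thus "B0 \<in> GL n" using B0 P0 mat_mult_left_right_inverse by (intro GL_I[OF B0 P0]) auto
  have "of_nat \<mu> \<cdot>\<^sub>m A' = A'" using \<mu>1 A' by (intro eq_matI) auto
  hence d: "map_mat \<delta> (map_mat rf_const B0) = map_mat rf_const (A' * B0) - map_mat rf_const (B0 * A')"
    using dB rf_const_hom.mat_hom_mult[OF B0 A'] rf_const_hom.mat_hom_mult[OF A' B0] by simp
  have c: "A' * B0 \<in> carrier_mat n n" "B0 * A' \<in> carrier_mat n n" using A' B0 by auto
  show "B0 * A' = A' * B0"
  proof (rule eq_matI)
    fix i j assume "i < dim_row (A' * B0)" "j < dim_col (A' * B0)"
    hence ij: "i < n" "j < n" using c by auto
    have "0 = rf_const ((A' * B0) $$ (i, j)) - rf_const ((B0 * A') $$ (i, j))"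
      using arg_cong[OF d, of "\<lambda>M. M $$ (i, j)"] ij A' B0 by (simp del: index_mult_mat(1))
    hence "rf_const ((B0 * A') $$ (i, j)) = rf_const ((A' * B0) $$ (i, j))" by simp
    thus "(B0 * A') $$ (i, j) = (A' * B0) $$ (i, j)" unfolding rf_const_eq_iff .
  qed (use A' B0 in auto)
qed

lemma case_S_normal_form:
  fixes \<delta> \<sigma> :: "'c::{alg_closed_field, field_char_0} ratfun \<Rightarrow> 'c ratfun"
  assumes S: "case_S \<delta> \<sigma> \<mu>" and A: "A \<in> carrier_mat n n" and B: "B \<in> GL n"
    and cons: "consistent \<delta> \<sigma> \<mu> A B"
  shows "\<exists>A' \<in> carrier_mat n n. \<exists>B0 \<in> GL n. diagonal_mat A' \<and> upper_triangular B0 \<and> B0 * A' = A' * B0 \<and>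
    gauge_equivalent \<delta> \<sigma> n A B (map_mat rf_const A') (map_mat rf_const B0)"
proof -
  have Bc: "B \<in> carrier_mat n n" using B by (simp add: GL_def)
  obtain Bi where Bi: "Bi \<in> carrier_mat n n" "B * Bi = 1\<^sub>m n" "Bi * B = 1\<^sub>m n" using B by (rule GL_E)
  have \<mu>1: "\<mu> = 1" and \<sigma>: "\<sigma> = rf_subst [:1, 1:]" and \<delta>: "\<delta> = (\<lambda>f. to_fract 1 * rf_deriv f)"
    using S by (auto simp: case_S_def)
  have us: "\<exists>w k. pcompose 1 [:1, 1:] * w = (1 :: 'c poly) ^ k" by (rule exI[of _ 1]) simp
  interpret system_cases \<delta> \<sigma> 1 "[:1, 1:]" \<mu> n "\<lambda>i j. A $$ (i, j)" "\<lambda>i j. B $$ (i, j)" "\<lambda>i j. Bi $$ (i, j)"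
    by (rule system_cases_matrix[OF _ \<delta> \<sigma> _ case_S_commute(1)[OF S] _ us separating_S A Bc Bi cons])
      (auto simp: \<mu>1)
  have tors: "tors v" if "v \<in> LL" for v by (rule torsion_case_S[OF \<mu>1 refl refl that])
  obtain v l C where h: "kindep v n \<and> (\<forall>i<n. eigenv (l i) (v i)) \<and>
      (\<forall>i<n. \<forall>j. C i j \<noteq> 0 \<longrightarrow> j \<le> i) \<and> (\<forall>i<n. Ph (v i) = (\<Sum>j<n. sc (C i j) (v j)))"
    using basis_case_S[OF refl \<mu>1 tors] by blast
  hence ind: "kindep v n" and ev: "\<And>i. i < n \<Longrightarrow> eigenv (l i) (v i)" by blast+
  have C: "C i j = 0" if "i < n" "i < j" for i j using h that by (meson not_less)
  have PhC: "Ph (v i) = (\<Sum>j<n. sc (C i j) (v j))" if "i < n" for i using h that by blast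
  have vs: "v i \<in> supp n" if "i < n" for i using ev[OF that] by (simp add: eigenv_def)
  define M where "M = (\<lambda>k j. if k = j then l j else 0)"
  have DM: "D (v j) = (\<Sum>k<n. sc (M k j) (v k))" if j: "j < n" for j
  proof -
    have "(\<Sum>k<n. sc (M k j) (v k)) = (\<Sum>k\<in>{j}. sc (l k) (v k))"
      using j by (intro sum.mono_neutral_cong_right) (auto simp: M_def)
    thus ?thesis using ev[OF j] by (simp add: eigenv_def)
  qed
  define A' where "A' = mat n n (\<lambda>(i, j). - M i j)"
  have A': "A' \<in> carrier_mat n n" by (simp add: A'_def)
  obtain B' P where B': "B' \<in> carrier_mat n n" and P: "P \<in> carrier_mat n n"
    and BP: "B' * P = 1\<^sub>m n" "P * B' = 1\<^sub>m n"
    and g: "gauge_equivalent \<delta> \<sigma> n A B (map_mat rf_const A') B'"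
    and dP: "map_mat \<delta> P = map_mat rf_const A' * P - P * map_mat rf_const (of_nat \<mu> \<cdot>\<^sub>m A')"
    and dB: "map_mat \<delta> B' = map_mat rf_const (of_nat \<mu> \<cdot>\<^sub>m A') * B' - B' * map_mat rf_const A'"
    and PhP: "\<And>j. j < n \<Longrightarrow> Ph (v j) = (\<Sum>k<n. ks (P $$ (k, j)) (v k))"
    by (rule gauge_reduction[OF A Bc Bi refl refl ind vs DM A'_def]) (assumption | rule that)+
  have Pc: "P $$ (k, j) = rf_const (C j k)" if "k < n" "j < n" for k j
  proof -
    have "(\<Sum>k<n. ks (P $$ (k, j) - rf_const (C j k)) (v k)) = 0"
      using PhP[OF that(2)] PhC[OF that(2)]
      by (simp add: kv.scale_left_diff_distrib sum_subtractf sc_def)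
    hence "P $$ (k, j) - rf_const (C j k) = 0"
      using ind[unfolded kindep_def, rule_format, of "\<lambda>k. P $$ (k, j) - rf_const (C j k)" k] that by blast
    thus ?thesis by simp
  qed
  \<comment> \<open>Transposed, because the coefficients of \<Phi> v_j form column j; C is lower
    triangular, so P0 is upper triangular.\<close>
  define P0 where "P0 = mat n n (\<lambda>(k, j). C j k)"
  have P0: "P0 \<in> carrier_mat n n" by (simp add: P0_def)
  have PP0: "P = map_mat rf_const P0" by (rule eq_matI) (use P Pc in \<open>auto simp: P0_def\<close>)
  \<comment> \<open>As A' is diagonal, the entry (i, j) solves \<delta> f = (l_j - l_i) f and is
    constant by \<open>\<delta>_exponential\<close>.\<close>
  have "\<exists>c. B' $$ (i, j) = rf_const c" if ij: "i < n" "j < n" for i j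
  proof -
    have c1: "map_mat rf_const (of_nat \<mu> \<cdot>\<^sub>m A') \<in> carrier_mat n n" "map_mat rf_const A' \<in> carrier_mat n n"
      using A' by auto
    have "\<delta> (B' $$ (i, j)) = (map_mat rf_const (of_nat \<mu> \<cdot>\<^sub>m A') * B') $$ (i, j)
        - (B' * map_mat rf_const A') $$ (i, j)"
      using arg_cong[OF dB, of "\<lambda>M. M $$ (i, j)"] ij B' A' by (simp del: index_mult_mat(1))
    also have "(map_mat rf_const (of_nat \<mu> \<cdot>\<^sub>m A') * B') $$ (i, j)
        = (\<Sum>k<n. if k = i then rf_const (- l i) * B' $$ (i, j) else 0)"
      unfolding mult_mat_entry[OF c1(1) B' ij]
      using ij by (intro sum.cong) (auto simp: A'_def M_def \<mu>1 rf_const_0)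
    also have "\<dots> = rf_const (- l i) * B' $$ (i, j)" using ij by simp
    also have "(B' * map_mat rf_const A') $$ (i, j) = (\<Sum>k<n. if k = j then rf_const (- l j) * B' $$ (i, j) else 0)"
      unfolding mult_mat_entry[OF B' c1(2) ij]
      using ij by (intro sum.cong) (auto simp: A'_def M_def rf_const_0)
    also have "\<dots> = rf_const (- l j) * B' $$ (i, j)" using ij by simp
    finally have e: "\<delta> (B' $$ (i, j)) = rf_const (l j + - l i) * B' $$ (i, j)"
      unfolding rf_const_add rf_const_minus by (simp add: algebra_simps)
    show ?thesis
    proof (cases "B' $$ (i, j) = 0")
      case True
      thus ?thesis by (metis rf_const_0)
    next
      case False
      hence "l j + - l i = 0" using \<delta>_exponential[OF e] by (auto simp: one_pCons)
      hence "\<delta> (B' $$ (i, j)) = 0" using e by (simp add: rf_const_0)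
      thus ?thesis by (rule \<delta>_eq_zero)
    qed
  qed
  then obtain B0 where B0: "B0 \<in> carrier_mat n n" "B' = map_mat rf_const B0"
    using constant_matrix[OF B'] by metis
  note cg = constant_gauge[OF \<mu>1 A' B0(1) P0 BP(1)[unfolded B0(2) PP0] dB[unfolded B0(2)]]
  have "upper_triangular B0"
    by (rule left_inverse_upper_triangular[OF B0(1) P0 cg(1)]) (use C in \<open>auto simp: P0_def\<close>)
  moreover have "diagonal_mat A'" by (auto simp: diagonal_mat_def A'_def M_def)
  ultimately show ?thesis using A' cg(2,3) g[unfolded B0(2)] by blast
qed

lemma case_Q_normal_form:
  fixes \<delta> \<sigma> :: "'c::{alg_closed_field, field_char_0} ratfun \<Rightarrow> 'c ratfun"
  assumes Q: "case_Q q \<delta> \<sigma> \<mu>" and A: "A \<in> carrier_mat n n" and B: "B \<in> GL n"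
    and cons: "consistent \<delta> \<sigma> \<mu> A B"
  shows "\<exists>A' \<in> carrier_mat n n. \<exists>B0 \<in> GL n.
    (\<forall>l1 l2. eigenvalue A' l1 \<and> eigenvalue A' l2 \<longrightarrow> l1 - l2 \<notin> \<int> - {0}) \<and> B0 * A' = A' * B0 \<and>
    gauge_equivalent \<delta> \<sigma> n A B (map_mat rf_const A') (map_mat rf_const B0)"
proof -
  have Bc: "B \<in> carrier_mat n n" using B by (simp add: GL_def)
  obtain Bi where Bi: "Bi \<in> carrier_mat n n" "B * Bi = 1\<^sub>m n" "Bi * B = 1\<^sub>m n" using B by (rule GL_E)
  have \<mu>1: "\<mu> = 1" and \<sigma>: "\<sigma> = rf_subst [:0, q:]"
    and \<delta>: "\<delta> = (\<lambda>f. to_fract [:0, 1:] * rf_deriv f)"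
    and q: "q \<noteq> 0" "\<And>m::nat. m > 0 \<Longrightarrow> q ^ m \<noteq> 1"
    using Q by (auto simp: case_Q_def rf_X_def)
  have us: "\<exists>w k. pcompose [:0, 1:] [:0, q:] * w = [:0, 1:] ^ k"
    using q by (intro exI[of _ "[:1 / q:]"] exI[of _ 1]) (simp add: pcompose_pCons)
  interpret system_cases \<delta> \<sigma> "[:0, 1:]" "[:0, q:]" \<mu> n "\<lambda>i j. A $$ (i, j)" "\<lambda>i j. B $$ (i, j)" "\<lambda>i j. Bi $$ (i, j)"
    by (rule system_cases_matrix[OF _ \<delta> \<sigma> _ case_Q_commute(1)[OF Q] _ us separating_Q[OF _ q] A Bc Bi cons])
      (auto simp: \<mu>1 q)
  have tors: "tors v" if "v \<in> LL" for v by (rule torsion_case_Q[OF \<mu>1 refl refl q(2) that])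
  obtain \<Lambda> :: "'c set" where \<Lambda>0: "(\<forall>x\<in>\<Lambda>. \<forall>y\<in>\<Lambda>. x - y \<in> \<int> \<longrightarrow> x = y) \<and>
    (\<forall>z. \<exists>k. z + of_int k \<in> \<Lambda>) \<and> (\<forall>x\<in>\<Lambda>. x \<in> \<rat> \<longrightarrow> (\<exists>r. x = of_rat r \<and> 0 \<le> r \<and> r < 1))"
    by (rule exE[OF residue_representatives[where 'c = 'c]])
  have \<Lambda>: "\<And>x y. x \<in> \<Lambda> \<Longrightarrow> y \<in> \<Lambda> \<Longrightarrow> x - y \<in> \<int> \<Longrightarrow> x = y" "\<And>z. \<exists>k. z + of_int k \<in> \<Lambda>"
    using \<Lambda>0 by simp_all
  obtain A' B' P where ct: "class_triangular n A'" and A'\<Lambda>: "\<And>i. i < n \<Longrightarrow> A' $$ (i, i) \<in> \<Lambda>"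
    and B': "B' \<in> carrier_mat n n" and P: "P \<in> carrier_mat n n"
    and BP: "B' * P = 1\<^sub>m n" "P * B' = 1\<^sub>m n"
    and g: "gauge_equivalent \<delta> \<sigma> n A B (map_mat rf_const A') B'"
    and dB: "map_mat \<delta> B' = map_mat rf_const (of_nat \<mu> \<cdot>\<^sub>m A') * B' - B' * map_mat rf_const A'"
    and mB: "\<And>i j. i < n \<Longrightarrow> j < n \<Longrightarrow> is_mono (of_nat \<mu> * A' $$ (i, i) - A' $$ (j, j)) (B' $$ (i, j))"
    and mP: "\<And>i j. i < n \<Longrightarrow> j < n \<Longrightarrow> is_mono (A' $$ (i, i) - of_nat \<mu> * A' $$ (j, j)) (P $$ (i, j))"
    by (rule normal_form_QM[OF refl tors A Bc Bi refl refl \<Lambda>]) (assumption | rule that)+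
  have A': "A' \<in> carrier_mat n n" using ct by (simp add: class_triangular_def)
  \<comment> \<open>The exponent is a difference of two elements of \<Lambda>, so it is 0 as soon as
    it is integral.\<close>
  have const: "\<exists>c. f = rf_const c" if mono: "is_mono (A' $$ (i, i) - A' $$ (j, j)) f" and ij: "i < n" "j < n" for i j f
  proof -
    obtain \<beta> where \<beta>: "f = rf_const \<beta> * xp (A' $$ (i, i) - A' $$ (j, j))"
      "A' $$ (i, i) - A' $$ (j, j) \<notin> \<int> \<longrightarrow> \<beta> = 0" using mono unfolding is_mono_def by blast
    show ?thesis
    proof (cases "\<beta> = 0")
      case True
      thus ?thesis using \<beta>(1) by (metis mult_zero_left rf_const_0)
    next
      case False
      hence "A' $$ (i, i) = A' $$ (j, j)" using \<beta>(2) \<Lambda>(1)[OF A'\<Lambda>[OF ij(1)] A'\<Lambda>[OF ij(2)]] by blast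
      hence "f = rf_const \<beta>" using \<beta>(1) by (simp add: xp_0)
      thus ?thesis by blast
    qed
  qed
  have "\<exists>c. B' $$ (i, j) = rf_const c" if "i < n" "j < n" for i j
    using mB[OF that] const[OF _ that] by (simp add: \<mu>1)
  then obtain B0 where B0: "B0 \<in> carrier_mat n n" "B' = map_mat rf_const B0"
    using constant_matrix[OF B'] by metis
  have "\<exists>c. P $$ (i, j) = rf_const c" if "i < n" "j < n" for i j
    using mP[OF that] const[OF _ that] by (simp add: \<mu>1)
  then obtain P0 where P0: "P0 \<in> carrier_mat n n" "P = map_mat rf_const P0"
    using constant_matrix[OF P] by metis
  note cg = constant_gauge[OF \<mu>1 A' B0(1) P0(1) BP(1)[unfolded B0(2) P0(2)] dB[unfolded B0(2)]]
  have "l1 - l2 \<notin> \<int> - {0}" if "eigenvalue A' l1" "eigenvalue A' l2" for l1 l2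
  proof -
    have "l1 \<in> \<Lambda>" "l2 \<in> \<Lambda>"
      using that A'\<Lambda> unfolding eigenvalue_upper_triangular[OF A' class_triangular_upper[OF ct]] by blast+
    thus ?thesis using \<Lambda>(1) by auto
  qed
  thus ?thesis using A' cg(2,3) g[unfolded B0(2)] by blast
qed

lemma laurent_expansion_is_mono:
  assumes "f = rf_const \<beta> * xp c" "c \<notin> \<int> \<longrightarrow> \<beta> = 0"
  shows "laurent_expansion f (\<lambda>m. if of_int m = c then \<beta> else 0)"
proof (cases "\<beta> = 0")
  case True
  thus ?thesis using assms(1) by (simp add: laurent_expansion_def rf_const_0)
next
  case False
  then obtain k where k: "c = of_int k" using assms(2) by (auto elim: Ints_cases)
  have "{m. (if of_int m = c then \<beta> else 0) \<noteq> 0} = {k}" using False k by auto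
  thus ?thesis using assms(1) by (simp add: laurent_expansion_def k xp_of_int)
qed

text \<open>With \<open>B' = (\<beta>\<^sub>i\<^sub>j x\<^sup>m\<^sup>(\<^sup>i\<^sup>,\<^sup>j\<^sup>))\<close> the matrix \<open>T = (\<beta>\<^sub>i\<^sub>j)\<close> is \<open>B'\<close> evaluated at \<open>x = 1\<close>; it conjugates
  \<open>A' + D\<close> to \<open>q A'\<close>, where \<open>D\<close> records the exponent occurring in each column of \<open>B'\<close>.\<close>
lemma case_M_normal_form:
  fixes \<delta> \<sigma> :: "'c::{alg_closed_field, field_char_0} ratfun \<Rightarrow> 'c ratfun"
  assumes M: "case_M q \<delta> \<sigma> \<mu>" and A: "A \<in> carrier_mat n n" and B: "B \<in> GL n"
    and cons: "consistent \<delta> \<sigma> \<mu> A B"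
  shows "\<exists>A' \<in> carrier_mat n n. \<exists>B' \<in> GL n. gauge_equivalent \<delta> \<sigma> n A B (map_mat rf_const A') B' \<and>
     (\<forall>l. eigenvalue A' l \<longrightarrow> (\<exists>r::rat. l = of_rat r \<and> 0 \<le> r \<and> r < 1)) \<and>
     (\<exists>D \<in> carrier_mat n n.
        diagonalisable_mat D \<and> (\<forall>d. eigenvalue D d \<longrightarrow> d \<in> \<int>) \<and>
        D * A' = A' * D \<and> similar_mat (A' + D) (of_nat q \<cdot>\<^sub>m A')) \<and>
     B' \<in> GL_laurent n \<and>
     (\<forall>m \<in> laurent_exponents B'.
        \<exists>l1 l2. eigenvalue A' l1 \<and> eigenvalue A' l2 \<and> of_int m = of_nat q * l1 - l2)"
proof -
  have Bc: "B \<in> carrier_mat n n" using B by (simp add: GL_def)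
  obtain Bi where Bi: "Bi \<in> carrier_mat n n" "B * Bi = 1\<^sub>m n" "Bi * B = 1\<^sub>m n" using B by (rule GL_E)
  have \<mu>: "\<mu> = q" and \<sigma>: "\<sigma> = rf_subst (monom 1 q)"
    and \<delta>: "\<delta> = (\<lambda>f. to_fract [:0, 1:] * rf_deriv f)" and q: "q \<ge> 2"
    using M by (auto simp: case_M_def rf_X_def)
  have us: "\<exists>w k. pcompose [:0, 1:] (monom 1 q) * w = ([:0, 1:] :: 'c poly) ^ k"
    by (intro exI[of _ 1] exI[of _ q]) (simp add: pcompose_pCons monom_altdef)
  interpret system_cases \<delta> \<sigma> "[:0, 1:]" "monom 1 q" \<mu> n
      "\<lambda>i j. A $$ (i, j)" "\<lambda>i j. B $$ (i, j)" "\<lambda>i j. Bi $$ (i, j)"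
    by (rule system_cases_matrix[OF _ \<delta> \<sigma> _ case_M_commute(1)[OF M] _ us separating_M[OF _ q] A Bc Bi cons])
      (use q in \<open>auto simp: \<mu> degree_monom_eq\<close>)
  have tors: "tors v" if "v \<in> LL" for v by (rule torsion_case_M[OF refl q refl that])
  obtain \<Lambda> :: "'c set" where \<Lambda>0: "(\<forall>x\<in>\<Lambda>. \<forall>y\<in>\<Lambda>. x - y \<in> \<int> \<longrightarrow> x = y) \<and>
    (\<forall>z. \<exists>k. z + of_int k \<in> \<Lambda>) \<and> (\<forall>x\<in>\<Lambda>. x \<in> \<rat> \<longrightarrow> (\<exists>r. x = of_rat r \<and> 0 \<le> r \<and> r < 1))"
    by (rule exE[OF residue_representatives[where 'c = 'c]])
  have \<Lambda>: "\<And>x y. x \<in> \<Lambda> \<Longrightarrow> y \<in> \<Lambda> \<Longrightarrow> x - y \<in> \<int> \<Longrightarrow> x = y" "\<And>z. \<exists>k. z + of_int k \<in> \<Lambda>"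
    using \<Lambda>0 by simp_all
  have \<Lambda>rat: "\<And>x. x \<in> \<Lambda> \<Longrightarrow> x \<in> \<rat> \<Longrightarrow> \<exists>r. x = of_rat r \<and> 0 \<le> r \<and> r < 1"
    using \<Lambda>0 by simp
  obtain A' B' P where ct: "class_triangular n A'" and A'\<Lambda>: "\<And>i. i < n \<Longrightarrow> A' $$ (i, i) \<in> \<Lambda>"
    and B': "B' \<in> carrier_mat n n" and P: "P \<in> carrier_mat n n"
    and BP: "B' * P = 1\<^sub>m n" "P * B' = 1\<^sub>m n"
    and g: "gauge_equivalent \<delta> \<sigma> n A B (map_mat rf_const A') B'"
    and dB: "map_mat \<delta> B' = map_mat rf_const (of_nat \<mu> \<cdot>\<^sub>m A') * B' - B' * map_mat rf_const A'"
    and mB: "\<And>i j. i < n \<Longrightarrow> j < n \<Longrightarrow> is_mono (of_nat \<mu> * A' $$ (i, i) - A' $$ (j, j)) (B' $$ (i, j))"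
    and mP: "\<And>i j. i < n \<Longrightarrow> j < n \<Longrightarrow> is_mono (A' $$ (i, i) - of_nat \<mu> * A' $$ (j, j)) (P $$ (i, j))"
    by (rule normal_form_QM[OF refl tors A Bc Bi refl refl \<Lambda>]) (assumption | rule that)+
  have A': "A' \<in> carrier_mat n n" using ct by (simp add: class_triangular_def)
  define l where "l = (\<lambda>i. A' $$ (i, i))"
  have cls: "l i = l j" if "i < n" "j < n" "A' $$ (i, j) \<noteq> 0" for i j
    using ct that unfolding class_triangular_def l_def by (cases "i = j") auto
  have ev: "eigenvalue A' x \<longleftrightarrow> (\<exists>i<n. x = l i)" for x
    unfolding l_def by (rule eigenvalue_upper_triangular[OF A' class_triangular_upper[OF ct]])
  \<comment> \<open>The exponent of x in the entry (i, j) of B'; the entry (j, i) of the inverse P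
    has the opposite exponent.\<close>
  define ex where "ex = (\<lambda>i j. of_nat q * l i - l j)"
  have "\<forall>i j. \<exists>\<beta>. i < n \<longrightarrow> j < n \<longrightarrow> B' $$ (i, j) = rf_const \<beta> * xp (ex i j) \<and> (ex i j \<notin> \<int> \<longrightarrow> \<beta> = 0)"
    using mB unfolding is_mono_def \<mu> ex_def l_def by blast
  then obtain \<beta> where \<beta>': "\<forall>i j. i < n \<longrightarrow> j < n \<longrightarrow> B' $$ (i, j) = rf_const (\<beta> i j) * xp (ex i j) \<and>
    (ex i j \<notin> \<int> \<longrightarrow> \<beta> i j = 0)" by metis
  hence \<beta>: "\<And>i j. i < n \<Longrightarrow> j < n \<Longrightarrow> B' $$ (i, j) = rf_const (\<beta> i j) * xp (ex i j)"
    "\<And>i j. i < n \<Longrightarrow> j < n \<Longrightarrow> \<beta> i j \<noteq> 0 \<Longrightarrow> ex i j \<in> \<int>" by blast+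
  have "\<forall>i j. \<exists>\<beta>. i < n \<longrightarrow> j < n \<longrightarrow> P $$ (i, j) = rf_const \<beta> * xp (- ex j i) \<and> (- ex j i \<notin> \<int> \<longrightarrow> \<beta> = 0)"
    using mP unfolding is_mono_def \<mu> ex_def l_def minus_diff_eq by blast
  then obtain \<gamma> where \<gamma>': "\<forall>i j. i < n \<longrightarrow> j < n \<longrightarrow> P $$ (i, j) = rf_const (\<gamma> i j) * xp (- ex j i) \<and>
    (- ex j i \<notin> \<int> \<longrightarrow> \<gamma> i j = 0)" by metis
  hence \<gamma>: "\<And>i j. i < n \<Longrightarrow> j < n \<Longrightarrow> P $$ (i, j) = rf_const (\<gamma> i j) * xp (- ex j i)"
    "\<And>i j. i < n \<Longrightarrow> j < n \<Longrightarrow> \<gamma> i j \<noteq> 0 \<Longrightarrow> - ex j i \<in> \<int>" by blast+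
  define T where "T = mat n n (\<lambda>(i, j). \<beta> i j)"
  define T' where "T' = mat n n (\<lambda>(i, j). \<gamma> i j)"
  have T: "T \<in> carrier_mat n n" and T': "T' \<in> carrier_mat n n" by (auto simp: T_def T'_def)
  \<comment> \<open>All terms of the entry (i, j) of B' P carry the same monomial, with exponent q
    l_i - q l_j; this nonzero factor is cancelled in the comparison with the identity
    matrix.\<close>
  have TT': "T * T' = 1\<^sub>m n"
  proof (rule eq_matI)
    fix i j assume "i < dim_row (1\<^sub>m n)" "j < dim_col (1\<^sub>m n)"
    hence ij: "i < n" "j < n" by auto
    let ?c = "of_nat q * l i - of_nat q * l j"
    have "B' $$ (i, k) * P $$ (k, j) = rf_const (\<beta> i k * \<gamma> k j) * xp ?c" if k: "k < n" for k
    proof (cases "\<beta> i k = 0 \<or> \<gamma> k j = 0")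
      case True
      thus ?thesis using \<beta>(1)[OF ij(1) k] \<gamma>(1)[OF k ij(2)] by (auto simp: rf_const_0)
    next
      case False
      have "?c = ex i k + - ex j k" by (simp add: ex_def)
      hence "xp ?c = xp (ex i k) * xp (- ex j k)"
        using xp_add[OF \<beta>(2)[OF ij(1) k] \<gamma>(2)[OF k ij(2)]] False by simp
      thus ?thesis using \<beta>(1)[OF ij(1) k] \<gamma>(1)[OF k ij(2)] by (simp add: rf_const_mult)
    qed
    hence "(B' * P) $$ (i, j) = rf_const (\<Sum>k<n. \<beta> i k * \<gamma> k j) * xp ?c"
      unfolding mult_mat_entry[OF B' P ij] by (simp add: rf_const_sum sum_distrib_right)
    also have "(\<Sum>k<n. \<beta> i k * \<gamma> k j) = (T * T') $$ (i, j)"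
      unfolding mult_mat_entry[OF T T' ij] using ij by (intro sum.cong) (auto simp: T_def T'_def)
    finally have e: "rf_const ((T * T') $$ (i, j)) * xp ?c = 1\<^sub>m n $$ (i, j)" unfolding BP ..
    show "(T * T') $$ (i, j) = 1\<^sub>m n $$ (i, j)"
    proof (cases "i = j")
      case True
      hence "rf_const ((T * T') $$ (i, j)) = rf_const 1" using e ij by (simp add: xp_0 rf_const_1)
      hence "(T * T') $$ (i, j) = 1" unfolding rf_const_eq_iff .
      thus ?thesis using True ij by simp
    next
      case False
      hence "rf_const ((T * T') $$ (i, j)) = rf_const 0"
        using e ij xp_nz[of ?c] by (simp add: rf_const_0 del: index_mult_mat(1))
      hence "(T * T') $$ (i, j) = 0" unfolding rf_const_eq_iff .
      thus ?thesis using False ij by simp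
    qed
  qed (use T T' in auto)
  have T'T: "T' * T = 1\<^sub>m n" by (rule mat_mult_left_right_inverse[OF T T' TT'])
  \<comment> \<open>Since T is invertible, no column vanishes. So every l_j is congruent to some q
    l_i, the hypothesis of \<open>finite_expanding_residues\<close>.\<close>
  have col: "\<exists>i<n. \<beta> i j \<noteq> 0" if j: "j < n" for j
  proof (rule ccontr)
    assume neg: "\<not> (\<exists>i<n. \<beta> i j \<noteq> 0)"
    have "(T' * T) $$ (j, j) = (\<Sum>k<n. T' $$ (j, k) * T $$ (k, j))" by (rule mult_mat_entry[OF T' T j j])
    also have "\<dots> = 0" using neg j by (intro sum.neutral) (auto simp: T_def)
    finally show False unfolding T'T using j by simp
  qed
  have nonres: "x = y" if "x \<in> l ` {..<n}" "y \<in> l ` {..<n}" "x - y \<in> \<int>" for x y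
    using that A'\<Lambda> \<Lambda>(1) unfolding l_def by blast
  have pre: "\<exists>y\<in>l ` {..<n}. of_nat q * y - x \<in> \<int>" if x: "x \<in> l ` {..<n}" for x
  proof -
    obtain j where j: "j < n" "x = l j" using x by blast
    obtain i where i: "i < n" "\<beta> i j \<noteq> 0" using col[OF j(1)] by blast
    have "of_nat q * l i - x \<in> \<int>" using \<beta>(2)[OF i(1) j(1) i(2)] unfolding ex_def j(2) .
    thus ?thesis using i(1) by blast
  qed
  have inj: "l i = l j" if ij: "i < n" "j < n" "of_nat q * l i - of_nat q * l j \<in> \<int>" for i j
  proof (rule finite_expanding_residues(1)[where E = "l ` {..<n}" and q = q])
    show "x = y" if "x \<in> l ` {..<n}" "y \<in> l ` {..<n}" "x - y \<in> \<int>" for x y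
      using that by (rule nonres)
    show "\<exists>y\<in>l ` {..<n}. of_nat q * y - x \<in> \<int>" if "x \<in> l ` {..<n}" for x
      using that by (rule pre)
  qed (use ij q in auto)
  have rat: "l i \<in> \<rat>" if i: "i < n" for i
  proof (rule finite_expanding_residues(2)[where E = "l ` {..<n}" and q = q])
    show "x = y" if "x \<in> l ` {..<n}" "y \<in> l ` {..<n}" "x - y \<in> \<int>" for x y
      using that by (rule nonres)
    show "\<exists>y\<in>l ` {..<n}. of_nat q * y - x \<in> \<int>" if "x \<in> l ` {..<n}" for x
      using that by (rule pre)
  qed (use i q in auto)
  have "\<forall>j. \<exists>d i. j < n \<longrightarrow> i < n \<and> of_int d = ex i j"
    using col \<beta>(2) by (metis Ints_cases)
  then obtain d i0 where d: "\<And>j. j < n \<Longrightarrow> i0 j < n \<and> of_int (d j) = ex (i0 j) j" by metis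
  \<comment> \<open>Integral exponents in rows i and i' of one column make q l_i - q l_i' integral,
    hence l_i = l_i' by \<open>inj\<close>: the exponent of a nonzero entry depends on its column
    only.\<close>
  have exd: "ex i j = of_int (d j)" if "i < n" "j < n" "\<beta> i j \<noteq> 0" for i j
  proof -
    have "ex i j - of_int (d j) \<in> \<int>" using \<beta>(2)[OF that] by (intro Ints_diff) auto
    hence "of_nat q * l i - of_nat q * l (i0 j) \<in> \<int>" using d[OF that(2)] by (simp add: ex_def)
    hence "l i = l (i0 j)" using inj that d by blast
    thus ?thesis using d[OF that(2)] by (simp add: ex_def)
  qed
  \<comment> \<open>Columns with equal eigenvalue have equal exponents, which makes D commute with
    A'.\<close>
  have dl: "d i = d j" if "i < n" "j < n" "l i = l j" for i j
  proof -
    have di: "of_int (d i) = ex (i0 i) i" "of_int (d j) = ex (i0 j) j" using d that by blast+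
    have "of_nat q * l (i0 i) - of_nat q * l (i0 j) = of_int (d i - d j)"
      unfolding of_int_diff di ex_def that(3) by simp
    hence "of_nat q * l (i0 i) - of_nat q * l (i0 j) \<in> \<int>" by simp
    hence "l (i0 i) = l (i0 j)" using inj d that by blast
    hence "ex (i0 i) i = ex (i0 j) j" using that(3) by (simp add: ex_def)
    hence "of_int (d i) = (of_int (d j) :: 'c)" unfolding di .
    thus ?thesis by simp
  qed
  define D where "D = mat n n (\<lambda>(i, j). if i = j then of_int (d j) else (0 :: 'c))"
  have D: "D \<in> carrier_mat n n" by (simp add: D_def)
  have multD: "(N * D) $$ (i, j) = N $$ (i, j) * of_int (d j)"
    if "N \<in> carrier_mat n n" "i < n" "j < n" for N i j
  proof -
    have "(N * D) $$ (i, j) = (\<Sum>k<n. if k = j then N $$ (i, j) * of_int (d j) else 0)"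
      unfolding mult_mat_entry[OF that(1) D that(2,3)] using that by (intro sum.cong) (auto simp: D_def)
    thus ?thesis using that by simp
  qed
  have Dmult: "(D * N) $$ (i, j) = of_int (d i) * N $$ (i, j)"
    if "N \<in> carrier_mat n n" "i < n" "j < n" for N i j
  proof -
    have "(D * N) $$ (i, j) = (\<Sum>k<n. if k = i then of_int (d i) * N $$ (i, j) else 0)"
      unfolding mult_mat_entry[OF D that(1) that(2,3)] using that by (intro sum.cong) (auto simp: D_def)
    thus ?thesis using that by simp
  qed
  have comm: "D * A' = A' * D"
  proof (rule eq_matI)
    fix i j assume "i < dim_row (A' * D)" "j < dim_col (A' * D)"
    hence ij: "i < n" "j < n" using A' D by auto
    show "(D * A') $$ (i, j) = (A' * D) $$ (i, j)"
      unfolding multD[OF A' ij] Dmult[OF A' ij] using cls[OF ij] dl[OF ij] by (cases "A' $$ (i, j) = 0") auto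
  qed (use A' D in auto)
  have qA': "of_nat q \<cdot>\<^sub>m A' \<in> carrier_mat n n" using A' by simp
  have AD: "A' + D \<in> carrier_mat n n" using A' D by simp
  \<comment> \<open>Each entry of \<delta>(B') = q A' B' - B' A' is divided by its monomial. On B'
    the derivation multiplies column j by d_j, so what remains is T D = q A' T - T A'.\<close>
  have rel: "T * (A' + D) = (of_nat q \<cdot>\<^sub>m A') * T"
  proof (rule eq_matI)
    fix i j assume "i < dim_row ((of_nat q \<cdot>\<^sub>m A') * T)" "j < dim_col ((of_nat q \<cdot>\<^sub>m A') * T)"
    hence ij: "i < n" "j < n" using A' T by auto
    have c1: "map_mat rf_const (of_nat q \<cdot>\<^sub>m A') \<in> carrier_mat n n" "map_mat rf_const A' \<in> carrier_mat n n"
      using A' by auto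
    have "\<delta> (B' $$ (i, j)) = (map_mat rf_const (of_nat q \<cdot>\<^sub>m A') * B') $$ (i, j)
        - (B' * map_mat rf_const A') $$ (i, j)"
      using arg_cong[OF dB, of "\<lambda>M. M $$ (i, j)"] ij B' A' \<mu> by (simp del: index_mult_mat(1))
    also have "(map_mat rf_const (of_nat q \<cdot>\<^sub>m A') * B') $$ (i, j)
        = (\<Sum>k<n. rf_const ((of_nat q \<cdot>\<^sub>m A') $$ (i, k) * T $$ (k, j)) * xp (ex i j))"
      unfolding mult_mat_entry[OF c1(1) B' ij]
    proof (rule sum.cong)
      fix k assume "k \<in> {..<n}"
      hence k: "k < n" by simp
      show "map_mat rf_const (of_nat q \<cdot>\<^sub>m A') $$ (i, k) * B' $$ (k, j)
          = rf_const ((of_nat q \<cdot>\<^sub>m A') $$ (i, k) * T $$ (k, j)) * xp (ex i j)"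
      proof (cases "A' $$ (i, k) = 0")
        case True
        thus ?thesis using ij k A' by (simp add: rf_const_0)
      next
        case False
        hence "ex i j = ex k j" using cls[OF ij(1) k] by (simp add: ex_def)
        thus ?thesis using ij k A' \<beta>(1)[OF k ij(2)] by (simp add: T_def rf_const_mult)
      qed
    qed simp
    also have "\<dots> = rf_const (((of_nat q \<cdot>\<^sub>m A') * T) $$ (i, j)) * xp (ex i j)"
      unfolding mult_mat_entry[OF qA' T ij] by (simp add: rf_const_sum sum_distrib_right)
    also have "(B' * map_mat rf_const A') $$ (i, j)
        = (\<Sum>k<n. rf_const (T $$ (i, k) * A' $$ (k, j)) * xp (ex i j))"
      unfolding mult_mat_entry[OF B' c1(2) ij]
    proof (rule sum.cong)
      fix k assume "k \<in> {..<n}"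
      hence k: "k < n" by simp
      show "B' $$ (i, k) * map_mat rf_const A' $$ (k, j) = rf_const (T $$ (i, k) * A' $$ (k, j)) * xp (ex i j)"
      proof (cases "A' $$ (k, j) = 0")
        case True
        thus ?thesis using ij k A' by (simp add: rf_const_0)
      next
        case False
        hence "ex i j = ex i k" using cls[OF k ij(2)] by (simp add: ex_def)
        thus ?thesis using ij k A' \<beta>(1)[OF ij(1) k] by (simp add: T_def rf_const_mult)
      qed
    qed simp
    also have "\<dots> = rf_const ((T * A') $$ (i, j)) * xp (ex i j)"
      unfolding mult_mat_entry[OF T A' ij] by (simp add: rf_const_sum sum_distrib_right)
    finally have e: "\<delta> (B' $$ (i, j)) = rf_const (((of_nat q \<cdot>\<^sub>m A') * T) $$ (i, j)) * xp (ex i j)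
        - rf_const ((T * A') $$ (i, j)) * xp (ex i j)" .
    have "\<delta> (B' $$ (i, j)) = rf_const (T $$ (i, j) * of_int (d j)) * xp (ex i j)"
    proof (cases "\<beta> i j = 0")
      case True
      thus ?thesis using \<beta>(1)[OF ij] ij by (simp add: T_def rf_const_0)
    next
      case False
      have "\<delta> (rf_const (\<beta> i j) * rf_X powi d j) = rf_const (\<beta> i j * of_int (d j)) * rf_X powi d j"
        by (simp add: \<delta>_mult \<delta>_X_powi[OF refl] rf_const_mult)
      thus ?thesis using \<beta>(1)[OF ij] ij exd[OF ij False] by (simp add: T_def xp_of_int)
    qed
    hence "rf_const (((of_nat q \<cdot>\<^sub>m A') * T) $$ (i, j)) * xp (ex i j)
        = rf_const ((T * A') $$ (i, j) + T $$ (i, j) * of_int (d j)) * xp (ex i j)"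
      unfolding e rf_const_add by (simp add: algebra_simps del: index_mult_mat(1))
    hence "rf_const (((of_nat q \<cdot>\<^sub>m A') * T) $$ (i, j)) = rf_const ((T * A') $$ (i, j) + T $$ (i, j) * of_int (d j))"
      using xp_nz[of "ex i j"] by (simp del: index_mult_mat(1))
    hence "((of_nat q \<cdot>\<^sub>m A') * T) $$ (i, j) = (T * A') $$ (i, j) + (T * D) $$ (i, j)"
      unfolding rf_const_eq_iff multD[OF T ij] .
    also have "\<dots> = (T * (A' + D)) $$ (i, j)"
      unfolding mult_add_distrib_mat[OF T A' D] using ij T A' D by (simp del: index_mult_mat(1))
    finally show "(T * (A' + D)) $$ (i, j) = ((of_nat q \<cdot>\<^sub>m A') * T) $$ (i, j)" ..
  qed (use A' T D in auto)
  have "similar_mat (A' + D) (of_nat q \<cdot>\<^sub>m A')"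
  proof (rule similar_matI)
    show "{A' + D, of_nat q \<cdot>\<^sub>m A', T', T} \<subseteq> carrier_mat n n" using AD qA' T T' by simp
    have "T' * (of_nat q \<cdot>\<^sub>m A') * T = T' * ((of_nat q \<cdot>\<^sub>m A') * T)" by (rule assoc_mult_mat[OF T' qA' T])
    also have "\<dots> = A' + D" unfolding rel[symmetric] by (rule cancel_left_mat[OF T' T AD T'T])
    finally show "A' + D = T' * (of_nat q \<cdot>\<^sub>m A') * T" ..
  qed (rule T'T, rule TT')
  moreover have "diagonalisable_mat D"
    unfolding diagonalisable_mat_def
    by (intro exI[of _ D] conjI similar_mat_refl[OF D]) (auto simp: diagonal_mat_def D_def)
  moreover have "x \<in> \<int>" if e: "eigenvalue D x" for x
  proof -
    have "upper_triangular D" by (auto simp: upper_triangular_def D_def)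
    then obtain i where "i < n" "x = D $$ (i, i)"
      using e eigenvalue_upper_triangular[OF D] by blast
    thus ?thesis by (simp add: D_def)
  qed
  moreover have "B' \<in> GL_laurent n"
  proof -
    have "f \<in> laurent_polys" if f: "f \<in> elements_mat B'" for f
    proof -
      obtain i j where ij: "i < n" "j < n" "f = B' $$ (i, j)" using elements_matD[OF f] B' by auto
      thus ?thesis unfolding laurent_polys_def using laurent_expansion_is_mono \<beta>' by blast
    qed
    moreover have "f \<in> laurent_polys" if f: "f \<in> elements_mat P" for f
    proof -
      obtain i j where ij: "i < n" "j < n" "f = P $$ (i, j)" using elements_matD[OF f] P by auto
      thus ?thesis unfolding laurent_polys_def using laurent_expansion_is_mono \<gamma>' by blast
    qed
    ultimately show ?thesis unfolding GL_laurent_def using B' P BP by blast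
  qed
  moreover have "\<exists>l1 l2. eigenvalue A' l1 \<and> eigenvalue A' l2 \<and> of_int m = of_nat q * l1 - l2"
    if m: "m \<in> laurent_exponents B'" for m
  proof -
    obtain f c where f: "f \<in> elements_mat B'" "laurent_expansion f c" "c m \<noteq> 0"
      using m unfolding laurent_exponents_def by blast
    obtain i j where ij: "i < n" "j < n" "f = B' $$ (i, j)" using elements_matD[OF f(1)] B' by auto
    have "laurent_expansion f (\<lambda>m. if of_int m = ex i j then \<beta> i j else 0)"
      using laurent_expansion_is_mono \<beta>' ij by blast
    hence "c = (\<lambda>m. if of_int m = ex i j then \<beta> i j else 0)" by (rule laurent_expansion_unique[OF f(2)])
    hence "of_int m = ex i j" using f(3) by (auto split: if_splits)
    thus ?thesis unfolding ev ex_def using ij by blast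
  qed
  moreover have "\<exists>r::rat. x = of_rat r \<and> 0 \<le> r \<and> r < 1" if e: "eigenvalue A' x" for x
  proof -
    obtain i where i: "i < n" "x = l i" using e ev by blast
    thus ?thesis using \<Lambda>rat[OF A'\<Lambda>[OF i(1)]] rat[OF i(1)] by (simp add: l_def)
  qed
  moreover have "B' \<in> GL n" by (rule GL_I[OF B' P BP])
  ultimately show ?thesis using A' D comm g by blast
qed

lemma rf_subst_eqD:
  "rf_subst s = rf_subst t \<Longrightarrow> degree s > 0 \<Longrightarrow> degree t > 0 \<Longrightarrow> s = t"
  by (metis rf_subst_X to_fract_eq_iff)

text \<open>The final conclusion has one implication for each case, and in case M for each q, so
  those not at hand must be vacuous. \<sigma>(x) determines s and thereby the case, and \<mu>
  determines q in case M.\<close>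

lemma cases_exclusive:
  fixes \<delta> \<sigma> :: "'c::field ratfun \<Rightarrow> 'c ratfun"
  shows "case_S \<delta> \<sigma> \<mu> \<Longrightarrow> \<not> case_Q q \<delta> \<sigma> \<mu>" "case_S \<delta> \<sigma> \<mu> \<Longrightarrow> \<not> case_M p \<delta> \<sigma> \<mu>"
    "case_Q q \<delta> \<sigma> \<mu> \<Longrightarrow> \<not> case_M p \<delta> \<sigma> \<mu>" "case_M p \<delta> \<sigma> \<mu> \<Longrightarrow> case_M p' \<delta> \<sigma> \<mu> \<Longrightarrow> p = p'"
proof -
  show "\<not> case_Q q \<delta> \<sigma> \<mu>" if "case_S \<delta> \<sigma> \<mu>"
    using that rf_subst_eqD[of "[:1, 1:]" "[:0, q:]"] by (auto simp: case_S_def case_Q_def)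
  have deg: "degree (monom 1 p :: 'c poly) = p" by (simp add: degree_monom_eq)
  show "\<not> case_M p \<delta> \<sigma> \<mu>" if "case_S \<delta> \<sigma> \<mu>"
    using that rf_subst_eqD[of "[:1, 1:]" "monom 1 p"] deg
    by (auto simp: case_S_def case_M_def dest: arg_cong[of _ _ degree])
  show "\<not> case_M p \<delta> \<sigma> \<mu>" if "case_Q q \<delta> \<sigma> \<mu>"
    using that rf_subst_eqD[of "[:0, q:]" "monom 1 p"] deg
    by (auto simp: case_Q_def case_M_def dest: arg_cong[of _ _ degree])
  show "p = p'" if "case_M p \<delta> \<sigma> \<mu>" "case_M p' \<delta> \<sigma> \<mu>" using that by (simp add: case_M_def)
qed

theorem theorem2:
  fixes \<delta> \<sigma> :: "'c::{alg_closed_field, field_char_0} ratfun \<Rightarrow> 'c ratfun"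
    and \<mu> n :: nat
    and A B :: "'c ratfun mat"
  assumes "case_S \<delta> \<sigma> \<mu> \<or> (\<exists>q. case_Q q \<delta> \<sigma> \<mu>) \<or> (\<exists>q. case_M q \<delta> \<sigma> \<mu>)"
    and "A \<in> carrier_mat n n"
    and "B \<in> GL n"
    and "consistent \<delta> \<sigma> \<mu> A B"
  shows "\<exists>(A' :: 'c mat) (B' :: 'c ratfun mat).
    A' \<in> carrier_mat n n \<and> B' \<in> GL n \<and>
    gauge_equivalent \<delta> \<sigma> n A B (map_mat rf_const A') B' \<and>
    (case_S \<delta> \<sigma> \<mu> \<longrightarrow>
       diagonal_mat A' \<and>
       (\<exists>B0 \<in> GL n. B' = map_mat rf_const B0 \<and> upper_triangular B0 \<and> B0 * A' = A' * B0)) \<and>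
    ((\<exists>q. case_Q q \<delta> \<sigma> \<mu>) \<longrightarrow>
       (\<forall>l1 l2. eigenvalue A' l1 \<and> eigenvalue A' l2 \<longrightarrow> l1 - l2 \<notin> \<int> - {0}) \<and>
       (\<exists>B0 \<in> GL n. B' = map_mat rf_const B0 \<and> B0 * A' = A' * B0)) \<and>
    (\<forall>q. case_M q \<delta> \<sigma> \<mu> \<longrightarrow>
       (\<forall>l. eigenvalue A' l \<longrightarrow> (\<exists>r::rat. l = of_rat r \<and> 0 \<le> r \<and> r < 1)) \<and>
       (\<exists>D \<in> carrier_mat n n.
          diagonalisable_mat D \<and> (\<forall>d. eigenvalue D d \<longrightarrow> d \<in> \<int>) \<and>
          D * A' = A' * D \<and> similar_mat (A' + D) (of_nat q \<cdot>\<^sub>m A')) \<and>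
       B' \<in> GL_laurent n \<and>
       (\<forall>m \<in> laurent_exponents B'.
          \<exists>l1 l2. eigenvalue A' l1 \<and> eigenvalue A' l2 \<and> of_int m = of_nat q * l1 - l2))"
proof -
  have GL_map: "map_mat rf_const B0 \<in> GL n" if gl: "B0 \<in> GL n" for B0 :: "'c mat"
  proof -
    have B0: "B0 \<in> carrier_mat n n" using gl by (simp add: GL_def)
    obtain N where N: "N \<in> carrier_mat n n" "B0 * N = 1\<^sub>m n" "N * B0 = 1\<^sub>m n" using gl by (rule GL_E)
    show ?thesis
    proof (rule GL_I)
      show "map_mat rf_const B0 * map_mat rf_const N = 1\<^sub>m n"
        unfolding rf_const_hom.mat_hom_mult[OF B0 N(1), symmetric] N by (rule rf_const_hom.mat_hom_one)
      show "map_mat rf_const N * map_mat rf_const B0 = 1\<^sub>m n"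
        unfolding rf_const_hom.mat_hom_mult[OF N(1) B0, symmetric] N by (rule rf_const_hom.mat_hom_one)
    qed (use B0 N in auto)
  qed
  from assms(1) consider (S) "case_S \<delta> \<sigma> \<mu>" | (Q) q where "case_Q q \<delta> \<sigma> \<mu>" | (M) q where "case_M q \<delta> \<sigma> \<mu>"
    by blast
  thus ?thesis
  proof cases
    case S
    obtain A' B0 where h: "A' \<in> carrier_mat n n" "B0 \<in> GL n" "diagonal_mat A'" "upper_triangular B0"
      "B0 * A' = A' * B0" "gauge_equivalent \<delta> \<sigma> n A B (map_mat rf_const A') (map_mat rf_const B0)"
      using case_S_normal_form[OF S assms(2-4)] by blast
    show ?thesis
      by (rule exI[of _ A'], rule exI[of _ "map_mat rf_const B0"])
        (use h GL_map[OF h(2)] cases_exclusive(1,2)[OF S] in auto)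
  next
    case Q
    obtain A' B0 where h: "A' \<in> carrier_mat n n" "B0 \<in> GL n"
      "\<forall>l1 l2. eigenvalue A' l1 \<and> eigenvalue A' l2 \<longrightarrow> l1 - l2 \<notin> \<int> - {0}"
      "B0 * A' = A' * B0" "gauge_equivalent \<delta> \<sigma> n A B (map_mat rf_const A') (map_mat rf_const B0)"
      using case_Q_normal_form[OF Q assms(2-4)] by blast
    have "\<not> case_S \<delta> \<sigma> \<mu>" "\<And>p. \<not> case_M p \<delta> \<sigma> \<mu>" using cases_exclusive Q by blast+
    thus ?thesis
      by (intro exI[of _ A'] exI[of _ "map_mat rf_const B0"])
        (use h GL_map[OF h(2)] in auto)
  next
    case M
    have "\<not> case_S \<delta> \<sigma> \<mu>" "\<And>p. \<not> case_Q p \<delta> \<sigma> \<mu>" "\<And>p. case_M p \<delta> \<sigma> \<mu> \<Longrightarrow> p = q"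
      using cases_exclusive M by blast+
    thus ?thesis using case_M_normal_form[OF M assms(2-4)] by blast
  qed
qed

end
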